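(* Let $\kappa_1>0$ and $\kappa_2<0$ be real numbers. Then there exists $\lambda_0>0$ such that for every $\lambda>\lambda_0$ there exists $\omega^\lambda\in L^\infty(D)$ satisfying: (1) $\omega^\lambda=\omega^\lambda_1+\omega^\lambda_2$, where $\omega^\lambda_1=\lambda I_{\{\psi^\lambda>\mu^\lambda_1\}}$ and $\omega^\lambda_2=-\lambda I_{\{\psi^\lambda<-\mu^\lambda_2\}}$ for some $\mu^\lambda_1,\mu^\lambda_2>0$ depending on $\lambda$, with $\psi^\lambda=G\omega^\lambda$; (2) $\int_D\omega^\lambda_1\,d\mathbf{x}=\kappa_1$ and $\int_D\omega^\lambda_2\,d\mathbf{x}=\kappa_2$; (3) $\omega^\lambda$ is even in $x_1$: $\omega^\lambda(\mathbf{x})=\omega^\lambda(\bar{\mathbf{x}})$; (4) $\mathrm{diam}(\mathrm{supp}(\omega^\lambda_1)),\ \mathrm{diam}(\mathrm{supp}(\omega^\lambda_2))\le C\lambda^{-1/2}$, where $C>0$ does not depend on $\lambda$; (5) $\lim_{\lambda\to+\infty}\left|\frac1{\kappa_1}\int_D\mathbf{x}\,\omega^\lambda_1(\mathbf{x})d\mathbf{x}-P\right|=0$ and $\lim_{\lambda\to+\infty}\left|\frac1{\kappa_2}\int_D\mathbf{x}\,\omega^\lambda_2(\mathbf{x})d\mathbf{x}-Q\right|=0$, where $P=(0,p)$ and $Q=(0,q)$ are two points of $D$ with $p>0$, $q<0$ depending only on $\kappa_2/\kappa_1$.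
   Context: $D$ is the open unit disk in $\mathbb{R}^2$ centered at the origin; for $\mathbf{x}=(x_1,x_2)$, $\bar{\mathbf{x}}=(-x_1,x_2)$. $G$ is the Green's function of $-\Delta$ in $D$ with zero Dirichlet boundary condition, and $G\omega(\mathbf{x})=\int_DG(\mathbf{x},\mathbf{y})\omega(\mathbf{y})d\mathbf{y}$. $I_A$ is the characteristic function of $A$. *)

theory Defs
  imports "HOL-Analysis.Analysis"
begin

type_synonym pt = "real \<times> real"

definition D :: "pt set" where
  "D = ball 0 1"

text \<open>Green's function of -Laplacian on the unit disk, Dirichlet condition:
  G(x,y) = (1/(2 pi)) ln( |y| |x - y/|y|^2| / |x - y| ), written in the form
  (1/(4 pi)) ln( (|x|^2 |y|^2 - 2 x.y + 1) / |x - y|^2 ), valid also for y = 0.\<close>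
definition Green :: "pt \<Rightarrow> pt \<Rightarrow> real" where
  "Green x y = (1 / (4 * pi)) *
     ln ((norm x ^ 2 * norm y ^ 2 - 2 * (x \<bullet> y) + 1) / norm (x - y) ^ 2)"

definition Gop :: "(pt \<Rightarrow> real) \<Rightarrow> pt \<Rightarrow> real" where
  "Gop \<omega> x = (LINT y:D|lebesgue. Green x y * \<omega> y)"

definition reflect :: "pt \<Rightarrow> pt" where
  "reflect x = (- fst x, snd x)"

end

theory Submission
  imports Defs "HOL-Complex_Analysis.Great_Picard"
begin

text \<open>
  Write \<open>\<omega> = f - g\<close> and maximise the energy over all pairs of densities \<open>0 \<le> f, g \<le> \<lambda>\<close> with masses
  \<open>\<kappa>\<^sub>1\<close>, \<open>- \<kappa>\<^sub>2\<close> that are foliated Schwarz symmetric about the upper and the lower half of the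
  \<open>x\<^sub>2\<close>-axis. This class is convex and weakly closed, so a maximiser exists. Since \<open>G\<close> decreases
  under reflection of one argument in a line through the origin, \<open>\<psi>\<close> inherits the symmetry; hence
  superlevel sets of \<open>\<psi>\<close> are admissible and the maximiser satisfies the bathtub principle among
  all densities. Comparison with two small discs shows \<open>\<psi> \<ge> \<kappa>\<^sub>1 ln \<lambda> / (4 \<pi>) - C\<close> on the support
  of \<open>f\<close>, which forces supports of diameter \<open>O(\<lambda> powr (-1/2))\<close>, away from each other and from the
  boundary. Then \<open>f\<close> and \<open>g\<close> cannot both be invariant under a further reflection, so \<open>\<psi>\<close> is strictly
  monotone along circles about \<open>0\<close>; its level sets are therefore null, and \<open>f\<close>, \<open>g\<close> are patches.
  Finally the bathtub principle tested with small vertical translates of \<open>f\<close> gives, as the logarithmic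
  self-interaction is even in the translation, that the centres of mass asymptotically solve the
  critical point equations of the Kirchhoff--Routh function on the axis, whose solution is unique.
\<close>

section \<open>Reflections and the logarithmic kernel\<close>

text \<open>Building the symmetry into the class replaces rearrangement inequalities: it remains to
  check that the class is weakly closed and contains suitable increasing functions of the stream
  function \<open>\<psi> = V f - V g\<close>. As the bathtub competitor is such a function, the
  constraint leaves no multiplier behind, and afterwards every density of the same height and mass
  may be a competitor, even an asymmetric translate. The second obstacle is regularity: the usual
  arguments for null level sets and for the location of the centres differentiate \<psi>. Here
  \<psi> is never differentiated. Level sets are handled through the equality case of the reflection
  inequality, and the location through finite translations of length \<open>l powr (-4)\<close>,
  short enough for the self-interaction error \<open>l * t powr (3/2)\<close> to be negligible
  against \<open>t\<close>. The singular part of every logarithm is dominated by the kernel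
  \<open>|z| powr (-3/2)\<close>, whose rescaled potential on a density of height \<open>l\<close>
  is a constant at the scale \<open>l powr (-1/2)\<close>; this keeps the estimates uniform in
  \<open>l\<close>.\<close>

definition mirror :: "pt \<Rightarrow> pt \<Rightarrow> pt" where
  "mirror e x = x - (2 * (x \<bullet> e)) *\<^sub>R e"

lemma inner_unit [simp]: "norm (e::pt) = 1 \<Longrightarrow> e \<bullet> e = 1"
  by (simp add: dot_square_norm)

lemma mirror_inner_unit: "norm e = 1 \<Longrightarrow> mirror e x \<bullet> e = - (x \<bullet> e)"
  by (simp add: mirror_def inner_simps)

lemma mirror_mirror [simp]: "norm e = 1 \<Longrightarrow> mirror e (mirror e x) = x"
  by (simp add: mirror_def inner_simps algebra_simps)

lemma mirror_inner_mirror [simp]: "norm e = 1 \<Longrightarrow> mirror e x \<bullet> mirror e y = x \<bullet> y"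
  by (simp add: mirror_def inner_simps inner_commute algebra_simps)

lemma norm_mirror [simp]: "norm e = 1 \<Longrightarrow> norm (mirror e x) = norm x"
  by (simp add: norm_eq_sqrt_inner[of "mirror e x"] norm_eq_sqrt_inner[of "x"])

lemma mirror_diff: "mirror e (x - y) = mirror e x - mirror e y"
  by (simp add: mirror_def inner_simps algebra_simps)

lemma mirror_in_D [simp]: "norm e = 1 \<Longrightarrow> mirror e x \<in> D \<longleftrightarrow> x \<in> D"
  by (simp add: D_def)

lemma mirror_measurable [measurable]: "mirror e \<in> borel \<rightarrow>\<^sub>M borel"
  unfolding mirror_def by measurable

text \<open>For \<open>p \<noteq> 0\<close> the map is resolved into one-dimensional affine
  substitutions: with \<open>y\<close> fixed, \<open>u = p * x + q * y\<close> contributes the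
  factor \<open>|p|\<close>; after exchanging the integrals, \<open>y\<close> enters only through
  \<open>- y / p\<close> and the factor is compensated. For \<open>p = 0\<close> the map swaps the
  coordinates up to sign.\<close>

lemma nn_integral_reflection_matrix:
  fixes f :: "pt \<Rightarrow> ennreal"
  assumes [measurable]: "f \<in> borel_measurable borel" and pq: "p\<^sup>2 + q\<^sup>2 = (1::real)"
  shows "(\<integral>\<^sup>+z. f (p * fst z + q * snd z, q * fst z - p * snd z) \<partial>lborel) = (\<integral>\<^sup>+z. f z \<partial>lborel)"
proof -
  have [measurable]: "f \<in> borel_measurable (lborel \<Otimes>\<^sub>M lborel)"
    by (simp add: lborel_prod)
  show ?thesis
  proof (cases "p = 0")
  case True
  then have q: "q = 1 \<or> q = -1"
    using pq by (simp add: power2_eq_1_iff)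
  have q1: "\<bar>q\<bar> = 1" "q \<noteq> 0"
    using q by auto
  have "(\<integral>\<^sup>+z. f (p * fst z + q * snd z, q * fst z - p * snd z) \<partial>lborel)
      = (\<integral>\<^sup>+y. \<integral>\<^sup>+x. f (q * y, 0 + q * x) \<partial>lborel \<partial>lborel)"
    unfolding lborel_prod[symmetric] by (subst lborel_pair.nn_integral_snd[symmetric]) (simp_all add: True)
  also have "\<dots> = (\<integral>\<^sup>+y. \<integral>\<^sup>+x. f (0 + q * y, x) \<partial>lborel \<partial>lborel)"
  proof -
    have "(\<integral>\<^sup>+x. f (q * y, 0 + q * x) \<partial>lborel) = (\<integral>\<^sup>+x. f (0 + q * y, x) \<partial>lborel)" for y
      using q1 nn_integral_real_affine[of "\<lambda>x. f (q * y, x)" q 0] by simp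
    then show ?thesis by presburger
  qed
  also have "\<dots> = (\<integral>\<^sup>+y. \<integral>\<^sup>+x. f (y, x) \<partial>lborel \<partial>lborel)"
    using q1 by (simp add: nn_integral_real_affine[of "\<lambda>y. \<integral>\<^sup>+x. f (y, x) \<partial>lborel" q 0])
  also have "\<dots> = (\<integral>\<^sup>+z. f z \<partial>lborel)"
    unfolding lborel_prod[symmetric] by (subst lborel.nn_integral_fst[symmetric]) simp_all
  finally show ?thesis .
next
  case False
  have eq: "q * x - p * y = (q / p) * (q * y + p * x) - y / p" for x y
  proof -
    have "(q / p) * (q * y + p * x) - y / p = q * x + (q\<^sup>2 - 1) / p * y"
      using False by (simp add: field_simps power2_eq_square)
    also have "q\<^sup>2 - 1 = - p\<^sup>2" using pq by simp
    finally show ?thesis using False by (simp add: power2_eq_square)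
  qed
  have "(\<integral>\<^sup>+z. f (p * fst z + q * snd z, q * fst z - p * snd z) \<partial>lborel)
      = ennreal \<bar>p\<bar> * (ennreal \<bar>1/p\<bar> * (\<integral>\<^sup>+y. \<integral>\<^sup>+x. f (p * x + q * y, q * x - p * y) \<partial>lborel \<partial>lborel))"
    unfolding lborel_prod[symmetric] using False
    by (subst lborel_pair.nn_integral_snd[symmetric])
       (simp_all add: mult.assoc[symmetric] ennreal_mult[symmetric])
  also have "(\<integral>\<^sup>+y. \<integral>\<^sup>+x. f (p * x + q * y, q * x - p * y) \<partial>lborel \<partial>lborel)
      = (\<integral>\<^sup>+y. \<integral>\<^sup>+x. f (q * y + p * x, (q / p) * (q * y + p * x) - y / p) \<partial>lborel \<partial>lborel)"
    by (simp add: eq add.commute)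
  also have "ennreal \<bar>p\<bar> * (ennreal \<bar>1/p\<bar> * \<dots>)
      = ennreal \<bar>1/p\<bar> * (\<integral>\<^sup>+y. ennreal \<bar>p\<bar> * (\<integral>\<^sup>+x. f (q * y + p * x, (q / p) * (q * y + p * x) - y / p) \<partial>lborel) \<partial>lborel)"
    by (subst nn_integral_cmult) (simp_all add: mult_ac)
  also have "\<dots> = ennreal \<bar>1/p\<bar> * (\<integral>\<^sup>+y. (\<integral>\<^sup>+u. f (u, (q / p) * u - y / p) \<partial>lborel) \<partial>lborel)"
    using False by (subst nn_integral_real_affine[where c=p, symmetric]) simp_all
  also have "\<dots> = ennreal \<bar>1/p\<bar> * (\<integral>\<^sup>+u. (\<integral>\<^sup>+y. f (u, (q / p) * u - y / p) \<partial>lborel) \<partial>lborel)"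
    by (subst lborel_pair.Fubini') simp_all
  also have "\<dots> = (\<integral>\<^sup>+u. ennreal \<bar>-(1/p)\<bar> * (\<integral>\<^sup>+y. f (u, (q / p) * u + -(1/p) * y) \<partial>lborel) \<partial>lborel)"
    by (subst nn_integral_cmult) (simp_all)
  also have "\<dots> = (\<integral>\<^sup>+u. \<integral>\<^sup>+y. f (u, y) \<partial>lborel \<partial>lborel)"
    using False by (subst nn_integral_real_affine[where c="-(1/p)", symmetric]) simp_all
  also have "\<dots> = (\<integral>\<^sup>+z. f z \<partial>lborel)"
    unfolding lborel_prod[symmetric] by (subst lborel.nn_integral_fst[symmetric]) simp_all
  finally show ?thesis .
qed
qed

text \<open>For \<open>e = (c, s)\<close> the matrix of \<open>mirror e\<close> is symmetric and
  trace-free, with first row \<open>1 - 2 * c\<^sup>2\<close>, \<open>- 2 * c * s\<close>; this is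
  the form treated before.\<close>

lemma nn_integral_mirror:
  fixes f :: "pt \<Rightarrow> ennreal"
  assumes [measurable]: "f \<in> borel_measurable borel" and e: "norm e = 1"
  shows "(\<integral>\<^sup>+x. f (mirror e x) \<partial>lborel) = (\<integral>\<^sup>+x. f x \<partial>lborel)"
proof -
  obtain c s where cs: "e = (c, s)" by force
  have 1: "c\<^sup>2 + s\<^sup>2 = 1"
    using e by (simp add: cs norm_Pair)
  have "(1 - 2 * c\<^sup>2)\<^sup>2 + (- 2 * c * s)\<^sup>2 = 1 - 4 * c\<^sup>2 * (1 - (c\<^sup>2 + s\<^sup>2))"
    by (simp add: power2_eq_square algebra_simps)
  then have pq: "(1 - 2 * c\<^sup>2)\<^sup>2 + (- 2 * c * s)\<^sup>2 = 1"
    using 1 by simp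
  have "s * s = 1 - c * c" using 1 by (simp add: power2_eq_square)
  then have s2: "1 - 2 * c\<^sup>2 = - (1 - 2 * s\<^sup>2)"
    by (simp add: power2_eq_square)
  have "mirror e z = ((1 - 2 * c\<^sup>2) * fst z + (- 2 * c * s) * snd z, (- 2 * c * s) * fst z + (1 - 2 * s\<^sup>2) * snd z)" for z
    by (cases z) (simp add: cs mirror_def inner_prod_def algebra_simps power2_eq_square)
  then have "mirror e z = ((1 - 2 * c\<^sup>2) * fst z + (- 2 * c * s) * snd z, (- 2 * c * s) * fst z - (1 - 2 * c\<^sup>2) * snd z)" for z
    unfolding s2 by (metis mult_minus_left diff_minus_eq_add)
  then have "(\<integral>\<^sup>+x. f (mirror e x) \<partial>lborel) = (\<integral>\<^sup>+z. f ((1 - 2 * c\<^sup>2) * fst z + (- 2 * c * s) * snd z, (- 2 * c * s) * fst z - (1 - 2 * c\<^sup>2) * snd z) \<partial>lborel)"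
    by presburger
  then show ?thesis
    using nn_integral_reflection_matrix[OF assms(1) pq] by presburger
qed

lemma distr_mirror:
  assumes e: "norm e = 1"
  shows "distr lborel borel (mirror e) = lborel"
proof (rule measure_eqI)
  fix A assume "A \<in> sets (distr lborel borel (mirror e))"
  then have [measurable]: "A \<in> sets borel" by simp
  have "emeasure (distr lborel borel (mirror e)) A = (\<integral>\<^sup>+x. indicator A x \<partial>distr lborel borel (mirror e))"
    by simp
  also have "\<dots> = (\<integral>\<^sup>+x. indicator A (mirror e x) \<partial>lborel)"
    by (subst nn_integral_distr) simp_all
  also have "\<dots> = emeasure lborel A"
    by (subst nn_integral_mirror[OF _ e]) simp_all
  finally show "emeasure (distr lborel borel (mirror e)) A = emeasure lborel A" .
qed simp

lemma integral_mirror: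
  fixes f :: "pt \<Rightarrow> 'b::{banach, second_countable_topology}"
  assumes [measurable]: "f \<in> borel_measurable borel" and e: "norm e = 1"
  shows "(LINT x|lborel. f (mirror e x)) = (LINT x|lborel. f x)"
  by (subst (2) distr_mirror[OF e, symmetric], subst integral_distr) simp_all

lemma integrable_mirror:
  fixes f :: "pt \<Rightarrow> 'b::{banach, second_countable_topology}"
  assumes f: "integrable lborel f" and e: "norm e = 1"
  shows "integrable lborel (\<lambda>x. f (mirror e x))"
  using f by (subst (asm) distr_mirror[OF e, symmetric], subst (asm) integrable_distr_eq) simp_all

lemma AE_mirror:
  assumes [measurable]: "Measurable.pred borel P" and e: "norm e = 1" and "AE x in lborel. P x"
  shows "AE x in lborel. P (mirror e x)"
  using assms(3) by (subst (asm) distr_mirror[OF e, symmetric], subst (asm) AE_distr_iff) simp_all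

lemma integral_translate:
  fixes f :: "pt \<Rightarrow> 'b::{banach, second_countable_topology}"
  assumes [measurable]: "f \<in> borel_measurable borel"
  shows "(LINT x|lborel. f (c + x)) = (LINT x|lborel. f x)"
  by (subst (2) lborel_distr_plus[of c, symmetric], subst integral_distr) simp_all

lemma integrable_translate:
  fixes f :: "pt \<Rightarrow> 'b::{banach, second_countable_topology}"
  assumes f: "integrable lborel f"
  shows "integrable lborel (\<lambda>x. f (c + x))"
  using f by (subst (asm) lborel_distr_plus[of c, symmetric], subst (asm) integrable_distr_eq) simp_all

text \<open>The inequality \<open>\<bar>z\<bar>\<^sup>2 \<ge> \<bar>z\<^sub>1\<bar> \<bar>z\<^sub>2\<bar>\<close> reduces integrability of the kernel to one dimension.\<close>

lemma nn_integral_powr_1d: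
  assumes "r > 0"
  shows "(\<integral>\<^sup>+x. ennreal (indicator {-r..r} x * \<bar>x\<bar> powr (-3/4)) \<partial>lborel) \<le> ennreal (8 * r powr (1/4))"
proof -
  have I: "(\<integral>\<^sup>+x. ennreal (x powr (-3/4)) * indicator {0..r} x \<partial>lborel) = ennreal (4 * r powr (1/4))"
  proof -
    have "((\<lambda>x. x powr (-3/4)) has_integral (r powr (-3/4 + 1) / (-3/4 + 1))) {0..r}"
      by (rule has_integral_powr_from_0) (use assms in auto)
    then have "((\<lambda>x. x powr (-3/4)) has_integral (4 * r powr (1/4))) {0..r}"
      by (simp add: mult.commute)
    from nn_integral_has_integral_lborel[OF _ _ has_integral_restrict_UNIV[THEN iffD2, OF this]]
    have "(\<integral>\<^sup>+x. ennreal (if x \<in> {0..r} then x powr (-3/4) else 0) \<partial>lborel) = ennreal (4 * r powr (1/4))"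
      by simp
    moreover have "(\<integral>\<^sup>+x. ennreal (x powr (-3/4)) * indicator {0..r} x \<partial>lborel)
      = (\<integral>\<^sup>+x. ennreal (if x \<in> {0..r} then x powr (-3/4) else 0) \<partial>lborel)"
      by (intro nn_integral_cong) (auto simp: indicator_def)
    ultimately show ?thesis by simp
  qed
  have "(\<integral>\<^sup>+x. ennreal (indicator {-r..r} x * \<bar>x\<bar> powr (-3/4)) \<partial>lborel)
     \<le> (\<integral>\<^sup>+x. ennreal (x powr (-3/4)) * indicator {0..r} x + ennreal ((0 + (-1) * x) powr (-3/4)) * indicator {0..r} (0 + (-1) * x) \<partial>lborel)"
    by (intro nn_integral_mono) (auto simp: indicator_def)
  also have "\<dots> = ennreal (4 * r powr (1/4)) + (\<integral>\<^sup>+x. ennreal ((0 + (-1) * x) powr (-3/4)) * indicator {0..r} (0 + (-1) * x) \<partial>lborel)"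
    unfolding I[symmetric] by (rule nn_integral_add) measurable
  also have "(\<integral>\<^sup>+x. ennreal ((0 + (-1) * x) powr (-3/4)) * indicator {0..r} (0 + (-1) * x) \<partial>lborel) = ennreal (4 * r powr (1/4))"
  proof -
    define F where "F = (\<lambda>x. ennreal (x powr (-3/4)) * indicator {0..r} x)"
    have [measurable]: "F \<in> borel_measurable borel"
      unfolding F_def by measurable
    have "(\<integral>\<^sup>+x. F (0 + (-1) * x) \<partial>lborel) = (\<integral>\<^sup>+x. F x \<partial>lborel)"
      using nn_integral_real_affine[of F "-1" 0] by simp
    then show ?thesis using I unfolding F_def by metis
  qed
  finally show ?thesis
    by (simp add: ennreal_plus[symmetric] del: ennreal_plus)
qed

lemma nn_integral_norm_powr:
  assumes "r > 0"
  shows "(\<integral>\<^sup>+z. ennreal (indicator (ball 0 r) z * norm (z::pt) powr (-3/2)) \<partial>lborel) \<le> ennreal (64 * sqrt r)"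
proof -
  let ?k = "\<lambda>x. indicator {-r..r} x * \<bar>x\<bar> powr (-3/4)"
  have le: "indicator (ball 0 r) z * norm z powr (-3/2) \<le> ?k (fst z) * ?k (snd z)"
    if "fst z \<noteq> 0" "snd z \<noteq> 0" for z :: pt
  proof (cases "z \<in> ball 0 r")
    case True
    have n: "\<bar>fst z\<bar> \<le> norm z" "\<bar>snd z\<bar> \<le> norm z"
      using norm_fst_le[of "fst z" "snd z"] norm_snd_le[of "snd z" "fst z"] by auto
    have "norm z powr (-3/2) = norm z powr (-3/4) * norm z powr (-3/4)"
      by (simp add: powr_add[symmetric])
    also have "\<dots> \<le> \<bar>fst z\<bar> powr (-3/4) * \<bar>snd z\<bar> powr (-3/4)"
      using that n by (intro mult_mono powr_mono2') auto
    finally show ?thesis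
      using True n by (auto simp: indicator_def)
  qed (simp add: indicator_def)
  \<comment> \<open>The axes are removed because \<open>0 powr (-3/4) = 0\<close>: there the product
    bound would fail.\<close>
  have ae: "AE z in lborel. fst z \<noteq> 0 \<and> snd (z::pt) \<noteq> 0"
  proof -
    have ne0: "AE x in lborel. x \<noteq> (0::real)"
      using AE_lborel_singleton[of "0::real"] by simp
    then have "AE x in lborel. AE y in lborel. x \<noteq> (0::real) \<and> y \<noteq> (0::real)"
      by (auto elim: eventually_mono)
    then have "AE z in lborel \<Otimes>\<^sub>M lborel. fst z \<noteq> (0::real) \<and> snd z \<noteq> (0::real)"
    proof (intro lborel_pair.AE_pair_measure)
      show "{z \<in> space (lborel \<Otimes>\<^sub>M lborel). fst z \<noteq> (0::real) \<and> snd z \<noteq> (0::real)} \<in> sets (lborel \<Otimes>\<^sub>M lborel)"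
        by measurable
    qed simp
    then show ?thesis unfolding lborel_prod .
  qed
  have [measurable]: "(ball 0 r :: pt set) \<in> sets borel" by simp
  have "(\<integral>\<^sup>+z. ennreal (indicator (ball 0 r) z * norm (z::pt) powr (-3/2)) \<partial>lborel)
     \<le> (\<integral>\<^sup>+z. ennreal (?k (fst z)) * ennreal (?k (snd z)) \<partial>lborel)"
  proof (rule nn_integral_mono_AE)
    show "AE z in lborel. ennreal (indicator (ball 0 r) z * norm (z::pt) powr (-3/2)) \<le> ennreal (?k (fst z)) * ennreal (?k (snd z))"
      using ae
    proof eventually_elim
      case (elim z)
      then have "ennreal (indicator (ball 0 r) z * norm z powr (-3/2)) \<le> ennreal (?k (fst z) * ?k (snd z))"
        by (intro ennreal_leI le) auto
      then show ?case by (subst ennreal_mult[symmetric]) simp_all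
    qed
  qed
  also have "\<dots> = (\<integral>\<^sup>+x. \<integral>\<^sup>+y. ennreal (?k x) * ennreal (?k y) \<partial>lborel \<partial>lborel)"
    unfolding lborel_prod[symmetric] by (subst lborel.nn_integral_fst[symmetric]) simp_all
  also have "\<dots> = (\<integral>\<^sup>+x. ennreal (?k x) \<partial>lborel) * (\<integral>\<^sup>+y. ennreal (?k y) \<partial>lborel)"
    by (simp add: nn_integral_cmult nn_integral_multc)
  also have "\<dots> \<le> ennreal (8 * r powr (1/4)) * ennreal (8 * r powr (1/4))"
    by (intro mult_mono nn_integral_powr_1d assms) auto
  also have "\<dots> = ennreal (64 * sqrt r)"
    using assms by (simp add: ennreal_mult[symmetric] powr_half_sqrt[symmetric] powr_add[symmetric])
  finally show ?thesis .
qed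

text \<open>Any exponent strictly between -2 and 0 dominates a logarithm at the origin and is
  integrable there; -3/2 splits evenly between the two coordinates. The cut-off makes the integral
  over the plane finite, and \<open>r powr (3/2) * ker r\<close> is the scale-invariant
  version.\<close>

definition ker :: "real \<Rightarrow> pt \<Rightarrow> real" where
  "ker r z = indicator (ball 0 r) z * norm z powr (-3/2)"

lemma ker_nonneg [simp]: "0 \<le> ker r z"
  by (simp add: ker_def)

lemma ker_measurable [measurable]: "ker r \<in> borel_measurable borel"
proof -
  have [measurable]: "(ball 0 r :: pt set) \<in> sets borel" by simp
  show ?thesis unfolding ker_def[abs_def] by measurable
qed

lemma ker_integrable: "r > 0 \<Longrightarrow> integrable lborel (ker r)"
  using nn_integral_norm_powr[of r]
  by (intro integrableI_bounded) (auto simp: ker_def le_less_trans[OF _ ennreal_less_top])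

lemma ker_integral: "r > 0 \<Longrightarrow> (LINT z|lborel. ker r z) \<le> 64 * sqrt r"
  using nn_integral_norm_powr[of r]
  by (subst integral_eq_nn_integral) (auto intro!: enn2real_leI simp: ker_def)

lemma ker_minus: "ker r (x - y) = ker r (y - x)"
  by (simp add: ker_def norm_minus_commute indicator_def)

lemma ker_shift_integrable: "r > 0 \<Longrightarrow> integrable lborel (\<lambda>y. ker r (x - y))"
  using integrable_translate[OF ker_integrable, of r "-x"] by (subst ker_minus) simp

lemma ker_shift_integral: "r > 0 \<Longrightarrow> (LINT y|lborel. ker r (x - y)) \<le> 64 * sqrt r"
  using integral_translate[of "ker r" "-x"] ker_integral[of r] by (subst ker_minus) simp

section \<open>Weak sequential compactness\<close>

lemma tendsto_sums_dominated:
  fixes f :: "nat \<Rightarrow> nat \<Rightarrow> real"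
  assumes lim: "\<And>i. (\<lambda>n. f n i) \<longlonglongrightarrow> l i" and bd: "\<And>n i. \<bar>f n i\<bar> \<le> h i" and h: "summable h"
    and s: "\<And>n. f n sums F n"
  shows "summable l" and "F \<longlonglongrightarrow> (\<Sum>i. l i)"
proof -
  have "\<bar>l i\<bar> \<le> h i" for i
    by (rule tendsto_upperbound[OF tendsto_rabs[OF lim]]) (auto simp: bd)
  then show "summable l"
    by (intro summable_comparison_test'[OF h, of 0]) auto
  have "(\<lambda>n. \<Sum>i. f n i) \<longlonglongrightarrow> (\<Sum>i. l i)"
  proof -
    have "eventually (\<lambda>(i, n). norm (f n i) \<le> h i) (at_top \<times>\<^sub>F sequentially)"
      using bd by (intro always_eventually) auto
    from tannerys_theorem[of "\<lambda>i n. f n i" l sequentially h, OF lim this h] show ?thesis by simp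
  qed
  moreover have "(\<lambda>n. \<Sum>i. f n i) = F"
    using s by (auto simp: sums_iff)
  ultimately show "F \<longlonglongrightarrow> (\<Sum>i. l i)" by simp
qed

text \<open>The functions are treated as densities of measures. A diagonal argument makes the masses
  of countably many sets converge, Dynkin's theorem extends this to all Borel sets, and the limit
  set function is a measure dominated by \<open>L\<close> times Lebesgue measure on
  \<open>S\<close>, so that Radon-Nikodym produces \<open>g\<close>. Integrable test functions are
  then reached from indicators.\<close>

lemma weak_sequential_compactness:
  fixes f :: "nat \<Rightarrow> 'a::euclidean_space \<Rightarrow> real"
  assumes f[measurable]: "\<And>n. f n \<in> borel_measurable borel"
    and bd: "\<And>n x. 0 \<le> f n x" "\<And>n x. f n x \<le> L"
    and S[measurable]: "S \<in> sets borel" and Sfin: "emeasure lborel S < \<infinity>"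
    and off: "\<And>n x. x \<notin> S \<Longrightarrow> f n x = 0"
  obtains r g where "strict_mono (r::nat \<Rightarrow> nat)" "g \<in> borel_measurable borel"
    "\<And>x. 0 \<le> g x" "\<And>x. g x \<le> L" "\<And>x. x \<notin> S \<Longrightarrow> g x = 0"
    "\<And>\<phi>. integrable lborel \<phi> \<Longrightarrow> (\<lambda>n. LINT x|lborel. \<phi> x * f (r n) x) \<longlonglongrightarrow> (LINT x|lborel. \<phi> x * g x)"
proof -
  have L: "0 \<le> L" using bd[of 0 undefined] by linarith
  define \<nu> where "\<nu> n = density lborel (\<lambda>x. ennreal (f n x))" for n
  have fb: "f n x \<le> L * indicator S x" for n x
    using bd off[of x n] by (auto simp: indicator_def)
  have em: "emeasure (\<nu> n) A \<le> ennreal L * emeasure lborel (A \<inter> S)" if [measurable]: "A \<in> sets borel" for n A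
  proof -
    have "emeasure (\<nu> n) A = (\<integral>\<^sup>+x. ennreal (f n x) * indicator A x \<partial>lborel)"
      by (simp add: \<nu>_def emeasure_density)
    also have "\<dots> \<le> (\<integral>\<^sup>+x. ennreal L * indicator (A \<inter> S) x \<partial>lborel)"
    proof (intro nn_integral_mono)
      fix x
      show "ennreal (f n x) * indicator A x \<le> ennreal L * indicator (A \<inter> S) x"
        using bd(2)[of n x] off[of x n] by (cases "x \<in> A"; cases "x \<in> S") (simp_all add: ennreal_leI)
    qed
    also have "\<dots> = ennreal L * emeasure lborel (A \<inter> S)"
      by (subst nn_integral_cmult_indicator) auto
    finally show ?thesis .
  qed
  have AS: "emeasure lborel (A \<inter> S) < \<infinity>" if "A \<in> sets borel" for A
    by (rule le_less_trans[OF emeasure_mono Sfin]) auto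
  have fin: "finite_measure (\<nu> n)" for n
  proof
    show "emeasure (\<nu> n) (space (\<nu> n)) \<noteq> \<infinity>"
      using em[of UNIV n] Sfin by (auto simp: \<nu>_def ennreal_mult_eq_top_iff top_unique)
  qed
  have me: "measure (\<nu> n) A \<le> L * measure lborel (A \<inter> S)" if A: "A \<in> sets borel" for n A
  proof -
    have "enn2real (emeasure (\<nu> n) A) \<le> enn2real (ennreal L * emeasure lborel (A \<inter> S))"
      using em[OF A, of n] AS[OF A] by (intro enn2real_mono) (auto simp: ennreal_mult_less_top)
    then show ?thesis using L by (simp add: measure_def enn2real_mult)
  qed
  have mi: "measure (\<nu> n) A = (LINT x|lborel. indicator A x * f n x)" if [measurable]: "A \<in> sets borel" for n A
  proof -
    have "emeasure (\<nu> n) A = (\<integral>\<^sup>+x. ennreal (indicator A x * f n x) \<partial>lborel)"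
      by (simp add: \<nu>_def emeasure_density) (intro nn_integral_cong, simp add: indicator_def)
    then show ?thesis
      using bd by (simp add: measure_def integral_eq_nn_integral)
  qed
  have sets\<nu>: "sets (\<nu> n) = sets borel" for n
    by (simp add: \<nu>_def)
  define B where "B = (SOME B::'a set set. countable B \<and> topological_basis B)"
  have B: "countable B" "topological_basis B"
    using someI_ex[OF ex_countable_basis] unfolding B_def by auto
  \<comment> \<open>Closing a countable base under finite intersections keeps it countable and makes
    it an intersection-stable generator of the Borel sets.\<close>
  define C where "C = Inter ` {F. finite F \<and> F \<subseteq> B}"
  have Ccount: "countable C"
    unfolding C_def by (intro countable_image countable_Collect_finite_subset B)
  have BC: "B \<subseteq> C"
  proof
    fix b assume "b \<in> B"
    then show "b \<in> C" unfolding C_def by (intro image_eqI[of _ _ "{b}"]) auto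
  qed
  have UC: "UNIV \<in> C"
    unfolding C_def by (intro image_eqI[of _ _ "{}"]) auto
  have Copen: "open c" if "c \<in> C" for c
    using that B(2) unfolding C_def by (auto intro!: open_Inter dest: topological_basis_open)
  have "topological_basis C"
    using B(2) BC Copen unfolding topological_basis_def by (meson subset_trans)
  then have bC: "sets borel = sigma_sets UNIV C"
    using borel_eq_countable_basis[OF Ccount] by (metis sets_measure_of Pow_UNIV top_greatest)
  have IntC: "Int_stable C"
    unfolding Int_stable_def C_def
  proof safe
    fix F G assume "finite F" "F \<subseteq> B" "finite G" "G \<subseteq> B"
    then show "\<Inter> F \<inter> \<Inter> G \<in> Inter ` {F. finite F \<and> F \<subseteq> B}"
      by (intro image_eqI[of _ _ "F \<union> G"]) auto
  qed
  have "norm (measure (\<nu> n) A) \<le> L * measure lborel S" if "A \<in> C" for n A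
  proof -
    have "A \<in> sets borel" using Copen[OF that] by simp
    then have "measure (\<nu> n) A \<le> L * measure lborel (A \<inter> S)" by (rule me)
    also have "\<dots> \<le> L * measure lborel S"
      using L Sfin \<open>A \<in> sets borel\<close> by (intro mult_left_mono measure_mono_fmeasurable) (auto simp: fmeasurable_def)
    finally show ?thesis by simp
  qed
  from function_convergent_subsequence[where f="\<lambda>n A. measure (\<nu> n) A" and S=C, OF Ccount this]
  obtain r where r: "strict_mono r" "\<And>A. A \<in> C \<Longrightarrow> \<exists>l. (\<lambda>n. measure (\<nu> (r n)) A) \<longlonglongrightarrow> l"
    by metis
  have sumh: "summable (\<lambda>i. L * measure lborel (A i \<inter> S))" if A: "range A \<subseteq> sets borel" "disjoint_family A" for A :: "nat \<Rightarrow> 'a set"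
  proof -
    have "disjoint_family (\<lambda>i. A i \<inter> S)"
      using A(2) by (auto simp: disjoint_family_on_def)
    then have "(\<lambda>i. measure lborel (A i \<inter> S)) sums measure lborel (\<Union>i. A i \<inter> S)"
    proof (intro measure_UNION)
      have "(\<Union>i. A i \<inter> S) \<subseteq> S" by auto
      then have "emeasure lborel (\<Union>i. A i \<inter> S) \<le> emeasure lborel S" by (intro emeasure_mono) auto
      then show "emeasure lborel (\<Union>i. A i \<inter> S) \<noteq> \<infinity>" using Sfin by auto
    qed (use A in auto)
    then show ?thesis by (auto simp: sums_iff intro!: summable_mult)
  qed
  have sumsm: "(\<lambda>i. measure (\<nu> n) (A i)) sums measure (\<nu> n) (\<Union>i. A i)" if "range A \<subseteq> sets borel" "disjoint_family A" for A :: "nat \<Rightarrow> 'a set" and n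
    using that finite_measure.finite_measure_UNION[OF fin] by (simp add: sets\<nu>)
  \<comment> \<open>Complements need the convergence of the total masses; disjoint unions need the
    uniform summable bound \<open>L * measure lborel (A i \<inter> S)\<close>.\<close>
  have conv: "\<exists>l. (\<lambda>n. measure (\<nu> (r n)) A) \<longlonglongrightarrow> l" if "A \<in> sigma_sets UNIV C" for A
    using IntC subset_UNIV[of C, folded Pow_UNIV] that
  proof (induct rule: sigma_sets_induct_disjoint)
    case (compl A)
    then obtain l m where "(\<lambda>n. measure (\<nu> (r n)) A) \<longlonglongrightarrow> l" "(\<lambda>n. measure (\<nu> (r n)) UNIV) \<longlonglongrightarrow> m"
      using r(2)[OF UC] by auto
    moreover have "measure (\<nu> n) (UNIV - A) = measure (\<nu> n) UNIV - measure (\<nu> n) A" for n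
      using finite_measure.finite_measure_compl[OF fin, of A n] compl(1) by (simp add: sets\<nu> bC \<nu>_def)
    ultimately show ?case by (auto intro!: tendsto_diff)
  next
    case (union A)
    then obtain l where l: "\<And>i. (\<lambda>n. measure (\<nu> (r n)) (A i)) \<longlonglongrightarrow> l i" by metis
    have A: "range A \<subseteq> sets borel" using union by (simp add: bC)
    have "(\<lambda>n. measure (\<nu> (r n)) (\<Union>i. A i)) \<longlonglongrightarrow> (\<Sum>i. l i)"
      by (rule tendsto_sums_dominated(2)[OF l _ sumh[OF A union(1)] sumsm[OF A union(1)]])
         (use A me in auto)
    then show ?case by blast
  qed (auto intro: r)
  define l where "l A = lim (\<lambda>n. measure (\<nu> (r n)) A)" for A
  have l: "(\<lambda>n. measure (\<nu> (r n)) A) \<longlonglongrightarrow> l A" if "A \<in> sets borel" for A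
    using conv[of A] that by (auto simp: bC l_def convergent_def dest: limI)
  have l0: "0 \<le> l A" if "A \<in> sets borel" for A
    by (rule tendsto_lowerbound[OF l[OF that]]) auto
  have lle: "l A \<le> L * measure lborel (A \<inter> S)" if "A \<in> sets borel" for A
    by (rule tendsto_upperbound[OF l[OF that]]) (auto simp: me that)
  define N where "N = measure_of UNIV (sets borel) (\<lambda>A. ennreal (l A))"
  have setsN: "sets N = sets borel"
    unfolding N_def by (metis sets.sigma_sets_eq sets_measure_of space_borel top_greatest Pow_UNIV)
  have eN: "emeasure N A = ennreal (l A)" if "A \<in> sets borel" for A
    unfolding N_def
  proof (rule emeasure_measure_of_sigma)
    show "sigma_algebra UNIV (sets (borel::'a measure))"
      by (metis sets.sigma_algebra_axioms space_borel)
    show "positive (sets borel) (\<lambda>A. ennreal (l A))"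
      using lle[of "{}"] l0[of "{}"] by (auto simp: positive_def)
    show "countably_additive (sets borel) (\<lambda>A. ennreal (l A))"
      unfolding countably_additive_def
    proof safe
      fix A :: "nat \<Rightarrow> 'a set" assume A: "range A \<subseteq> sets borel" "disjoint_family A" "\<Union> (range A) \<in> sets borel"
      have lA: "\<And>i. (\<lambda>n. measure (\<nu> (r n)) (A i)) \<longlonglongrightarrow> l (A i)" using A(1) by (intro l) auto
      have "summable (\<lambda>i. l (A i))" "(\<lambda>n. measure (\<nu> (r n)) (\<Union>i. A i)) \<longlonglongrightarrow> (\<Sum>i. l (A i))"
        by (rule tendsto_sums_dominated[OF lA _ sumh[OF A(1,2)] sumsm[OF A(1,2)]];
            use A me in auto)+
      moreover from this(2) l[OF A(3)] have "l (\<Union>i. A i) = (\<Sum>i. l (A i))"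
        by (rule LIMSEQ_unique[symmetric])
      ultimately show "(\<Sum>i. ennreal (l (A i))) = ennreal (l (\<Union> (range A)))"
        using l0 A(1) by (intro suminf_ennreal_eq) (auto simp: sums_iff)
    qed
  qed fact
  have "absolutely_continuous lborel N"
    unfolding absolutely_continuous_def
  proof
    fix A :: "'a set" assume A: "A \<in> null_sets lborel"
    then have [measurable]: "A \<in> sets borel" by auto
    have "A \<inter> S \<in> null_sets lborel" using A by (rule null_set_Int2) auto
    then have "l A = 0"
      using lle[of A] l0[of A] by (simp add: measure_eq_0_null_sets)
    then show "A \<in> null_sets N" by (auto simp: null_sets_def setsN eN)
  qed
  from sigma_finite_measure.Radon_Nikodym[OF sigma_finite_lborel this] setsN obtain h where h[measurable]: "h \<in> borel_measurable borel" and hN: "density lborel h = N"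
    by auto
  have hA: "(\<integral>\<^sup>+x. h x * indicator A x \<partial>lborel) = ennreal (l A)" if "A \<in> sets borel" for A
    using eN[OF that] that by (simp add: hN[symmetric] emeasure_density)
  define U where "U x = ennreal L * indicator S x" for x
  have [measurable]: "U \<in> borel_measurable borel" unfolding U_def by measurable
  \<comment> \<open>On the set where \<open>h\<close> exceeds its bound, the integral of
    \<open>h\<close> is \<open>l A\<close> and hence at most the integral of the bound; so this set
    is null.\<close>
  define A where "A = {x. U x < h x}"
  have [measurable]: "A \<in> sets borel" unfolding A_def by measurable
  have UA: "(\<integral>\<^sup>+x. U x * indicator A x \<partial>lborel) = ennreal (L * measure lborel (A \<inter> S))"
  proof -
    have "(\<integral>\<^sup>+x. U x * indicator A x \<partial>lborel) = (\<integral>\<^sup>+x. ennreal L * indicator (A \<inter> S) x \<partial>lborel)"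
      by (intro nn_integral_cong) (auto simp: U_def indicator_def)
    also have "\<dots> = ennreal (L * measure lborel (A \<inter> S))"
      using L AS[of A] by (subst nn_integral_cmult_indicator) (auto simp: ennreal_mult emeasure_eq_ennreal_measure)
    finally show ?thesis .
  qed
  have "(\<integral>\<^sup>+x. h x * indicator A x - U x * indicator A x \<partial>lborel) = ennreal (l A) - ennreal (L * measure lborel (A \<inter> S))"
  proof -
    have "U x * indicator A x \<le> h x * indicator A x" for x
      by (cases "x \<in> A") (auto simp: A_def)
    then show ?thesis
      by (subst nn_integral_diff) (simp_all add: UA hA)
  qed
  also have "\<dots> = 0"
    using lle[of A] by (simp add: diff_eq_0_iff_ennreal ennreal_leI)
  finally have "AE x in lborel. h x * indicator A x - U x * indicator A x = 0"
    by (subst (asm) nn_integral_0_iff_AE) auto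
  then have hU: "AE x in lborel. h x \<le> U x"
  proof eventually_elim
    case (elim x)
    show ?case
    proof (rule ccontr)
      assume "\<not> h x \<le> U x"
      then have "x \<in> A" by (auto simp: A_def)
      with elim have "h x - U x = 0" by simp
      moreover have "U x \<noteq> top" by (auto simp: U_def indicator_def)
      ultimately show False using \<open>\<not> h x \<le> U x\<close> by (simp add: diff_eq_0_iff_ennreal)
    qed
  qed
  \<comment> \<open>The truncation is a version of \<open>h\<close> for which bounds and support
    hold everywhere, not only almost everywhere.\<close>
  define g where "g x = (if x \<in> S then min L (enn2real (h x)) else 0)" for x
  have g[measurable]: "g \<in> borel_measurable borel" unfolding g_def by measurable
  have gh: "AE x in lborel. h x = ennreal (g x)"
    using hU
  proof eventually_elim
    case (elim x)
    then show ?case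
    proof (cases "x \<in> S")
      case True
      then have "h x \<le> ennreal L" using elim by (simp add: U_def)
      then show ?thesis using True L by (cases "h x") (auto simp: g_def min_def top_unique)
    qed (auto simp: U_def g_def)
  qed
  have gb: "0 \<le> g x" "g x \<le> L" "x \<notin> S \<Longrightarrow> g x = 0" for x
    using L by (auto simp: g_def)
  have gA: "(LINT x|lborel. indicator A x * g x) = l A" if [measurable]: "A \<in> sets borel" for A
  proof -
    have "(\<integral>\<^sup>+x. ennreal (indicator A x * g x) \<partial>lborel) = (\<integral>\<^sup>+x. h x * indicator A x \<partial>lborel)"
      by (rule nn_integral_cong_AE) (use gh in \<open>auto simp: indicator_def elim!: eventually_mono\<close>)
    then show ?thesis
      using gb l0[OF that] by (subst integral_eq_nn_integral) (auto simp: hA that)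
  qed
  have int: "integrable lborel (\<lambda>x. \<phi> x * F x)" if "integrable lborel \<phi>" "F \<in> borel_measurable borel" "\<And>x. 0 \<le> F x" "\<And>x. F x \<le> L" for \<phi> F :: "'a \<Rightarrow> real"
  proof (rule Bochner_Integration.integrable_bound[of _ "\<lambda>x. L * \<bar>\<phi> x\<bar>"])
    show "AE x in lborel. norm (\<phi> x * F x) \<le> norm (L * \<bar>\<phi> x\<bar>)"
    proof (intro always_eventually allI)
      fix x
      have "\<bar>F x\<bar> \<le> L" using that(3,4)[of x] by simp
      then show "norm (\<phi> x * F x) \<le> norm (L * \<bar>\<phi> x\<bar>)" using L
        by (simp add: abs_mult mult.commute mult_right_mono)
    qed
  qed (use that in auto)
  have "(\<lambda>n. LINT x|lborel. \<phi> x * f (r n) x) \<longlonglongrightarrow> (LINT x|lborel. \<phi> x * g x)" if "integrable lborel \<phi>" for \<phi>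
    using that
  proof (induct rule: integrable_induct)
    case (base A c)
    then have [measurable]: "A \<in> sets borel" by simp
    have "(\<lambda>n. c * (LINT x|lborel. indicator A x * f (r n) x)) \<longlonglongrightarrow> c * (LINT x|lborel. indicator A x * g x)"
      using l[of A] by (intro tendsto_mult_left) (simp add: gA mi)
    then show ?case by (simp add: mult.commute[of _ c] mult.assoc)
  next
    case (add \<phi> \<psi>)
    have "(LINT x|lborel. (\<phi> x + \<psi> x) * F x) = (LINT x|lborel. \<phi> x * F x) + (LINT x|lborel. \<psi> x * F x)"
      if "F \<in> borel_measurable borel" "\<And>x. 0 \<le> F x" "\<And>x. F x \<le> L" for F
      using int[OF add(1) that] int[OF add(3) that] by (simp add: distrib_right)
    then show ?case using add(2,4) f bd g gb by (simp add: tendsto_add)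
  next
    case (lim \<phi> s)
    \<comment> \<open>The error of replacing \<phi> by \<open>s i\<close> is uniform over all
      functions with values in \<open>[0, L]\<close>, hence over the whole sequence and its
      limit.\<close>
    have diff: "\<bar>(LINT x|lborel. \<phi> x * F x) - (LINT x|lborel. s i x * F x)\<bar> \<le> L * (LINT x|lborel. \<bar>\<phi> x - s i x\<bar>)"
      if F: "F \<in> borel_measurable borel" "\<And>x. 0 \<le> F x" "\<And>x. F x \<le> L" for F i
    proof -
      have "(LINT x|lborel. \<phi> x * F x) - (LINT x|lborel. s i x * F x) = (LINT x|lborel. \<phi> x * F x - s i x * F x)"
        using int[OF lim(5) F] int[OF lim(1) F] by simp
      also have "\<bar>\<dots>\<bar> \<le> (LINT x|lborel. \<bar>\<phi> x * F x - s i x * F x\<bar>)"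
        by (rule integral_abs_bound)
      also have "\<dots> \<le> (LINT x|lborel. L * \<bar>\<phi> x - s i x\<bar>)"
      proof (rule integral_mono)
        fix x
        have "\<bar>\<phi> x * F x - s i x * F x\<bar> = \<bar>F x\<bar> * \<bar>\<phi> x - s i x\<bar>"
          by (metis abs_mult left_diff_distrib mult.commute)
        also have "\<dots> \<le> L * \<bar>\<phi> x - s i x\<bar>"
          using F(2,3)[of x] by (intro mult_right_mono) auto
        finally show "\<bar>\<phi> x * F x - s i x * F x\<bar> \<le> L * \<bar>\<phi> x - s i x\<bar>" .
      qed (use int[OF lim(5) F] int[OF lim(1) F] lim(1,5) in auto)
      finally show ?thesis by simp
    qed
    have "(\<lambda>i. LINT x|lborel. \<bar>\<phi> x - s i x\<bar>) \<longlonglongrightarrow> (LINT x|(lborel :: 'a measure). (0::real))"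
    proof (rule integral_dominated_convergence[where w="\<lambda>x. 3 * \<bar>\<phi> x\<bar>" and f="\<lambda>x. 0::real" and s="\<lambda>i x. \<bar>\<phi> x - s i x\<bar>" and M=lborel])
      show "AE x in lborel. (\<lambda>i. \<bar>\<phi> x - s i x\<bar>) \<longlonglongrightarrow> 0"
        using lim(3) by (auto intro!: tendsto_eq_intros always_eventually)
      show "AE x in lborel. norm \<bar>\<phi> x - s i x\<bar> \<le> 3 * \<bar>\<phi> x\<bar>" for i
      proof (intro always_eventually allI)
        fix x show "norm \<bar>\<phi> x - s i x\<bar> \<le> 3 * \<bar>\<phi> x\<bar>" using lim(4)[of x i] by simp
      qed
    qed (use lim(1,5) in auto)
    then have d0: "(\<lambda>i. L * (LINT x|lborel. \<bar>\<phi> x - s i x\<bar>)) \<longlonglongrightarrow> 0"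
      using tendsto_mult_left[of _ 0 sequentially L] by simp
    show ?case
    proof (rule LIMSEQ_I)
      fix e :: real assume e: "e > 0"
      have "eventually (\<lambda>i. L * (LINT x|lborel. \<bar>\<phi> x - s i x\<bar>) < e / 3) sequentially"
        using e by (intro order_tendstoD(2)[OF d0]) simp
      then obtain i where i: "L * (LINT x|lborel. \<bar>\<phi> x - s i x\<bar>) < e / 3"
        using eventually_happens' sequentially_bot by blast
      from LIMSEQ_D[OF lim(2)[of i], of "e/3"] e obtain n0 where
        n0: "\<And>n. n \<ge> n0 \<Longrightarrow> \<bar>(LINT x|lborel. s i x * f (r n) x) - (LINT x|lborel. s i x * g x)\<bar> < e / 3"
        by (auto simp: real_norm_def)
      have "norm ((LINT x|lborel. \<phi> x * f (r n) x) - (LINT x|lborel. \<phi> x * g x)) < e" if "n \<ge> n0" for n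
      proof -
        have "\<bar>(LINT x|lborel. \<phi> x * f (r n) x) - (LINT x|lborel. s i x * f (r n) x)\<bar> < e / 3"
          using diff[of "f (r n)" i] bd i by force
        moreover have "\<bar>(LINT x|lborel. \<phi> x * g x) - (LINT x|lborel. s i x * g x)\<bar> < e / 3"
          using diff[of g i] g gb i by force
        ultimately show ?thesis using n0[OF that] unfolding real_norm_def by linarith
      qed
      then show "\<exists>no. \<forall>n\<ge>no. norm ((LINT x|lborel. \<phi> x * f (r n) x) - (LINT x|lborel. \<phi> x * g x)) < e"
        by blast
    qed
  qed
  with that[OF r(1) g gb] show ?thesis by blast
qed

section \<open>The Green potential of a bounded density\<close>

text \<open>Bounds and vanishing off \<open>D\<close> are demanded everywhere, so that integrands
  can be compared point by point and integrals can run over the whole plane, where reflections and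
  translations preserve the measure.\<close>

definition dens :: "real \<Rightarrow> real \<Rightarrow> (pt \<Rightarrow> real) \<Rightarrow> bool" where
  "dens l a f \<longleftrightarrow> f \<in> borel_measurable borel \<and> (\<forall>x. 0 \<le> f x \<and> f x \<le> l) \<and> (\<forall>x. x \<notin> D \<longrightarrow> f x = 0)
     \<and> (LINT x|lborel. f x) = a"

lemma D_iff: "x \<in> D \<longleftrightarrow> norm x < 1"
  by (simp add: D_def)

lemma D_sets [measurable, simp]: "D \<in> sets borel"
  by (simp add: D_def)

lemma D_emeasure: "emeasure lborel D < \<infinity>"
  unfolding D_def by (rule emeasure_lborel_ball_finite)

lemma D_dist: "x \<in> D \<Longrightarrow> y \<in> D \<Longrightarrow> norm (x - y) < 2"
  using norm_triangle_ineq4[of x y] by (simp add: D_iff)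

lemma dens_measurable: "dens l a f \<Longrightarrow> f \<in> borel_measurable borel"
  and dens_nonneg: "dens l a f \<Longrightarrow> 0 \<le> f x"
  and dens_le: "dens l a f \<Longrightarrow> f x \<le> l"
  and dens_off: "dens l a f \<Longrightarrow> x \<notin> D \<Longrightarrow> f x = 0"
  and dens_integral: "dens l a f \<Longrightarrow> (LINT x|lborel. f x) = a"
  unfolding dens_def by blast+

lemma dens_level_nonneg: "dens l a f \<Longrightarrow> 0 \<le> l"
  using dens_nonneg dens_le by (meson order_trans)

lemma integrable_indicator_D: "integrable lborel (indicator D :: pt \<Rightarrow> real)"
  using D_emeasure by (simp add: integrable_indicator_iff)

lemma dens_integrable: "dens l a f \<Longrightarrow> integrable lborel f"
proof (rule Bochner_Integration.integrable_bound[of _ "\<lambda>x. l * indicator D x" f])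
  assume f: "dens l a f"
  show "f \<in> borel_measurable lborel" using dens_measurable[OF f] by simp
  have "norm (f x) \<le> norm (l * indicator D x)" for x
    using dens_nonneg[OF f, of x] dens_le[OF f, of x] dens_off[OF f, of x] by (cases "x \<in> D") simp_all
  then show "AE x in lborel. norm (f x) \<le> norm (l * indicator D x)"
    by (intro always_eventually) blast
qed (use integrable_indicator_D in simp)

lemma dens_mass_nonneg: "dens l a f \<Longrightarrow> 0 \<le> a"
  using Bochner_Integration.integral_nonneg[of lborel f] by (auto simp: dens_def)

lemma dens_kernel_integrable:
  assumes f: "dens l a f" and k[measurable]: "k \<in> borel_measurable borel"
    and b: "\<And>y. y \<in> D \<Longrightarrow> \<bar>k y\<bar> \<le> C0 + C1 * ker R (x - y)" and R: "R > 0"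
  shows "integrable lborel (\<lambda>y. k y * f y)"
proof -
  note [measurable] = dens_measurable[OF f]
  have i: "integrable lborel (\<lambda>y. l * (\<bar>C0\<bar> * indicator D y + \<bar>C1\<bar> * ker R (x - y)))"
    using integrable_indicator_D ker_shift_integrable[OF R] by auto
  show ?thesis
  proof (rule Bochner_Integration.integrable_bound[OF i])
    show "AE y in lborel. norm (k y * f y) \<le> norm (l * (\<bar>C0\<bar> * indicator D y + \<bar>C1\<bar> * ker R (x - y)))"
    proof (intro always_eventually allI)
      fix y
      show "norm (k y * f y) \<le> norm (l * (\<bar>C0\<bar> * indicator D y + \<bar>C1\<bar> * ker R (x - y)))"
      proof (cases "y \<in> D")
        case True
        have "C0 + C1 * ker R (x - y) \<le> \<bar>C0\<bar> + \<bar>C1\<bar> * ker R (x - y)"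
          by (intro add_mono mult_right_mono) auto
        then have "\<bar>k y\<bar> * f y \<le> (\<bar>C0\<bar> + \<bar>C1\<bar> * ker R (x - y)) * l"
          using b[OF True] dens_nonneg[OF f] dens_le[OF f] by (intro mult_mono) (auto intro: order_trans)
        then show ?thesis
          using True dens_nonneg[OF f, of y] dens_level_nonneg[OF f] by (simp add: abs_mult mult.commute)
      qed (simp add: dens_off[OF f])
    qed
  qed measurable
qed

text \<open>The bounded part of the kernel is charged to the mass \<open>a\<close>, the singular
  part to the height \<open>l\<close>. With \<open>C1 = r powr (3/2)\<close> and
  \<open>R = r\<close> the second term is \<open>64 * r\<^sup>2 * l\<close>, which is how errors at
  the scale \<open>1 / sqrt l\<close> become constants.\<close>

lemma dens_kernel_le:
  assumes f: "dens l a f" and i: "integrable lborel (\<lambda>y. k y * f y)"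
    and b: "\<And>y. y \<in> D \<Longrightarrow> k y \<le> C0 + C1 * ker R (x - y)" and R: "R > 0" and C1: "C1 \<ge> 0"
  shows "(LINT y|lborel. k y * f y) \<le> C0 * a + 64 * C1 * sqrt R * l"
proof -
  have "(LINT y|lborel. k y * f y) \<le> (LINT y|lborel. C0 * f y + C1 * l * ker R (x - y))"
  proof (rule integral_mono[OF i])
    show "integrable lborel (\<lambda>y. C0 * f y + C1 * l * ker R (x - y))"
      using dens_integrable[OF f] ker_shift_integrable[OF R] by auto
    fix y
    show "k y * f y \<le> C0 * f y + C1 * l * ker R (x - y)"
    proof (cases "y \<in> D")
      case True
      have "k y * f y \<le> (C0 + C1 * ker R (x - y)) * f y"
        using b[OF True] dens_nonneg[OF f] by (intro mult_right_mono) auto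
      also have "\<dots> = C0 * f y + C1 * ker R (x - y) * f y"
        by (simp add: distrib_right)
      also have "\<dots> \<le> C0 * f y + C1 * ker R (x - y) * l"
        using C1 dens_le[OF f] by (intro add_left_mono mult_left_mono) auto
      finally show ?thesis by (simp add: mult_ac)
    qed (simp add: dens_off[OF f] C1 dens_level_nonneg[OF f])
  qed
  also have "\<dots> = C0 * a + C1 * l * (LINT y|lborel. ker R (x - y))"
    using dens_integrable[OF f] ker_shift_integrable[OF R] by (simp add: dens_integral[OF f])
  also have "\<dots> \<le> C0 * a + C1 * l * (64 * sqrt R)"
    using C1 dens_level_nonneg[OF f] ker_shift_integral[OF R] by (intro add_left_mono mult_left_mono) auto
  finally show ?thesis by (simp add: mult_ac)
qed

lemma dens_kernel_mono:
  assumes f: "dens l a f" and "integrable lborel (\<lambda>y. h y * f y)" "integrable lborel (\<lambda>y. k y * f y)"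
    and b: "\<And>y. y \<in> D \<Longrightarrow> h y \<le> k y"
  shows "(LINT y|lborel. h y * f y) \<le> (LINT y|lborel. k y * f y)"
proof (rule integral_mono[OF assms(2,3)])
  fix y show "h y * f y \<le> k y * f y"
    using b[of y] dens_nonneg[OF f, of y] dens_off[OF f, of y] by (cases "y \<in> D") (auto intro: mult_right_mono)
qed

text \<open>This is \<open>2 * pi\<close> times the fundamental solution of the negative Laplacian.
  Its value at the origin is 0 because \<open>ln 0 = 0\<close>, so identities linking it to
  \<open>Green\<close> hold only off the diagonal, which is enough under an integral.\<close>

definition ell :: "pt \<Rightarrow> real" where
  "ell z = - ln (norm z)"

lemma ell_measurable [measurable]: "ell \<in> borel_measurable borel"
  unfolding ell_def by measurable

lemma ln_le_powr:
  assumes "u > (0::real)"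
  shows "ln u \<le> u powr (3/2)"
proof -
  have "ln (u powr (3/2)) \<le> u powr (3/2) - 1"
    using assms by (intro ln_le_minus_one) auto
  then have "(3/2) * ln u \<le> u powr (3/2) - 1"
    using assms by (simp add: ln_powr)
  moreover have "0 \<le> u powr (3/2)" by simp
  ultimately show ?thesis by linarith
qed

lemma ker_scale: "r > 0 \<Longrightarrow> z \<noteq> 0 \<Longrightarrow> norm z < r \<Longrightarrow> r powr (3/2) * ker r z = (r / norm z) powr (3/2)"
  by (simp add: ker_def powr_divide powr_minus_divide)

text \<open>Inside the ball of radius \<open>r\<close> the excess \<open>ln (r / norm z)\<close> is
  absorbed by the kernel; outside, \<open>- ln (norm z)\<close> is at most
  \<open>ln (1 / r)\<close>.\<close>

lemma ell_le:
  assumes "0 < r" "r \<le> 1"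
  shows "ell z \<le> ln (1 / r) + r powr (3/2) * ker r z"
proof (cases "z = 0")
  case False
  show ?thesis
  proof (cases "norm z < r")
    case True
    have "ell z = ln (1 / r) + ln (r / norm z)"
      using False assms by (simp add: ell_def ln_div)
    also have "\<dots> \<le> ln (1 / r) + (r / norm z) powr (3/2)"
      using False assms by (intro add_left_mono ln_le_powr) auto
    finally show ?thesis using ker_scale[OF assms(1) False True] by simp
  next
    case False
    then have "ln r \<le> ln (norm z)"
      using assms by (intro ln_mono) auto
    then have "ell z \<le> ln (1 / r)"
      using assms by (simp add: ell_def ln_div)
    then show ?thesis using add_increasing2[of "r powr (3/2) * ker r z"] by simp
  qed
qed (use assms in \<open>simp add: ell_def ker_def\<close>)

text \<open>Beyond the distance \<open>R * r\<close> the logarithm has dropped by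
  \<open>ln R\<close> below the level \<open>ln (1 / r)\<close>. This drop later penalises mass that
  is spread out.\<close>

lemma ell_le_far:
  assumes "0 < r" "r \<le> 1" "R \<ge> 1"
  shows "ell z \<le> ln (1 / r) - ln R * indicator {z. R * r \<le> norm z} z + r powr (3/2) * ker r z"
proof (cases "R * r \<le> norm z")
  case True
  have "0 < R * r" using assms by simp
  then have "ln (R * r) \<le> ln (norm z)" using True by (intro ln_mono) auto
  then have "ell z \<le> ln (1 / r) - ln R"
    using assms by (simp add: ell_def ln_div ln_mult)
  then show ?thesis using True by (simp add: add_increasing2)
qed (use ell_le[OF assms(1,2), of z] in simp)

lemma ell_abs_le:
  assumes "norm z < 2"
  shows "\<bar>ell z\<bar> \<le> 1 + ker 1 z"
proof -
  have "ell z \<le> ker 1 z" using ell_le[of 1 z] by simp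
  moreover have "- ell z \<le> 1"
  proof (cases "z = 0")
    case False
    then show ?thesis using assms ln_le_minus_one[of "norm z"] by (simp add: ell_def)
  qed (simp add: ell_def)
  ultimately show ?thesis using ker_nonneg[of 1 z] by linarith
qed

lemma dens_ell_integrable: "dens l a f \<Longrightarrow> x \<in> D \<Longrightarrow> integrable lborel (\<lambda>y. ell (x - y) * f y)"
  by (rule dens_kernel_integrable[of _ _ _ _ 1 1 1 x]) (auto intro: ell_abs_le D_dist)

section \<open>The Green function of the disk: image factor and elementary bounds\<close>

definition num :: "pt \<Rightarrow> pt \<Rightarrow> real" where
  "num x y = norm x ^ 2 * norm y ^ 2 - 2 * (x \<bullet> y) + 1"

text \<open>Separates the distance of the points from a factor that depends on their norms alone.
  Hence \<open>Green\<close> is a multiple of the logarithm of 1 plus a positive quotient, which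
  exhibits its sign and its behaviour under reflections that fix the norms.\<close>

lemma num_eq: "num x y = norm (x - y) ^ 2 + (1 - norm x ^ 2) * (1 - norm y ^ 2)"
  by (simp add: num_def power2_norm_eq_inner inner_simps inner_commute algebra_simps)

lemma num_commute: "num x y = num y x"
  by (simp add: num_def inner_commute)

text \<open>By Cauchy-Schwarz \<open>num x y\<close> is at least
  \<open>(1 - norm x * norm y)\<^sup>2\<close>: the image charge keeps its distance as long as one
  of the two points stays away from the circle.\<close>

lemma num_ge:
  assumes "x \<in> D" "y \<in> D"
  shows "(1 - norm x)\<^sup>2 \<le> num x y"
proof -
  have "(1 - norm x)\<^sup>2 \<le> (1 - norm x * norm y)\<^sup>2"
    using assms mult_left_mono[of "norm y" 1 "norm x"] by (intro power_mono) (auto simp: D_iff)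
  also have "\<dots> \<le> num x y"
    using norm_cauchy_schwarz[of x y] by (simp add: num_def power2_diff power_mult_distrib)
  finally show ?thesis .
qed

lemma num_pos: "x \<in> D \<Longrightarrow> y \<in> D \<Longrightarrow> 0 < num x y"
  by (rule less_le_trans[OF _ num_ge]) (auto simp: D_iff)

lemma num_le:
  assumes "x \<in> D" "y \<in> D"
  shows "num x y \<le> 4"
proof -
  have "num x y \<le> (1 + norm x * norm y)\<^sup>2"
    using norm_cauchy_schwarz[of x "-y"] by (simp add: num_def power2_sum power_mult_distrib)
  also have "\<dots> \<le> 2\<^sup>2"
    using assms mult_left_mono[of "norm y" 1 "norm x"] by (intro power_mono) (auto simp: D_iff)
  finally show ?thesis by simp
qed

lemma Green_num: "Green x y = (1 / (4 * pi)) * ln (num x y / norm (x - y) ^ 2)"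
  by (simp add: Green_def num_def)

lemma Green_ell:
  assumes "x \<in> D" "y \<in> D" "x \<noteq> y"
  shows "Green x y = (1 / (4 * pi)) * ln (num x y) + (1 / (2 * pi)) * ell (x - y)"
  using assms num_pos[OF assms(1,2)]
  by (simp add: Green_num ell_def ln_div ln_realpow field_simps)

lemma Green_commute: "Green x y = Green y x"
  by (simp add: Green_num num_commute[of x y] norm_minus_commute)

lemma Green_eq_ln1:
  assumes "x \<in> D" "y \<in> D" "x \<noteq> y"
  shows "Green x y = (1 / (4 * pi)) * ln (1 + (1 - norm x ^ 2) * (1 - norm y ^ 2) / norm (x - y) ^ 2)"
  using assms by (simp add: Green_num num_eq add_divide_distrib)

lemma one_minus_norm_sq_pos: "x \<in> D \<Longrightarrow> 0 < 1 - norm x ^ 2"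
  by (simp add: D_iff abs_square_less_1)

lemma Green_pos:
  assumes "x \<in> D" "y \<in> D" "x \<noteq> y"
  shows "0 < Green x y"
proof -
  have "0 < (1 - norm x ^ 2) * (1 - norm y ^ 2) / norm (x - y) ^ 2"
    using assms one_minus_norm_sq_pos by simp
  then show ?thesis using assms by (simp add: Green_eq_ln1)
qed

text \<open>Division by zero and \<open>ln 0\<close> both give 0, so the diagonal carries a finite
  value in place of the singularity.\<close>

lemma Green_same: "Green x x = 0"
  by (simp add: Green_num)

lemma Green_nonneg: "x \<in> D \<Longrightarrow> y \<in> D \<Longrightarrow> 0 \<le> Green x y"
  using Green_pos[of x y] by (cases "x = y") (auto simp: Green_same)

lemma Green_le_ell:
  assumes "x \<in> D" "y \<in> D"
  shows "2 * pi * Green x y \<le> ln 2 + ell (x - y)"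
proof (cases "x = y")
  case False
  have "ln (num x y) \<le> ln 4" using num_pos[OF assms] num_le[OF assms] by simp
  also have "ln 4 = 2 * ln (2::real)" using ln_realpow[of 2 2] by simp
  finally show ?thesis
    by (simp add: Green_ell[OF assms False] distrib_left)
qed (simp add: Green_same ell_def)

lemma Green_le_ker:
  assumes "x \<in> D" "y \<in> D"
  shows "Green x y \<le> 1 + ker 1 (x - y)"
proof -
  have "2 * pi * Green x y \<le> 1 + ker 1 (x - y)"
    using Green_le_ell[OF assms] ell_le[of 1 "x - y"] ln_2_less_1 by simp
  moreover have "1 * Green x y \<le> 2 * pi * Green x y"
    using Green_nonneg[OF assms] pi_ge_two by (intro mult_right_mono) auto
  ultimately show ?thesis by simp
qed

lemma Green_measurable [measurable]: "(\<lambda>p. Green (fst p) (snd p)) \<in> borel_measurable (borel \<Otimes>\<^sub>M borel)"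
  unfolding Green_def by measurable

lemma Green_measurable1 [measurable]: "Green x \<in> borel_measurable borel"
  unfolding Green_def[abs_def] by measurable

section \<open>Potentials and interaction energies\<close>

definition V :: "(pt \<Rightarrow> real) \<Rightarrow> pt \<Rightarrow> real" where
  "V f x = (LINT y|lborel. Green x y * f y)"

lemma V_measurable [measurable]:
  assumes [measurable]: "f \<in> borel_measurable borel"
  shows "V f \<in> borel_measurable borel"
proof -
  have [measurable]: "(\<lambda>p. Green (fst p) (snd p)) \<in> borel_measurable (borel \<Otimes>\<^sub>M lborel)"
    using Green_measurable by (simp add: measurable_cong_sets[OF sets_pair_measure_cong[OF refl sets_lborel] refl])
  have "(\<lambda>x. LINT y|lborel. Green (fst (x, y)) (snd (x, y)) * f y) \<in> borel_measurable borel"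
    by measurable
  then show ?thesis by (simp add: V_def[abs_def])
qed

lemma Green_integrable: "dens l a f \<Longrightarrow> x \<in> D \<Longrightarrow> integrable lborel (\<lambda>y. Green x y * f y)"
  by (rule dens_kernel_integrable[of _ _ _ _ 1 1 1 x]) (auto simp: abs_of_nonneg Green_nonneg intro: Green_le_ker)

lemma V_nonneg: "dens l a f \<Longrightarrow> x \<in> D \<Longrightarrow> 0 \<le> V f x"
  unfolding V_def
  by (intro Bochner_Integration.integral_nonneg) (metis Green_nonneg dens_nonneg dens_off mult_nonneg_nonneg mult_zero_right order_refl)

lemma V_bound: "dens l a f \<Longrightarrow> x \<in> D \<Longrightarrow> V f x \<le> a + 64 * l"
proof -
  assume f: "dens l a f" and x: "x \<in> D"
  have "(LINT y|lborel. Green x y * f y) \<le> 1 * a + 64 * 1 * sqrt 1 * l"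
    by (rule dens_kernel_le[OF f Green_integrable[OF f x], where x=x]) (simp_all add: Green_le_ker[OF x])
  then show ?thesis by (simp add: V_def)
qed

lemma V_abs: "dens l a f \<Longrightarrow> x \<in> D \<Longrightarrow> \<bar>V f x\<bar> \<le> a + 64 * l"
  using V_nonneg V_bound by (metis abs_of_nonneg)

lemma dens_bounded_integrable:
  assumes f: "dens l a f" and k[measurable]: "k \<in> borel_measurable borel" and b: "\<And>y. y \<in> D \<Longrightarrow> \<bar>k y\<bar> \<le> C"
  shows "integrable lborel (\<lambda>y. k y * f y)"
  by (rule dens_kernel_integrable[OF f k, where ?C0.0=C and ?C1.0=0 and R=1 and x=0]) (use b in auto)

definition Int2 :: "(pt \<Rightarrow> real) \<Rightarrow> (pt \<Rightarrow> real) \<Rightarrow> real" where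
  "Int2 f g = (LINT x|lborel. V f x * g x)"

lemma Vf_g_integrable: "dens l a f \<Longrightarrow> dens m b g \<Longrightarrow> integrable lborel (\<lambda>x. V f x * g x)"
  by (rule dens_bounded_integrable[where C="a + 64 * l"]) (auto simp: V_measurable dens_measurable V_abs)

text \<open>Stated for a general kernel because it serves both the Green function and, in the
  translation argument, the bare logarithm. A singularity of the strength of \<open>ker\<close> is
  absolutely integrable against two bounded densities.\<close>

lemma Fubini_dens:
  assumes f: "dens l a f" and g: "dens m b g"
    and k[measurable]: "(\<lambda>p. k (fst p) (snd p)) \<in> borel_measurable (borel \<Otimes>\<^sub>M borel)"
    and kb: "\<And>x y. x \<in> D \<Longrightarrow> y \<in> D \<Longrightarrow> \<bar>k x y\<bar> \<le> C0 + C1 * ker R (x - y)" and R: "R > 0" and C: "C1 \<ge> 0"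
  shows "(LINT x|lborel. (LINT y|lborel. k x y * f y) * g x) = (LINT y|lborel. (LINT x|lborel. k x y * g x) * f y)"
    and "integrable lborel (\<lambda>x. (LINT y|lborel. k x y * f y) * g x)"
proof -
  note [measurable] = dens_measurable[OF f] dens_measurable[OF g]
  have ms: "borel_measurable (lborel \<Otimes>\<^sub>M lborel) = borel_measurable (borel \<Otimes>\<^sub>M (borel :: pt measure))"
    by (rule measurable_cong_sets[OF sets_pair_measure_cong[OF sets_lborel sets_lborel] refl])
  let ?F = "\<lambda>p. k (fst p) (snd p) * f (snd p) * g (fst p)"
  have [measurable]: "?F \<in> borel_measurable (lborel \<Otimes>\<^sub>M lborel)"
    unfolding ms by measurable
  have k1[measurable]: "k x \<in> borel_measurable borel" for x
    using measurable_compose[OF measurable_Pair1'[of x borel borel] k] by simp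
  have i1: "integrable lborel (\<lambda>y. k x y * f y)" if "x \<in> D" for x
    by (rule dens_kernel_integrable[OF f k1 kb R]) (use that in auto)
  have i2: "integrable lborel (\<lambda>y. \<bar>k x y\<bar> * f y)" if "x \<in> D" for x
    by (rule dens_kernel_integrable[OF f _ _ R, where ?C0.0=C0 and ?C1.0=C1 and x=x]) (use kb[OF that] in simp_all)
  have G: "(\<lambda>x. (LINT y|lborel. norm (?F (x, y)))) = (\<lambda>x. (LINT y|lborel. \<bar>k x y\<bar> * f y) * g x)"
    using dens_nonneg[OF f] dens_nonneg[OF g] by (simp add: abs_mult)
  have i3: "integrable lborel (\<lambda>x. (LINT y|lborel. \<bar>k x y\<bar> * f y) * g x)"
  proof (rule dens_bounded_integrable[OF g])
    have [measurable]: "(\<lambda>p. k (fst p) (snd p)) \<in> borel_measurable (borel \<Otimes>\<^sub>M lborel)"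
      using k by (simp add: measurable_cong_sets[OF sets_pair_measure_cong[OF refl sets_lborel] refl])
    have "(\<lambda>x. LINT y|lborel. \<bar>k (fst (x,y)) (snd (x, y))\<bar> * f y) \<in> borel_measurable borel"
      by measurable
    then show "(\<lambda>x. LINT y|lborel. \<bar>k x y\<bar> * f y) \<in> borel_measurable borel"
      by simp
    fix x assume x: "x \<in> D"
    have "0 \<le> (LINT y|lborel. \<bar>k x y\<bar> * f y)"
      using dens_nonneg[OF f] by (intro Bochner_Integration.integral_nonneg) auto
    moreover have "(LINT y|lborel. \<bar>k x y\<bar> * f y) \<le> C0 * a + 64 * C1 * sqrt R * l"
      by (rule dens_kernel_le[OF f i2[OF x] kb[OF x] R C])
    ultimately show "\<bar>LINT y|lborel. \<bar>k x y\<bar> * f y\<bar> \<le> C0 * a + 64 * C1 * sqrt R * l" by simp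
  qed
  have F: "integrable (lborel \<Otimes>\<^sub>M lborel) ?F"
  proof (rule lborel_pair.Fubini_integrable)
    show "integrable lborel (\<lambda>x. (LINT y|lborel. norm (?F (x, y))))"
      unfolding G by (rule i3)
    have "integrable lborel (\<lambda>y. ?F (x, y))" for x
      using i1[of x] dens_off[OF g, of x] by (cases "x \<in> D") auto
    then show "AE x in lborel. integrable lborel (\<lambda>y. ?F (x, y))" by simp
  qed measurable
  have F': "integrable (lborel \<Otimes>\<^sub>M lborel) (case_prod (\<lambda>x y. k x y * f y * g x))"
    using F by (simp add: case_prod_beta')
  show "(LINT x|lborel. (LINT y|lborel. k x y * f y) * g x) = (LINT y|lborel. (LINT x|lborel. k x y * g x) * f y)"
  proof -
    have "(LINT x|lborel. k x y * f y * g x) = (LINT x|lborel. k x y * g x) * f y" for y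
      by (subst integral_mult_left_zero[symmetric]) (simp add: mult_ac)
    moreover have "(LINT y|lborel. k x y * f y * g x) = (LINT y|lborel. k x y * f y) * g x" for x
      by simp
    ultimately show ?thesis
      using lborel_pair.Fubini_integral[OF F'] by presburger
  qed
  show "integrable lborel (\<lambda>x. (LINT y|lborel. k x y * f y) * g x)"
    using lborel_pair.integrable_fst[OF F'] by simp
qed

lemma Int2_commute:
  assumes "dens l a f" "dens m b g"
  shows "Int2 f g = Int2 g f"
proof -
  have "\<bar>Green x y\<bar> \<le> 1 + 1 * ker 1 (x - y)" if "x \<in> D" "y \<in> D" for x y
    using Green_le_ker[OF that] Green_nonneg[OF that] by simp
  from Fubini_dens(1)[OF assms Green_measurable this]
  show ?thesis unfolding Int2_def V_def by (simp add: Green_commute)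
qed

lemma dens_convex:
  assumes f: "dens l a f" and g: "dens l a g" and t: "0 \<le> t" "t \<le> 1"
  shows "dens l a (\<lambda>x. (1 - t) * f x + t * g x)"
proof -
  have "(1 - t) * f x + t * g x \<le> l" for x
    using dens_le[OF f, of x] dens_le[OF g, of x] t convex_bound_le[of "f x" l "g x" "1 - t" t] by simp
  moreover have "(LINT x|lborel. (1 - t) * f x + t * g x) = a"
    using dens_integrable[OF f] dens_integrable[OF g] by (simp add: dens_integral[OF f] dens_integral[OF g] algebra_simps)
  ultimately show ?thesis
    using f g t by (auto simp: dens_def)
qed

lemma Int2_comb_right:
  assumes "dens l a f" "dens m b g" "dens n c h"
  shows "Int2 h (\<lambda>y. s * f y + t * g y) = s * Int2 h f + t * Int2 h g"
proof -
  have "(\<lambda>x. V h x * (s * f x + t * g x)) = (\<lambda>x. s * (V h x * f x) + t * (V h x * g x))"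
    by (simp add: algebra_simps)
  then show ?thesis
    using Vf_g_integrable[OF assms(3,1)] Vf_g_integrable[OF assms(3,2)] by (simp add: Int2_def)
qed

text \<open>Twice the kinetic energy of \<open>f - g\<close>.\<close>

definition J :: "(pt \<Rightarrow> real) \<Rightarrow> (pt \<Rightarrow> real) \<Rightarrow> real" where
  "J f g = Int2 f f + Int2 g g - 2 * Int2 f g"

text \<open>Along the segment from \<open>f\<close> to \<open>f'\<close> the energy is a quadratic
  polynomial in \<open>t\<close>, and maximality at \<open>t = 0\<close> makes its linear
  coefficient nonpositive. Maximality is only required along the segment itself.\<close>

lemma first_variation:
  assumes f: "dens l a f" and f': "dens l a f'" and g: "dens m b g"
    and max: "\<And>t. 0 < t \<Longrightarrow> t < 1 \<Longrightarrow> J (\<lambda>x. (1 - t) * f x + t * f' x) g \<le> J f g"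
  shows "(LINT x|lborel. (V f x - V g x) * f' x) \<le> (LINT x|lborel. (V f x - V g x) * f x)"
proof -
  let ?A = "Int2 f f" and ?B = "Int2 f f'" and ?C = "Int2 f' f'" and ?E = "Int2 g f" and ?E' = "Int2 g f'"
  have le: "?B - ?E' - (?A - ?E) \<le> t * ((2 * ?B - ?A - ?C) / 2)" if t: "0 < t" "t < 1" for t
  proof -
    let ?F = "\<lambda>x. (1 - t) * f x + t * f' x"
    have F: "dens l a ?F" using t by (intro dens_convex[OF f f']) auto
    have "Int2 ?F ?F = (1 - t) * Int2 ?F f + t * Int2 ?F f'"
      by (rule Int2_comb_right[OF f f' F])
    also have "Int2 ?F f = (1 - t) * ?A + t * ?B"
      using Int2_comb_right[OF f f' f, of "1 - t" t] Int2_commute[OF F f] by simp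
    also have "Int2 ?F f' = (1 - t) * ?B + t * ?C"
      using Int2_comb_right[OF f f' f', of "1 - t" t] Int2_commute[OF F f'] Int2_commute[OF f f'] by simp
    finally have 1: "Int2 ?F ?F = (1 - t) * ((1 - t) * ?A + t * ?B) + t * ((1 - t) * ?B + t * ?C)" .
    have 2: "Int2 ?F g = (1 - t) * ?E + t * ?E'"
      using Int2_comb_right[OF f f' g, of "1 - t" t] Int2_commute[OF F g] by simp
    have "J ?F g - J f g = 2 * t * ((?B - ?E' - (?A - ?E)) - t * ((2 * ?B - ?A - ?C) / 2))"
      unfolding J_def 1 2 Int2_commute[OF f g] by (simp add: field_simps power2_eq_square)
    with max[OF t] have "t * ((?B - ?E' - (?A - ?E)) - t * ((2 * ?B - ?A - ?C) / 2)) \<le> 0" by simp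
    then show ?thesis using t by (simp add: mult_le_0_iff)
  qed
  have "((\<lambda>t. t * ((2 * ?B - ?A - ?C) / 2)) \<longlongrightarrow> 0) (at_right 0)"
    by (auto intro!: tendsto_eq_intros)
  moreover have "eventually (\<lambda>t. ?B - ?E' - (?A - ?E) \<le> t * ((2 * ?B - ?A - ?C) / 2)) (at_right 0)"
    using le by (auto simp: eventually_at_right[of 0 "1::real"] intro!: exI[of _ 1])
  ultimately have "?B - ?E' - (?A - ?E) \<le> 0"
    by (rule tendsto_lowerbound) simp
  moreover have "(LINT x|lborel. (V f x - V g x) * h x) = Int2 f h - Int2 g h" if "dens l a h" for h
    using Vf_g_integrable[OF f that] Vf_g_integrable[OF g that]
    by (simp add: Int2_def left_diff_distrib)
  ultimately show ?thesis using f f' by simp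
qed

section \<open>Foliated symmetric pairs and maximisers\<close>

text \<open>Foliated Schwarz symmetry about the half-line through \<open>v\<close>, in an almost-everywhere form that
  survives weak limits.\<close>

definition fol :: "pt \<Rightarrow> (pt \<Rightarrow> real) \<Rightarrow> bool" where
  "fol v f \<longleftrightarrow> (\<forall>e. norm e = 1 \<longrightarrow> 0 \<le> e \<bullet> v \<longrightarrow> (AE x in lborel. 0 < x \<bullet> e \<longrightarrow> f (mirror e x) \<le> f x))"

text \<open>The opposite axis for \<open>g\<close> makes both \<open>V f\<close> and
  \<open>- V g\<close> increase along circles towards \<open>v\<close>, so that the two
  contributions to the stream function never compete.\<close>

definition Adm :: "pt \<Rightarrow> real \<Rightarrow> real \<Rightarrow> real \<Rightarrow> (pt \<Rightarrow> real) \<Rightarrow> (pt \<Rightarrow> real) \<Rightarrow> bool" where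
  "Adm v l a b f g \<longleftrightarrow> dens l a f \<and> dens l b g \<and> fol v f \<and> fol (- v) g"

definition is_max :: "pt \<Rightarrow> real \<Rightarrow> real \<Rightarrow> real \<Rightarrow> (pt \<Rightarrow> real) \<Rightarrow> (pt \<Rightarrow> real) \<Rightarrow> bool" where
  "is_max v l a b f g \<longleftrightarrow> Adm v l a b f g \<and> (\<forall>f' g'. Adm v l a b f' g' \<longrightarrow> J f' g' \<le> J f g)"

lemma Adm_swap: "Adm v l a b f g \<Longrightarrow> Adm (- v) l b a g f"
  by (simp add: Adm_def)

lemma J_commute: "dens l a f \<Longrightarrow> dens m b g \<Longrightarrow> J f g = J g f"
  by (simp add: J_def Int2_commute)

lemma is_max_swap:
  assumes "is_max v l a b f g"
  shows "is_max (- v) l b a g f"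
  unfolding is_max_def
proof (intro conjI allI impI)
  show "Adm (- v) l b a g f" using assms Adm_swap by (simp add: is_max_def)
  fix f' g' assume A: "Adm (- v) l b a f' g'"
  then have "Adm v l a b g' f'" using Adm_swap[of "-v"] by fastforce
  then have "J g' f' \<le> J f g" using assms by (simp add: is_max_def)
  moreover have "J g' f' = J f' g'" using A J_commute by (auto simp: Adm_def)
  moreover have "J f g = J g f" using assms J_commute by (auto simp: Adm_def is_max_def)
  ultimately show "J f' g' \<le> J g f" by simp
qed

lemma fol_AE: "fol v f \<Longrightarrow> norm e = 1 \<Longrightarrow> 0 \<le> e \<bullet> v \<Longrightarrow> AE x in lborel. 0 < x \<bullet> e \<longrightarrow> f (mirror e x) \<le> f x"
  unfolding fol_def by blast

text \<open>If \<open>x \<bullet> e > 0\<close> and \<open>e \<bullet> v \<ge> 0\<close>, then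
  \<open>mirror e x\<close> lies on the same circle as \<open>x\<close> and no higher in the
  direction \<open>v\<close>.\<close>

lemma fol_monotone:
  assumes "\<And>x y. norm x = norm y \<Longrightarrow> y \<bullet> v \<le> x \<bullet> v \<Longrightarrow> f y \<le> f x"
  shows "fol v f"
  unfolding fol_def
proof (intro allI impI always_eventually)
  fix e x :: pt assume "norm e = 1" "0 \<le> e \<bullet> v" "0 < x \<bullet> e"
  moreover from this have "mirror e x \<bullet> v \<le> x \<bullet> v" by (simp add: mirror_def inner_simps)
  ultimately show "f (mirror e x) \<le> f x"
    by (intro assms) simp_all
qed

lemma mirror_uminus: "mirror (- e) = mirror e"
  by (rule ext) (simp add: mirror_def)

text \<open>Two points on one circle are exchanged by the reflection in their bisector. This turns
  comparison of values along circles into a statement about reflections.\<close>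

lemma mirror_eq_swap:
  assumes "norm x = norm y" "x \<noteq> y"
  defines "e \<equiv> (x - y) /\<^sub>R norm (x - y)"
  shows "norm e = 1" "mirror e x = y" "0 < x \<bullet> e" "e \<bullet> v = (x \<bullet> v - y \<bullet> v) / norm (x - y)"
proof -
  have n: "norm (x - y) > 0" using assms by simp
  then show "norm e = 1" by (simp add: e_def)
  have xy: "x \<bullet> x = y \<bullet> y" using assms(1) by (simp add: dot_square_norm)
  have k: "norm (x - y) ^ 2 = 2 * (x \<bullet> (x - y))"
    using xy by (simp add: power2_norm_eq_inner inner_simps inner_commute)
  then have "x \<bullet> (x - y) > 0" using n by (metis zero_less_power zero_less_mult_pos zero_less_numeral)
  then show "0 < x \<bullet> e" using n by (simp add: e_def)
  have "x \<bullet> e = (x \<bullet> (x - y)) / norm (x - y)"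
    by (simp add: e_def divide_inverse mult.commute)
  then have "2 * (x \<bullet> e) = norm (x - y)"
  proof -
    have "(2 * (x \<bullet> e)) * norm (x - y) = norm (x - y) * norm (x - y)"
      using k n \<open>x \<bullet> e = _\<close> by (simp add: power2_eq_square)
    then show ?thesis using n by (metis mult_right_cancel less_irrefl)
  qed
  then have "mirror e x = x - norm (x - y) *\<^sub>R e" by (simp add: mirror_def)
  also have "\<dots> = y" using n by (simp add: e_def)
  finally show "mirror e x = y" .
  show "e \<bullet> v = (x \<bullet> v - y \<bullet> v) / norm (x - y)"
    by (simp add: e_def inner_diff_left[symmetric] divide_inverse mult.commute)
qed

lemma fol_convex:
  assumes "fol v f" "fol v g" "0 \<le> s" "0 \<le> t"
  shows "fol v (\<lambda>x. s * f x + t * g x)"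
  unfolding fol_def
proof (intro allI impI)
  fix e :: pt assume e: "norm e = 1" "0 \<le> e \<bullet> v"
  from fol_AE[OF assms(1) e] fol_AE[OF assms(2) e]
  show "AE x in lborel. 0 < x \<bullet> e \<longrightarrow> s * f (mirror e x) + t * g (mirror e x) \<le> s * f x + t * g x"
    by eventually_elim (use assms in \<open>auto intro!: add_mono mult_left_mono\<close>)
qed

section \<open>Weak convergence of densities and existence of maximisers\<close>

definition wconv :: "(nat \<Rightarrow> pt \<Rightarrow> real) \<Rightarrow> (pt \<Rightarrow> real) \<Rightarrow> bool" where
  "wconv F f \<longleftrightarrow> (\<forall>\<phi>. integrable lborel \<phi> \<longrightarrow> (\<lambda>n. LINT x|lborel. \<phi> x * F n x) \<longlonglongrightarrow> (LINT x|lborel. \<phi> x * f x))"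

lemma wconvD: "wconv F f \<Longrightarrow> integrable lborel \<phi> \<Longrightarrow> (\<lambda>n. LINT x|lborel. \<phi> x * F n x) \<longlonglongrightarrow> (LINT x|lborel. \<phi> x * f x)"
  by (simp add: wconv_def)

lemma dens_indicator_integral: "dens l a f \<Longrightarrow> (LINT x|lborel. indicator D x * f x) = a"
  using dens_integral[of l a f] dens_off[of l a f]
  by (metis (no_types, lifting) Bochner_Integration.integral_cong indicator_simps mult_1 mult_zero_left)

lemma dens_weak_limit:
  assumes F: "\<And>n. dens l a (F n)" and w: "wconv F f" and f: "f \<in> borel_measurable borel"
    "\<And>x. 0 \<le> f x" "\<And>x. f x \<le> l" "\<And>x. x \<notin> D \<Longrightarrow> f x = 0"
  shows "dens l a f"
proof -
  have "(\<lambda>n. a) \<longlonglongrightarrow> (LINT x|lborel. indicator D x * f x)"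
    using wconvD[OF w integrable_indicator_D] dens_indicator_integral[OF F] by simp
  then have "(LINT x|lborel. indicator D x * f x) = a"
    using LIMSEQ_unique tendsto_const by blast
  moreover have "(\<lambda>x. indicator D x * f x) = f"
  proof
    fix x show "indicator D x * f x = f x" by (cases "x \<in> D") (simp_all add: f(4))
  qed
  ultimately show ?thesis using f by (simp add: dens_def)
qed

lemma integral_mirror_swap:
  assumes [measurable]: "\<phi> \<in> borel_measurable borel" "f \<in> borel_measurable borel" and e: "norm e = 1"
  shows "(LINT x|lborel. \<phi> x * f (mirror e x)) = (LINT x|lborel. \<phi> (mirror e x) * (f x :: real))"
  using integral_mirror[OF _ e, of "\<lambda>x. \<phi> (mirror e x) * f x"] e by simp

text \<open>For each \<open>e\<close> the condition is a family of linear inequalities, namely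
  nonnegative integrals of \<open>f - f o mirror e\<close> over subsets of the half-plane
  \<open>x \<bullet> e > 0\<close>, and these pass to weak limits.\<close>

lemma fol_weak_limit:
  assumes F: "\<And>n. dens l a (F n)" and w: "wconv F f" and f: "dens l a f" and fol: "\<And>n. fol v (F n)"
  shows "fol v f"
  unfolding fol_def
proof (intro allI impI)
  fix e :: pt assume e: "norm e = 1" "0 \<le> e \<bullet> v"
  note [measurable] = dens_measurable[OF f] dens_measurable[OF F]
  let ?m = "mirror e"
  \<comment> \<open>The set on which the limit violates the inequality serves as test set: the
    integrand is negative there, while the limit of the integrals is nonnegative.\<close>
  define A where "A = {x \<in> D. 0 < x \<bullet> e \<and> f x < f (?m x)}"
  have [measurable]: "A \<in> sets borel" unfolding A_def by measurable
  have iA: "integrable lborel (indicator A :: pt \<Rightarrow> real)"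
    by (rule Bochner_Integration.integrable_bound[OF integrable_indicator_D])
       (auto simp: A_def indicator_def)
  note iA' = integrable_mirror[OF iA e(1)]
  have split: "(LINT x|lborel. (indicator A x - indicator A (?m x)) * h x) = (LINT x|lborel. indicator A x * (h x - h (?m x)))"
    and ih: "integrable lborel (\<lambda>x. indicator A x * (h x - h (?m x)))"
    if h: "dens l a h" for h
  proof -
    note [measurable] = dens_measurable[OF h]
    have b: "\<bar>h x\<bar> \<le> l" for x using dens_nonneg[OF h] dens_le[OF h] by simp
    have i1: "integrable lborel (\<lambda>x. indicator A x * h x)"
      by (rule Bochner_Integration.integrable_bound[OF dens_integrable[OF h]]) (auto simp: indicator_def)
    have i2: "integrable lborel (\<lambda>x. indicator A x * h (?m x))"
      by (rule Bochner_Integration.integrable_bound[OF integrable_mirror[OF dens_integrable[OF h] e(1)]]) (auto simp: indicator_def)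
    have i3: "integrable lborel (\<lambda>x. indicator A (?m x) * h x)"
      by (rule Bochner_Integration.integrable_bound[OF dens_integrable[OF h]]) (auto simp: indicator_def)
    show "(LINT x|lborel. (indicator A x - indicator A (?m x)) * h x) = (LINT x|lborel. indicator A x * (h x - h (?m x)))"
      using i1 i2 i3 integral_mirror_swap[of "indicator A" h e] e by (simp add: left_diff_distrib right_diff_distrib)
    show "integrable lborel (\<lambda>x. indicator A x * (h x - h (?m x)))"
      using i1 i2 by (simp add: right_diff_distrib)
  qed
  have "(\<lambda>n. LINT x|lborel. indicator A x * (F n x - F n (?m x))) \<longlonglongrightarrow> (LINT x|lborel. indicator A x * (f x - f (?m x)))"
    using wconvD[OF w Bochner_Integration.integrable_diff[OF iA iA']] by (simp add: split[OF F] split[OF f])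
  moreover have "0 \<le> (LINT x|lborel. indicator A x * (F n x - F n (?m x)))" for n
  proof (rule integral_nonneg_AE)
    show "AE x in lborel. 0 \<le> indicator A x * (F n x - F n (?m x))"
      using fol_AE[OF fol e, of n] by eventually_elim (auto simp: A_def indicator_def)
  qed
  ultimately have "0 \<le> (LINT x|lborel. indicator A x * (f x - f (?m x)))"
    by (rule tendsto_lowerbound[OF _ always_eventually[OF allI] sequentially_bot])
  moreover have "0 \<le> (LINT x|lborel. - (indicator A x * (f x - f (?m x))))"
    by (rule Bochner_Integration.integral_nonneg) (auto simp: A_def indicator_def)
  ultimately have "(LINT x|lborel. - (indicator A x * (f x - f (?m x)))) = 0"
    by simp
  then have "AE x in lborel. - (indicator A x * (f x - f (?m x))) = 0"
    by (subst (asm) integral_nonneg_eq_0_iff_AE) (use ih[OF f] in \<open>auto simp: A_def indicator_def\<close>)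
  then show "AE x in lborel. 0 < x \<bullet> e \<longrightarrow> f (?m x) \<le> f x"
  proof eventually_elim
    case (elim x)
    show ?case
    proof (cases "x \<in> D")
      case True
      then show ?thesis using elim by (auto simp: A_def indicator_def not_le split: if_splits)
    next
      case False
      then show ?thesis using e dens_off[OF f] by simp
    qed
  qed
qed

lemma dens_indicator_D: "dens 1 (measure lborel D) (indicator D)"
proof -
  have "(LINT x|lborel. indicator D x) = measure lborel D" by simp
  then show ?thesis by (simp add: dens_def)
qed

text \<open>This is compactness of the Green operator: weak convergence gives pointwise convergence
  of the potentials on \<open>D\<close>, dominated convergence makes it strong, and a strongly
  convergent factor may be paired with a weakly convergent one.\<close>

lemma Int2_weak:
  assumes F: "\<And>n. dens l a (F n)" and w: "wconv F f" and f: "dens l a f"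
    and G: "\<And>n. dens m b (G n)" and wg: "wconv G g" and g: "dens m b g"
  shows "(\<lambda>n. Int2 (F n) (G n)) \<longlonglongrightarrow> Int2 f g"
proof -
  note [measurable] = dens_measurable[OF f] dens_measurable[OF F] dens_measurable[OF g] dens_measurable[OF G] V_measurable
  have DV: "(LINT y|lborel. Green x y * indicator D y * h y) = V h x" if "dens l a h" for h x
    unfolding V_def by (intro Bochner_Integration.integral_cong) (auto simp: indicator_def dens_off[OF that])
  have V: "(\<lambda>n. V (F n) x) \<longlonglongrightarrow> V f x" if "x \<in> D" for x
    using wconvD[OF w Green_integrable[OF dens_indicator_D that]] by (simp add: DV[OF F] DV[OF f])
  let ?M = "a + 64 * l"
  have m: "0 \<le> m" using dens_level_nonneg[OF g] .
  have "(\<lambda>n. LINT x|lborel. indicator D x * \<bar>V (F n) x - V f x\<bar> * m) \<longlonglongrightarrow> (LINT x|(lborel :: pt measure). (0::real))"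
  proof (rule integral_dominated_convergence[where w="\<lambda>x. 2 * ?M * m * indicator D x"])
    show "integrable lborel (\<lambda>x. 2 * ?M * m * indicator D x)"
      using integrable_indicator_D by simp
    show "AE x in lborel. (\<lambda>n. indicator D x * \<bar>V (F n) x - V f x\<bar> * m) \<longlonglongrightarrow> 0"
    proof (intro always_eventually allI)
      fix x show "(\<lambda>n. indicator D x * \<bar>V (F n) x - V f x\<bar> * m) \<longlonglongrightarrow> 0"
        using V[of x] by (cases "x \<in> D") (auto intro!: tendsto_eq_intros)
    qed
    show "AE x in lborel. norm (indicator D x * \<bar>V (F n) x - V f x\<bar> * m) \<le> 2 * ?M * m * indicator D x" for n
    proof (intro always_eventually allI)
      fix x
      show "norm (indicator D x * \<bar>V (F n) x - V f x\<bar> * m) \<le> 2 * ?M * m * indicator D x"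
      proof (cases "x \<in> D")
        case True
        have "\<bar>V (F n) x - V f x\<bar> \<le> 2 * ?M"
          by (rule order_trans[OF abs_triangle_ineq4]) (use V_abs[OF F True, of n] V_abs[OF f True] in simp)
        then show ?thesis using True m by (simp add: abs_mult mult_right_mono)
      qed simp
    qed
  qed measurable
  then have z: "(\<lambda>n. LINT x|lborel. indicator D x * \<bar>V (F n) x - V f x\<bar> * m) \<longlonglongrightarrow> 0" by simp
  have "\<bar>Int2 (F n) (G n) - Int2 f (G n)\<bar> \<le> (LINT x|lborel. indicator D x * \<bar>V (F n) x - V f x\<bar> * m)" for n
  proof -
    have i1: "integrable lborel (\<lambda>x. V (F n) x * G n x)" "integrable lborel (\<lambda>x. V f x * G n x)"
      using Vf_g_integrable F f G by blast+
    have i2: "integrable lborel (\<lambda>x. \<bar>V (F n) x - V f x\<bar> * indicator D x)"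
    proof (rule dens_bounded_integrable[OF dens_indicator_D, where C="2 * ?M"])
      fix x assume x: "x \<in> D"
      have "\<bar>V (F n) x - V f x\<bar> \<le> 2 * ?M"
        by (rule order_trans[OF abs_triangle_ineq4]) (use V_abs[OF F x, of n] V_abs[OF f x] in simp)
      then show "\<bar>\<bar>V (F n) x - V f x\<bar>\<bar> \<le> 2 * ?M" by simp
    qed measurable
    have "Int2 (F n) (G n) - Int2 f (G n) = (LINT x|lborel. V (F n) x * G n x - V f x * G n x)"
      unfolding Int2_def using i1 by simp
    also have "\<bar>\<dots>\<bar> \<le> (LINT x|lborel. \<bar>V (F n) x * G n x - V f x * G n x\<bar>)"
      by (rule integral_abs_bound)
    also have "\<dots> \<le> (LINT x|lborel. indicator D x * \<bar>V (F n) x - V f x\<bar> * m)"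
    proof (rule integral_mono)
      fix x
      show "\<bar>V (F n) x * G n x - V f x * G n x\<bar> \<le> indicator D x * \<bar>V (F n) x - V f x\<bar> * m"
      proof (cases "x \<in> D")
        case True
        have "\<bar>V (F n) x * G n x - V f x * G n x\<bar> = \<bar>V (F n) x - V f x\<bar> * \<bar>G n x\<bar>"
          by (metis abs_mult left_diff_distrib)
        then show ?thesis using True dens_nonneg[OF G, of n x] dens_le[OF G, of n x] by (simp add: mult_left_mono)
      qed (simp add: dens_off[OF G])
      show "integrable lborel (\<lambda>x. indicator D x * \<bar>V (F n) x - V f x\<bar> * m)"
        using i2 by (simp add: mult.commute[of "indicator D _"])
    qed (use i1 in auto)
    finally show ?thesis .
  qed
  then have "(\<lambda>n. Int2 (F n) (G n) - Int2 f (G n)) \<longlonglongrightarrow> 0"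
    by (intro Lim_null_comparison[OF _ z]) (auto simp: always_eventually)
  moreover have "(\<lambda>n. Int2 f (G n)) \<longlonglongrightarrow> Int2 f g"
  proof -
    have i: "integrable lborel (\<lambda>x. V f x * indicator D x)"
      by (rule dens_bounded_integrable[OF dens_indicator_D, where C="?M"]) (auto simp: V_abs[OF f])
    have e: "(LINT x|lborel. V f x * indicator D x * h x) = Int2 f h" if "dens m b h" for h
      unfolding Int2_def by (intro Bochner_Integration.integral_cong) (auto simp: indicator_def dens_off[OF that])
    show ?thesis using wconvD[OF wg i] by (simp add: e[OF G] e[OF g])
  qed
  ultimately have "(\<lambda>n. (Int2 (F n) (G n) - Int2 f (G n)) + Int2 f (G n)) \<longlonglongrightarrow> 0 + Int2 f g"
    by (rule tendsto_add)
  then show ?thesis by simp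
qed

lemma Int2_nonneg:
  assumes "dens l a f" "dens m b g"
  shows "0 \<le> Int2 f g"
  unfolding Int2_def
proof (intro Bochner_Integration.integral_nonneg)
  fix x show "0 \<le> V f x * g x"
    using V_nonneg[OF assms(1), of x] dens_nonneg[OF assms(2), of x] dens_off[OF assms(2), of x] by (cases "x \<in> D") auto
qed

lemma Int2_le:
  assumes "dens l a f" "dens m b g" "\<And>x. x \<in> D \<Longrightarrow> V f x \<le> C"
  shows "Int2 f g \<le> C * b"
proof -
  have "Int2 f g \<le> (LINT x|lborel. C * g x)"
    unfolding Int2_def
    by (rule dens_kernel_mono[OF assms(2) Vf_g_integrable[OF assms(1,2)] _ assms(3)])
       (simp_all add: dens_integrable[OF assms(2)])
  then show ?thesis by (simp add: dens_integral[OF assms(2)])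
qed

lemma J_bound:
  assumes "dens l a f" "dens l b g"
  shows "J f g \<le> (a + 64 * l) * a + (b + 64 * l) * b"
  using Int2_le[OF assms(1,1) V_bound[OF assms(1)]] Int2_le[OF assms(2,2) V_bound[OF assms(2)]] Int2_nonneg[OF assms]
  by (simp add: J_def)

lemma wconv_subseq: "wconv F f \<Longrightarrow> strict_mono r \<Longrightarrow> wconv (\<lambda>n. F (r n)) f"
  unfolding wconv_def
proof (intro allI impI)
  fix \<phi> :: "pt \<Rightarrow> real"
  assume "\<forall>\<phi>. integrable lborel \<phi> \<longrightarrow> (\<lambda>n. LINT x|lborel. \<phi> x * F n x) \<longlonglongrightarrow> (LINT x|lborel. \<phi> x * f x)"
    and r: "strict_mono r" and "integrable lborel \<phi>"
  then have "(\<lambda>n. LINT x|lborel. \<phi> x * F n x) \<longlonglongrightarrow> (LINT x|lborel. \<phi> x * f x)" by simp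
  from LIMSEQ_subseq_LIMSEQ[OF this r]
  show "(\<lambda>n. LINT x|lborel. \<phi> x * F (r n) x) \<longlonglongrightarrow> (LINT x|lborel. \<phi> x * f x)" by (simp only: o_def)
qed

lemma dens_weak_compact:
  assumes F: "\<And>n. dens l a (F n)"
  obtains r f where "strict_mono (r::nat \<Rightarrow> nat)" "dens l a f" "wconv (\<lambda>n. F (r n)) f"
proof -
  show ?thesis
  proof (rule weak_sequential_compactness[where f=F and L=l and S=D, OF dens_measurable[OF F] dens_nonneg[OF F] dens_le[OF F] D_sets D_emeasure dens_off[OF F]])
    fix r f
    assume r: "strict_mono (r::nat \<Rightarrow> nat)" "f \<in> borel_measurable borel"
      "\<And>x. 0 \<le> f x" "\<And>x. f x \<le> l" "\<And>x. x \<notin> D \<Longrightarrow> f x = 0"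
      "\<And>\<phi>. integrable lborel \<phi> \<Longrightarrow> (\<lambda>n. LINT x|lborel. \<phi> x * F (r n) x) \<longlonglongrightarrow> (LINT x|lborel. \<phi> x * f x)"
    have w: "wconv (\<lambda>n. F (r n)) f" unfolding wconv_def using r(6) by blast
    show ?thesis by (rule that[OF r(1) dens_weak_limit[OF F w r(2-5)] w])
  qed
qed

lemma maximizer_exists:
  assumes "Adm v l a b f0 g0"
  obtains f g where "is_max v l a b f g"
proof -
  define S where "S = {J f g | f g. Adm v l a b f g}"
  have ne: "S \<noteq> {}" using assms by (auto simp: S_def)
  have bdd: "bdd_above S"
    unfolding S_def bdd_above_def by (intro exI[of _ "(a + 64 * l) * a + (b + 64 * l) * b"]) (auto simp: Adm_def intro: J_bound)
  have "\<exists>f g. Adm v l a b f g \<and> Sup S - inverse (Suc n) < J f g" for n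
  proof -
    have "\<exists>s\<in>S. Sup S - inverse (Suc n) < s"
      by (rule less_cSupD[OF ne]) simp
    then show ?thesis by (auto simp: S_def)
  qed
  then obtain F G where FG: "\<And>n. Adm v l a b (F n) (G n)" "\<And>n. Sup S - inverse (Suc n) < J (F n) (G n)"
    by metis
  have F: "\<And>n. dens l a (F n)" "\<And>n. fol v (F n)" and G: "\<And>n. dens l b (G n)" "\<And>n. fol (- v) (G n)"
    using FG(1) by (auto simp: Adm_def)
  obtain r f where r: "strict_mono (r::nat \<Rightarrow> nat)" "dens l a f" "wconv (\<lambda>n. F (r n)) f"
    by (rule dens_weak_compact[OF F(1)])
  obtain s g where s: "strict_mono (s::nat \<Rightarrow> nat)" "dens l b g" "wconv (\<lambda>n. G (r (s n))) g"
    by (rule dens_weak_compact[OF G(1)])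
  have wF: "wconv (\<lambda>n. F (r (s n))) f" using wconv_subseq[OF r(3) s(1)] .
  have adm: "Adm v l a b f g"
    using r(2) s(2) fol_weak_limit[OF F(1) wF r(2) F(2)] fol_weak_limit[OF G(1) s(3,2) G(2)]
    by (simp add: Adm_def)
  have "(\<lambda>n. J (F (r (s n))) (G (r (s n)))) \<longlonglongrightarrow> J f g"
  proof -
    have F': "\<And>n. dens l a (F (r (s n)))" and G': "\<And>n. dens l b (G (r (s n)))" using F G by auto
    show ?thesis
      unfolding J_def
      by (rule tendsto_diff[OF tendsto_add[OF Int2_weak[OF F' wF r(2) F' wF r(2)] Int2_weak[OF G' s(3,2) G' s(3,2)]]
            tendsto_mult_left[OF Int2_weak[OF F' wF r(2) G' s(3,2)]]])
  qed
  moreover have "(\<lambda>n. Sup S - inverse (Suc (r (s n)))) \<longlonglongrightarrow> Sup S - 0"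
    using LIMSEQ_subseq_LIMSEQ[OF LIMSEQ_inverse_real_of_nat strict_mono_o[OF r(1) s(1)]]
    by (intro tendsto_intros) (simp add: o_def)
  ultimately have "Sup S - 0 \<le> J f g"
    by (rule tendsto_le[OF sequentially_bot]) (use FG(2) in \<open>auto intro!: always_eventually less_imp_le\<close>)
  moreover have "J f' g' \<le> Sup S" if "Adm v l a b f' g'" for f' g'
    by (rule cSup_upper[OF _ bdd]) (use that in \<open>auto simp: S_def\<close>)
  ultimately have "is_max v l a b f g" using adm by (force simp: is_max_def)
  then show ?thesis by (rule that)
qed

section \<open>Monotonicity of the potential under reflections\<close>

lemma num_mirror: "norm e = 1 \<Longrightarrow> num (mirror e x) (mirror e y) = num x y"
  by (simp add: num_def)

lemma Green_mirror: "norm e = 1 \<Longrightarrow> Green (mirror e x) (mirror e y) = Green x y"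
  by (simp add: Green_num num_mirror mirror_diff[symmetric])

lemma Green_mirror_left: "norm e = 1 \<Longrightarrow> Green (mirror e x) y = Green x (mirror e y)"
  using Green_mirror[of e x "mirror e y"] by simp

text \<open>Reflecting \<open>y\<close> to the other side of the line increases its squared distance
  to \<open>x\<close> by \<open>4 * (x \<bullet> e) * (y \<bullet> e)\<close> and leaves the factor
  with the norms unchanged.\<close>

lemma Green_mirror_less:
  assumes "norm e = 1" "x \<in> D" "y \<in> D" "0 < x \<bullet> e" "0 < y \<bullet> e" "x \<noteq> y"
  shows "Green x (mirror e y) < Green x y"
proof -
  let ?c = "(1 - norm x ^ 2) * (1 - norm y ^ 2)"
  have ne: "x \<noteq> mirror e y"
    using mirror_inner_unit[OF assms(1), of y] assms(4,5) by auto
  have "norm (x - mirror e y) ^ 2 = norm (x - y) ^ 2 + 4 * (x \<bullet> e) * (y \<bullet> e)"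
    using assms(1) by (simp add: power2_norm_eq_inner mirror_def inner_simps inner_commute algebra_simps)
  then have "norm (x - y) ^ 2 < norm (x - mirror e y) ^ 2" using assms by simp
  moreover have "0 < ?c" using one_minus_norm_sq_pos assms by simp
  ultimately have "?c / norm (x - mirror e y) ^ 2 < ?c / norm (x - y) ^ 2"
  proof (rule divide_strict_left_mono)
    show "0 < norm (x - mirror e y) ^ 2 * norm (x - y) ^ 2" using ne assms(6) by simp
  qed
  moreover have "0 < ?c / norm (x - mirror e y) ^ 2" using \<open>0 < ?c\<close> ne by simp
  ultimately have "ln (1 + ?c / norm (x - mirror e y) ^ 2) < ln (1 + ?c / norm (x - y) ^ 2)"
    by simp
  then show ?thesis
    using Green_eq_ln1[of x y] Green_eq_ln1[of x "mirror e y"] assms ne by (simp add: divide_strict_right_mono)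
qed

text \<open>The kernel \<open>K\<close> is odd under the reflection, so the difference of the two
  potentials may be folded onto the odd part of \<open>f\<close>.\<close>

lemma V_mirror_diff:
  assumes f: "dens l a f" and x: "x \<in> D" and e: "norm e = 1"
  defines "K \<equiv> \<lambda>y. Green x y - Green x (mirror e y)"
  shows "2 * (V f x - V f (mirror e x)) = (LINT y|lborel. K y * (f y - f (mirror e y)))"
    and "integrable lborel (\<lambda>y. K y * (f y - f (mirror e y)))"
proof -
  note [measurable] = dens_measurable[OF f]
  let ?m = "mirror e"
  have mx: "?m x \<in> D" using x e by simp
  have Kd: "K = (\<lambda>y. Green x y - Green (?m x) y)" using e by (simp add: K_def Green_mirror_left)
  have K[measurable]: "K \<in> borel_measurable borel" unfolding Kd by measurable
  have i1: "integrable lborel (\<lambda>y. K y * f y)"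
    using Green_integrable[OF f x] Green_integrable[OF f mx] by (simp add: Kd left_diff_distrib)
  have 1: "V f x - V f (?m x) = (LINT y|lborel. K y * f y)"
    using Green_integrable[OF f x] Green_integrable[OF f mx] by (simp add: V_def Kd left_diff_distrib)
  have odd: "K (?m y) = - K y" for y using e by (simp add: K_def)
  have i2: "integrable lborel (\<lambda>y. K y * f (?m y))"
    using integrable_mirror[OF i1 e] by (simp add: odd)
  have "(LINT y|lborel. K y * f (?m y)) = - (LINT y|lborel. K y * f y)"
    using integral_mirror_swap[OF K dens_measurable[OF f] e] by (simp add: odd)
  then show "2 * (V f x - V f (?m x)) = (LINT y|lborel. K y * (f y - f (?m y)))"
    using i1 i2 by (simp add: 1 right_diff_distrib)
  show "integrable lborel (\<lambda>y. K y * (f y - f (?m y)))"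
    using i1 i2 by (simp add: right_diff_distrib)
qed

text \<open>After folding, both factors of the integrand have the sign of
  \<open>y \<bullet> e\<close>. Since \<open>K\<close> is nonzero off the line and inside
  \<open>D\<close> up to two points, equality at a single \<open>x\<close> already forces
  \<open>f\<close> to be invariant under the whole reflection.\<close>

lemma V_mirror_mono:
  assumes f: "dens l a f" and x: "x \<in> D" and e: "norm e = 1" and xe: "0 < x \<bullet> e"
    and fol: "AE y in lborel. 0 < y \<bullet> e \<longrightarrow> f (mirror e y) \<le> f y"
  shows "V f (mirror e x) \<le> V f x"
    and "V f (mirror e x) = V f x \<Longrightarrow> AE y in lborel. f (mirror e y) = f y"
proof -
  note [measurable] = dens_measurable[OF f]
  let ?m = "mirror e"
  define K where "K y = Green x y - Green x (?m y)" for y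
  have fol': "AE y in lborel. 0 < ?m y \<bullet> e \<longrightarrow> f (?m (?m y)) \<le> f (?m y)"
    by (rule AE_mirror[OF _ e fol]) measurable
  have ne: "AE y in lborel. y \<noteq> x" "AE y in lborel. y \<noteq> ?m x"
    using AE_lborel_singleton by blast+
  have s1: "0 < K y" if "0 < y \<bullet> e" "y \<in> D" "y \<noteq> x" for y
    using Green_mirror_less[OF e x that(2) xe that(1)] that by (simp add: K_def)
  have s2: "K y < 0" if "y \<bullet> e < 0" "y \<in> D" "y \<noteq> ?m x" for y
  proof -
    have "Green x (?m (?m y)) < Green x (?m y)"
      by (rule Green_mirror_less[OF e x]) (use that xe mirror_inner_unit[OF e, of y] e in auto)
    then show ?thesis by (simp add: K_def e)
  qed
  have m0: "?m y = y" if "y \<bullet> e = 0" for y using that by (simp add: mirror_def)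
  have off: "f y = 0" "f (?m y) = 0" if "y \<notin> D" for y
    using that dens_off[OF f] e by auto
  have pos: "AE y in lborel. 0 \<le> K y * (f y - f (?m y)) \<and> (K y * (f y - f (?m y)) = 0 \<longrightarrow> f (?m y) = f y)"
    using fol fol' ne
  proof eventually_elim
    case (elim y)
    consider "y \<notin> D" | "y \<bullet> e = 0" | "y \<in> D" "0 < y \<bullet> e" | "y \<in> D" "y \<bullet> e < 0" by linarith
    then show ?case
    proof cases
      case 3
      then have "0 < K y" "f (?m y) \<le> f y" using s1 elim by auto
      then show ?thesis by auto
    next
      case 4
      then have "K y < 0" "f y \<le> f (?m y)" using s2[OF 4(2,1)] elim e mirror_inner_unit[OF e, of y] by auto
      then show ?thesis by (auto intro: mult_nonpos_nonpos)
    qed (auto simp: off m0)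
  qed
  have eq: "2 * (V f x - V f (?m x)) = (LINT y|lborel. K y * (f y - f (?m y)))"
    and i: "integrable lborel (\<lambda>y. K y * (f y - f (?m y)))"
    using V_mirror_diff[OF f x e] by (simp_all add: K_def)
  have "0 \<le> (LINT y|lborel. K y * (f y - f (?m y)))"
    by (rule integral_nonneg_AE) (use pos in eventually_elim, blast)
  then show "V f (?m x) \<le> V f x" using eq by simp
  assume "V f (?m x) = V f x"
  then have "(LINT y|lborel. K y * (f y - f (?m y))) = 0" using eq by simp
  moreover have "AE y in lborel. 0 \<le> K y * (f y - f (?m y))" using pos by eventually_elim blast
  ultimately have "AE y in lborel. K y * (f y - f (?m y)) = 0"
    using integral_nonneg_eq_0_iff_AE[OF i] by simp
  then show "AE y in lborel. f (?m y) = f y"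
    using pos by eventually_elim blast
qed

section \<open>The bathtub principle and potential estimates\<close>

text \<open>Apply the reflection inequality to \<open>f\<close> at \<open>x\<close> with
  \<open>e\<close>, and to \<open>g\<close> at \<open>y\<close> with \<open>- e\<close>; the
  opposite axes make both inequalities point the same way. Equality in the sum forces equality in
  both, hence one reflection common to \<open>f\<close> and \<open>g\<close>.\<close>

lemma psi_mono:
  assumes A: "Adm v l a b f g" and x: "x \<in> D" and n: "norm x = norm y" and v: "y \<bullet> v \<le> x \<bullet> v"
  shows "V f y - V g y \<le> V f x - V g x" (is ?le)
    and "x \<noteq> y \<Longrightarrow> V f y - V g y = V f x - V g x \<Longrightarrow>
      \<exists>e. norm e = 1 \<and> e \<bullet> v = (x \<bullet> v - y \<bullet> v) / norm (x - y) \<and>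
        (AE z in lborel. f (mirror e z) = f z) \<and> (AE z in lborel. g (mirror e z) = g z)"
      (is "_ \<Longrightarrow> ?eq \<Longrightarrow> ?ex")
proof -
  have f: "dens l a f" "fol v f" and g: "dens l b g" "fol (- v) g"
    using A by (auto simp: Adm_def)
  have y: "y \<in> D" using x n by (simp add: D_iff)
  have "?le \<and> (x \<noteq> y \<longrightarrow> ?eq \<longrightarrow> ?ex)"
  proof (cases "x = y")
    case False
    define e where "e = (x - y) /\<^sub>R norm (x - y)"
    note e = mirror_eq_swap[OF n False, folded e_def]
    have m: "mirror (- e) y = x" using mirror_mirror[OF e(1), of x] e(2) by (simp add: mirror_uminus)
    have e': "norm (- e) = 1" "0 < y \<bullet> (- e)" using e mirror_inner_unit[OF e(1), of x] by auto
    have ev: "0 \<le> e \<bullet> v" "0 \<le> (- e) \<bullet> (- v)" using e(4)[of v] v by auto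
    note F = V_mirror_mono[OF f(1) x e(1,3) fol_AE[OF f(2) e(1) ev(1)]]
    note G = V_mirror_mono[OF g(1) y e' fol_AE[OF g(2) e'(1) ev(2)]]
    have F1: "V f y \<le> V f x" and G1: "V g x \<le> V g y" using F(1) G(1) by (simp_all add: e m)
    have ?ex if ?eq
    proof (intro exI[of _ e] conjI)
      have "V f y = V f x" "V g x = V g y" using F1 G1 that by auto
      then show "AE z in lborel. f (mirror e z) = f z" "AE z in lborel. g (mirror e z) = g z"
        using F(2)[unfolded e(2)] G(2)[unfolded m, unfolded mirror_uminus] by blast+
    qed (use e in auto)
    then show ?thesis
      using F1 G1 by auto
  qed auto
  then show ?le and "x \<noteq> y \<Longrightarrow> ?eq \<Longrightarrow> ?ex" by blast+
qed

text \<open>\<mu> is the infimum of the levels whose open superlevel set has measure at most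
  \<open>m\<close>. Continuity of measure from below gives the first inequality at \<mu>, continuity
  from above the second.\<close>

lemma bathtub_level:
  fixes \<psi> :: "pt \<Rightarrow> real"
  assumes \<psi>[measurable]: "\<psi> \<in> borel_measurable borel" and M: "\<And>x. x \<in> D \<Longrightarrow> \<bar>\<psi> x\<bar> \<le> M"
    and m: "0 < m" "m < measure lborel D"
  obtains \<mu> where "measure lborel {x \<in> D. \<mu> < \<psi> x} \<le> m" "m \<le> measure lborel {x \<in> D. \<mu> \<le> \<psi> x}"
proof -
  define T where "T t = measure lborel {x \<in> D. t < \<psi> x}" for t
  have fin: "emeasure lborel A < \<infinity>" if "A \<subseteq> D" for A
    by (rule le_less_trans[OF emeasure_mono D_emeasure]) (use that in auto)
  have anti: "T t \<le> T s" if "s \<le> t" for s t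
    unfolding T_def
    by (rule measure_mono_fmeasurable) (use that fin in \<open>auto simp: fmeasurable_def\<close>)
  define S where "S = {t. T t \<le> m}"
  have low: "- M - 1 \<le> t" if "t \<in> S" for t
  proof (rule ccontr)
    assume "\<not> - M - 1 \<le> t"
    then have "{x \<in> D. t < \<psi> x} = D" using M by (auto simp: abs_le_iff) (metis abs_le_iff add.inverse_inverse less_le_trans linorder_not_le neg_le_iff_le diff_less_eq less_add_one order.strict_trans minus_le_iff)
    then show False using that m by (simp add: S_def T_def)
  qed
  have "{x \<in> D. M < \<psi> x} = {}" using M by (force simp: abs_le_iff)
  then have "M \<in> S" using m unfolding S_def T_def by (simp only: mem_Collect_eq measure_empty)
  then have ne: "S \<noteq> {}" by auto
  have bdd: "bdd_below S" using low by (auto simp: bdd_below_def)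
  define \<mu> where "\<mu> = Inf S"
  have above: "T t \<le> m" if t: "\<mu> < t" for t
  proof -
    obtain s where s: "s \<in> S" "s < t" using cInf_less_iff[OF ne bdd] t unfolding \<mu>_def by blast
    then show ?thesis using anti[of s t] by (simp add: S_def)
  qed
  have below: "m < T t" if "t < \<mu>" for t
  proof (rule ccontr)
    assume "\<not> m < T t"
    then have "t \<in> S" by (simp add: S_def)
    then show False using cInf_lower[OF _ bdd] that unfolding \<mu>_def by fastforce
  qed
  have "(\<lambda>n. T (\<mu> + inverse (real (Suc n)))) \<longlonglongrightarrow> measure lborel (\<Union>n. {x \<in> D. \<mu> + inverse (real (Suc n)) < \<psi> x})"
    unfolding T_def
  proof (rule Lim_measure_incseq)
    show "incseq (\<lambda>n. {x \<in> D. \<mu> + inverse (real (Suc n)) < \<psi> x})"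
    proof (rule incseq_SucI, safe)
      fix n x assume "\<mu> + inverse (real (Suc n)) < \<psi> x"
      moreover have "inverse (real (Suc (Suc n))) \<le> inverse (real (Suc n))" by (intro le_imp_inverse_le) auto
      ultimately show "\<mu> + inverse (real (Suc (Suc n))) < \<psi> x" by linarith
    qed
    have "emeasure lborel (\<Union>n. {x \<in> D. \<mu> + inverse (real (Suc n)) < \<psi> x}) < \<infinity>"
      by (rule fin) auto
    then show "emeasure lborel (\<Union>n. {x \<in> D. \<mu> + inverse (real (Suc n)) < \<psi> x}) \<noteq> \<infinity>" by simp
  qed auto
  moreover have "(\<Union>n. {x \<in> D. \<mu> + inverse (real (Suc n)) < \<psi> x}) = {x \<in> D. \<mu> < \<psi> x}"
  proof safe
    fix x n assume "\<mu> + inverse (real (Suc n)) < \<psi> x"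
    moreover have "0 < inverse (real (Suc n))" by simp
    ultimately show "\<mu> < \<psi> x" by linarith
  next
    fix x assume x: "x \<in> D" "\<mu> < \<psi> x"
    then obtain n where "inverse (real (Suc n)) < \<psi> x - \<mu>" using reals_Archimedean[of "\<psi> x - \<mu>"] by auto
    then show "x \<in> (\<Union>n. {x \<in> D. \<mu> + inverse (real (Suc n)) < \<psi> x})" using x by (intro UN_I[of n]) auto
  qed
  ultimately have "measure lborel {x \<in> D. \<mu> < \<psi> x} \<le> m"
    by (intro tendsto_upperbound[where F=sequentially]) (auto intro!: always_eventually above)
  moreover
  have "(\<lambda>n. T (\<mu> - inverse (real (Suc n)))) \<longlonglongrightarrow> measure lborel (\<Inter>n. {x \<in> D. \<mu> - inverse (real (Suc n)) < \<psi> x})"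
    unfolding T_def
  proof (rule Lim_measure_decseq)
    show "decseq (\<lambda>n. {x \<in> D. \<mu> - inverse (real (Suc n)) < \<psi> x})"
    proof (rule decseq_SucI, safe)
      fix n x assume "\<mu> - inverse (real (Suc (Suc n))) < \<psi> x"
      moreover have "inverse (real (Suc (Suc n))) \<le> inverse (real (Suc n))" by (intro le_imp_inverse_le) auto
      ultimately show "\<mu> - inverse (real (Suc n)) < \<psi> x" by linarith
    qed
    have "emeasure lborel {x \<in> D. \<mu> - inverse (real (Suc i)) < \<psi> x} < \<infinity>" for i
      by (rule fin) auto
    then show "emeasure lborel {x \<in> D. \<mu> - inverse (real (Suc i)) < \<psi> x} \<noteq> \<infinity>" for i by (metis less_irrefl)
  qed auto
  moreover have "(\<Inter>n. {x \<in> D. \<mu> - inverse (real (Suc n)) < \<psi> x}) = {x \<in> D. \<mu> \<le> \<psi> x}"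
  proof safe
    fix x assume x: "x \<in> (\<Inter>n. {x \<in> D. \<mu> - inverse (real (Suc n)) < \<psi> x})"
    then show "x \<in> D" by auto
    show "\<mu> \<le> \<psi> x"
    proof (rule ccontr)
      assume "\<not> \<mu> \<le> \<psi> x"
      then obtain n where "inverse (real (Suc n)) < \<mu> - \<psi> x" using reals_Archimedean[of "\<mu> - \<psi> x"] by auto
      moreover have "\<mu> - inverse (real (Suc n)) < \<psi> x" using x by auto
      ultimately show False by linarith
    qed
  next
    fix x n assume "\<mu> \<le> \<psi> x"
    moreover have "0 < inverse (real (Suc n))" by simp
    ultimately show "\<mu> - inverse (real (Suc n)) < \<psi> x" by linarith
  qed
  ultimately have "m \<le> measure lborel {x \<in> D. \<mu> \<le> \<psi> x}"
    by (intro tendsto_lowerbound[where F=sequentially]) (auto intro!: always_eventually less_imp_le[OF below])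
  with \<open>measure lborel {x \<in> D. \<mu> < \<psi> x} \<le> m\<close> show ?thesis by (rule that)
qed

text \<open>The comparison density equals \<open>l\<close> above the level, 0 below it and a
  constant on it that adjusts the mass. It is a monotone function of \<psi>, the only kind of
  competitor that \<open>max\<close> covers. Its integral against \<psi> is at least that of
  \<open>f\<close>, and equality makes \<open>(\<psi> - \<mu>) * (f' - f)\<close> vanish almost
  everywhere.\<close>

lemma bathtub_maximizer:
  fixes \<psi> :: "pt \<Rightarrow> real"
  assumes \<psi>[measurable]: "\<psi> \<in> borel_measurable borel" and M: "\<And>x. x \<in> D \<Longrightarrow> \<bar>\<psi> x\<bar> \<le> M"
    and f: "dens l a f" and a: "0 < a" "a < l * measure lborel D"
    and max: "\<And>h. mono h \<Longrightarrow> dens l a (\<lambda>x. indicator D x * h (\<psi> x)) \<Longrightarrow>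
      (LINT x|lborel. \<psi> x * (indicator D x * h (\<psi> x))) \<le> (LINT x|lborel. \<psi> x * f x)"
  obtains \<mu> where "l * measure lborel {x \<in> D. \<mu> < \<psi> x} \<le> a"
    "AE x in lborel. x \<in> D \<longrightarrow> \<mu> < \<psi> x \<longrightarrow> f x = l" "AE x in lborel. x \<in> D \<longrightarrow> \<psi> x < \<mu> \<longrightarrow> f x = 0"
proof -
  note [measurable] = dens_measurable[OF f]
  have l: "0 < l" using a dens_level_nonneg[OF f] by (cases "l = 0") auto
  have fin: "emeasure lborel A < \<infinity>" if "A \<subseteq> D" for A
    by (rule le_less_trans[OF emeasure_mono D_emeasure]) (use that in auto)
  obtain \<mu> where \<mu>: "measure lborel {x \<in> D. \<mu> < \<psi> x} \<le> a / l" "a / l \<le> measure lborel {x \<in> D. \<mu> \<le> \<psi> x}"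
    by (rule bathtub_level[OF \<psi> M, of "a / l"]) (use a l in \<open>auto simp: field_simps\<close>)
  let ?A = "{x \<in> D. \<mu> < \<psi> x}" and ?B = "{x \<in> D. \<psi> x = \<mu>}"
  \<comment> \<open>If the level set is null, the quotient is 0; this is the right value because the
    sets above the level then carry the mass exactly.\<close>
  define c where "c = (a - l * measure lborel ?A) / measure lborel ?B"
  have "measure lborel {x \<in> D. \<mu> \<le> \<psi> x} = measure lborel (?A \<union> ?B)"
    by (rule arg_cong[of _ _ "measure lborel"]) auto
  also have "\<dots> = measure lborel ?A + measure lborel ?B"
    by (rule measure_Union) (use fin[of ?A] fin[of ?B] in auto)
  finally have m: "a \<le> l * measure lborel ?A + l * measure lborel ?B"
    using \<mu>(2) l by (simp add: field_simps)
  have lA: "l * measure lborel ?A \<le> a" using \<mu>(1) l by (simp add: field_simps)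
  have c: "0 \<le> c" "c \<le> l" and cB: "c * measure lborel ?B = a - l * measure lborel ?A"
  proof -
    have B0: "0 \<le> measure lborel ?B" by simp
    show "0 \<le> c" using lA B0 by (simp add: c_def)
    show "c \<le> l"
    proof (cases "measure lborel ?B = 0")
      case False
      then have "0 < measure lborel ?B" using B0 by linarith
      then show ?thesis using m unfolding c_def pos_divide_le_eq[OF \<open>0 < measure lborel ?B\<close>] by linarith
    qed (use l in \<open>simp add: c_def\<close>)
    show "c * measure lborel ?B = a - l * measure lborel ?A"
      using m lA by (cases "measure lborel ?B = 0") (simp_all add: c_def)
  qed
  define h where "h t = (if \<mu> < t then l else if t = \<mu> then c else 0)" for t
  have h: "mono h" using c l by (auto simp: h_def mono_def)
  define f' where "f' x = indicator D x * h (\<psi> x)" for x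
  have f'_eq: "f' = (\<lambda>x. l * indicator ?A x + c * indicator ?B x)"
    by (rule ext) (auto simp: f'_def h_def indicator_def)
  have "(LINT x|lborel. f' x) = l * measure lborel ?A + c * measure lborel ?B"
    unfolding f'_eq using fin[of ?A] fin[of ?B]
    by (subst Bochner_Integration.integral_add) (auto simp: integrable_indicator_iff)
  then have "dens l a f'"
    unfolding dens_def using c l cB by (auto simp: f'_eq indicator_def)
  then have f': "dens l a f'" "(LINT x|lborel. \<psi> x * f' x) \<le> (LINT x|lborel. \<psi> x * f x)"
    using max[OF h] unfolding f'_def by auto
  have i: "integrable lborel (\<lambda>x. \<psi> x * f x)" "integrable lborel (\<lambda>x. \<psi> x * f' x)"
    by (rule dens_bounded_integrable[OF f \<psi> M], assumption) (rule dens_bounded_integrable[OF f'(1) \<psi> M], assumption)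
  have j: "integrable lborel (\<lambda>x. (\<psi> x - \<mu>) * (f' x - f x))"
    and e: "(LINT x|lborel. (\<psi> x - \<mu>) * (f' x - f x)) = (LINT x|lborel. \<psi> x * f' x) - (LINT x|lborel. \<psi> x * f x)"
  proof -
    have eq: "(\<lambda>x. (\<psi> x - \<mu>) * (f' x - f x)) = (\<lambda>x. (\<psi> x * f' x - \<psi> x * f x) - (\<mu> * f' x - \<mu> * f x))"
      by (simp add: algebra_simps)
    show "integrable lborel (\<lambda>x. (\<psi> x - \<mu>) * (f' x - f x))"
      unfolding eq using i dens_integrable[OF f] dens_integrable[OF f'(1)] by simp
    show "(LINT x|lborel. (\<psi> x - \<mu>) * (f' x - f x)) = (LINT x|lborel. \<psi> x * f' x) - (LINT x|lborel. \<psi> x * f x)"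
      unfolding eq using i dens_integrable[OF f] dens_integrable[OF f'(1)] by (simp add: dens_integral[OF f] dens_integral[OF f'(1)])
  qed
  have nn: "0 \<le> (\<psi> x - \<mu>) * (f' x - f x)" for x
  proof (cases "x \<in> D")
    case True
    consider "\<psi> x < \<mu>" | "\<psi> x = \<mu>" | "\<mu> < \<psi> x" by linarith
    then show ?thesis
      using True dens_nonneg[OF f, of x] dens_le[OF f, of x]
      by cases (auto simp: f'_def h_def intro!: mult_nonpos_nonpos mult_nonpos_nonneg)
  qed (simp add: dens_off[OF f] f'_def)
  have "0 \<le> (LINT x|lborel. (\<psi> x - \<mu>) * (f' x - f x))"
    by (rule Bochner_Integration.integral_nonneg) (rule nn)
  then have "(LINT x|lborel. (\<psi> x - \<mu>) * (f' x - f x)) = 0" using e f'(2) by linarith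
  then have "AE x in lborel. (\<psi> x - \<mu>) * (f' x - f x) = 0"
    using integral_nonneg_eq_0_iff_AE[OF j] nn by simp
  then have "AE x in lborel. x \<in> D \<longrightarrow> \<mu> < \<psi> x \<longrightarrow> f x = l" "AE x in lborel. x \<in> D \<longrightarrow> \<psi> x < \<mu> \<longrightarrow> f x = 0"
    by (eventually_elim, auto simp: f'_def h_def)+
  with lA show ?thesis by (rule that)
qed

lemma psi_measurable: "dens l a f \<Longrightarrow> dens m b g \<Longrightarrow> (\<lambda>x. V f x - V g x) \<in> borel_measurable borel"
  using V_measurable dens_measurable by (intro borel_measurable_diff) auto

lemma psi_abs:
  assumes "dens l a f" "dens m b g" "x \<in> D"
  shows "\<bar>V f x - V g x\<bar> \<le> (a + 64 * l) + (b + 64 * m)"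
  by (rule order_trans[OF abs_triangle_ineq4 add_mono[OF V_abs V_abs]]) (use assms in auto)

text \<open>Monotone functions of the stream function inherit its monotonicity along circles, so the
  competitor and the segment leading to it stay admissible. The symmetry constraint thus drops out
  of the optimality condition.\<close>

lemma is_max_bathtub:
  assumes mx: "is_max v l a b f g" and a: "0 < a" "a < l * measure lborel D"
  obtains \<mu> where "l * measure lborel {x \<in> D. \<mu> < V f x - V g x} \<le> a"
    "AE x in lborel. x \<in> D \<longrightarrow> \<mu> < V f x - V g x \<longrightarrow> f x = l"
    "AE x in lborel. x \<in> D \<longrightarrow> V f x - V g x < \<mu> \<longrightarrow> f x = 0"
proof -
  have A: "Adm v l a b f g" and max: "\<And>f' g'. Adm v l a b f' g' \<Longrightarrow> J f' g' \<le> J f g"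
    using mx by (auto simp: is_max_def)
  have f: "dens l a f" "fol v f" and g: "dens l b g" "fol (- v) g"
    using A by (auto simp: Adm_def)
  show ?thesis
  proof (rule bathtub_maximizer[OF psi_measurable[OF f(1) g(1)] psi_abs[OF f(1) g(1)] f(1) a])
    fix h :: "real \<Rightarrow> real" assume h: "mono h"
    let ?f' = "\<lambda>x. indicator D x * h (V f x - V g x)"
    assume f': "dens l a ?f'"
    have "fol v ?f'"
    proof (rule fol_monotone)
      fix x y :: pt assume n: "norm x = norm y" "y \<bullet> v \<le> x \<bullet> v"
      show "?f' y \<le> ?f' x"
      proof (cases "x \<in> D")
        case True
        moreover have "y \<in> D" using n True by (simp add: D_iff)
        ultimately show ?thesis using psi_mono(1)[OF A True n] h by (simp add: monoD)
      next
        case False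
        then have "y \<notin> D" using n by (simp add: D_iff)
        then show ?thesis using False by simp
      qed
    qed
    then have "Adm v l a b (\<lambda>x. (1 - t) * f x + t * ?f' x) g" if "0 < t" "t < 1" for t
      unfolding Adm_def using dens_convex[OF f(1) f'] fol_convex[OF f(2)] g that by simp
    then show "(LINT x|lborel. (V f x - V g x) * ?f' x) \<le> (LINT x|lborel. (V f x - V g x) * f x)"
      by (intro first_variation[OF f(1) f' g(1)] max)
  qed (assumption, rule that)
qed

section \<open>Pointwise bounds on the potential at the scale \<open>1 / sqrt l\<close>\<close>

lemma sqrt_powr_scale:
  assumes "0 < (r::real)"
  shows "r powr (3/2) * sqrt r = r ^ 2"
proof -
  have "r powr (3/2) * sqrt r = r powr (3/2 + 1/2)"
    unfolding powr_half_sqrt[OF less_imp_le[OF assms], symmetric] by (rule powr_add[symmetric])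
  also have "\<dots> = r ^ 2" using assms powr_realpow[of r 2] by simp
  finally show ?thesis .
qed

definition far :: "real \<Rightarrow> (pt \<Rightarrow> real) \<Rightarrow> pt \<Rightarrow> real" where
  "far R f x = (LINT y|lborel. indicator {y. R \<le> norm (x - y)} y * f y)"

lemma far_integrable: "dens l a f \<Longrightarrow> integrable lborel (\<lambda>y. indicator {y. R \<le> norm (x - y)} y * f y)"
  by (rule dens_bounded_integrable[where C=1]) (auto simp: indicator_def)

text \<open>The cut-off radius \<open>1 / sqrt l\<close> balances both terms:
  \<open>ln (1 / r)\<close> becomes \<open>ln l / 2\<close>, and the singular part costs
  \<open>64 * r\<^sup>2 * l = 64\<close>.\<close>

lemma ell_potential_le:
  assumes f: "dens l a f" and x: "x \<in> D" and l: "1 \<le> l" and R: "1 \<le> R"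
  shows "(LINT y|lborel. ell (x - y) * f y) \<le> a * (ln l / 2) - ln R * far (R / sqrt l) f x + 64"
proof -
  let ?r = "1 / sqrt l"
  have r: "0 < ?r" "?r \<le> 1" using l by auto
  have le: "ell (x - y) + ln R * indicator {y. R / sqrt l \<le> norm (x - y)} y \<le> ln (1 / ?r) + ?r powr (3/2) * ker ?r (x - y)" for y
    using ell_le_far[OF r R, of "x - y"] by (simp add: indicator_def)
  have i: "integrable lborel (\<lambda>y. (ell (x - y) + ln R * indicator {y. R / sqrt l \<le> norm (x - y)} y) * f y)"
    using dens_ell_integrable[OF f x] far_integrable[OF f, of "R / sqrt l" x] by (simp add: distrib_right mult.assoc)
  have "(LINT y|lborel. (ell (x - y) + ln R * indicator {y. R / sqrt l \<le> norm (x - y)} y) * f y)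
    \<le> ln (1 / ?r) * a + 64 * (?r powr (3/2)) * sqrt ?r * l"
    by (rule dens_kernel_le[OF f i le r(1)]) simp
  also have "64 * (?r powr (3/2)) * sqrt ?r * l = 64 * (?r ^ 2) * l"
    using sqrt_powr_scale[OF r(1)] by (simp only: mult.assoc)
  also have "\<dots> = 64" using l by (simp add: power_divide)
  also have "ln (1 / ?r) * a = a * (ln l / 2)" using l by (simp add: ln_sqrt)
  finally show ?thesis
    using dens_ell_integrable[OF f x] far_integrable[OF f, of "R / sqrt l" x]
    by (simp add: far_def distrib_right mult.assoc)
qed

lemma V_ell:
  assumes f: "dens l a f" and x: "x \<in> D"
  shows "2 * pi * V f x = (LINT y|lborel. ln (num x y) * f y) / 2 + (LINT y|lborel. ell (x - y) * f y)"
    and "integrable lborel (\<lambda>y. ln (num x y) * f y)"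
proof -
  note [measurable] = dens_measurable[OF f]
  have nm[measurable]: "(\<lambda>y. num x y) \<in> borel_measurable borel" unfolding num_def by measurable
  have "1 - norm x > 0" using x by (simp add: D_iff)
  have b: "\<bar>ln (num x y)\<bar> \<le> \<bar>ln 4\<bar> + \<bar>ln ((1 - norm x)\<^sup>2)\<bar>" if "y \<in> D" for y
  proof -
    have "ln (num x y) \<le> ln 4" using num_le[OF x that] num_pos[OF x that] by simp
    moreover have "ln ((1 - norm x)\<^sup>2) \<le> ln (num x y)"
      by (rule ln_mono) (use num_ge[OF x that] \<open>1 - norm x > 0\<close> in auto)
    moreover have "0 \<le> ln (4::real)" by simp
    ultimately show ?thesis by linarith
  qed
  show i: "integrable lborel (\<lambda>y. ln (num x y) * f y)"
    by (rule dens_bounded_integrable[OF f _ b]) measurable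
  have "2 * pi * V f x = (LINT y|lborel. 2 * pi * (Green x y * f y))"
    by (simp add: V_def)
  also have "\<dots> = (LINT y|lborel. (ln (num x y) * f y) / 2 + ell (x - y) * f y)"
  proof (rule integral_cong_AE)
    show "AE y in lborel. 2 * pi * (Green x y * f y) = (ln (num x y) * f y) / 2 + ell (x - y) * f y"
      using AE_lborel_singleton[of x]
    proof eventually_elim
      case (elim y)
      show ?case
      proof (cases "y \<in> D")
        case True
        have "2 * pi * Green x y = ln (num x y) / 2 + ell (x - y)"
          using Green_ell[OF x True] elim by (simp add: field_simps)
        then have "(2 * pi * Green x y) * f y = (ln (num x y) / 2 + ell (x - y)) * f y" by simp
        then show ?thesis by (simp add: algebra_simps)
      qed (simp add: dens_off[OF f])
    qed
  qed measurable
  also have "\<dots> = (LINT y|lborel. ln (num x y) * f y) / 2 + (LINT y|lborel. ell (x - y) * f y)"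
    using i dens_ell_integrable[OF f x] by simp
  finally show "2 * pi * V f x = (LINT y|lborel. ln (num x y) * f y) / 2 + (LINT y|lborel. ell (x - y) * f y)" .
qed

lemma ln4: "ln 4 = 2 * ln (2::real)"
  using ln_realpow[of 2 2] by simp

text \<open>The leading term \<open>a * (ln l / 2)\<close> is, up to a constant, the largest
  potential that mass \<open>a\<close> at height \<open>l\<close> can create; the last term is the
  loss caused by mass farther than \<open>R / sqrt l\<close> from \<open>x\<close>.\<close>

lemma V_upper:
  assumes f: "dens l a f" and x: "x \<in> D" and l: "1 \<le> l" and R: "1 \<le> R"
  shows "2 * pi * V f x \<le> a * (ln l / 2) + a + 64 - ln R * far (R / sqrt l) f x"
proof -
  have "(LINT y|lborel. ln (num x y) * f y) \<le> (LINT y|lborel. ln 4 * f y)"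
    by (rule dens_kernel_mono[OF f V_ell(2)[OF f x]])
       (use dens_integrable[OF f] num_pos[OF x] num_le[OF x] in auto)
  also have "\<dots> = 2 * ln 2 * a" using dens_integral[OF f] by (simp add: ln4)
  also have "\<dots> \<le> 2 * a" using ln_2_less_1 dens_mass_nonneg[OF f] mult_right_mono[of "ln 2" 1 a] by simp
  finally show ?thesis
    using V_ell(1)[OF f x] ell_potential_le[OF f x l R] by simp
qed

lemma V_upper0:
  assumes f: "dens l a f" and x: "x \<in> D" and l: "1 \<le> l"
  shows "2 * pi * V f x \<le> a * (ln l / 2) + a + 64"
  using V_upper[OF assms, of 1] by simp

text \<open>For mass within \<open>R / sqrt l\<close> of \<open>x\<close>, \<open>num_eq\<close>
  bounds \<open>num x y\<close> by \<open>R\<^sup>2 / l + (1 - norm x ^ 2)\<close>. Close to the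
  circle this is small: the image of opposite sign cancels the potential of the near mass.\<close>

lemma V_upper_boundary:
  assumes f: "dens l a f" and x: "x \<in> D" and l: "1 \<le> l" and t: "R\<^sup>2 / l + (1 - norm x ^ 2) \<le> 1"
  shows "2 * pi * V f x \<le> a * (ln l / 2) + a + 64 + ln (R\<^sup>2 / l + (1 - norm x ^ 2)) / 2 * (a - far (R / sqrt l) f x)"
proof -
  let ?t = "R\<^sup>2 / l + (1 - norm x ^ 2)"
  have "0 < 1 - norm x ^ 2" by (rule one_minus_norm_sq_pos[OF x])
  then have t0: "0 < ?t" using l by (simp add: add_nonneg_pos)
  let ?i = "\<lambda>y. indicator {y. R / sqrt l \<le> norm (x - y)} y :: real"
  have i: "integrable lborel (\<lambda>y. (ln 4 + ln ?t * (1 - ?i y)) * f y)"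
    using dens_integrable[OF f] far_integrable[OF f, of "R / sqrt l" x]
    by (simp add: distrib_right left_diff_distrib right_diff_distrib mult.assoc)
  have "(LINT y|lborel. ln (num x y) * f y) \<le> (LINT y|lborel. (ln 4 + ln ?t * (1 - ?i y)) * f y)"
  proof (rule dens_kernel_mono[OF f V_ell(2)[OF f x] i])
    fix y assume y: "y \<in> D"
    show "ln (num x y) \<le> ln 4 + ln ?t * (1 - ?i y)"
    proof (cases "R / sqrt l \<le> norm (x - y)")
      case True
      then show ?thesis using num_pos[OF x y] num_le[OF x y] by simp
    next
      case False
      have "norm (x - y) ^ 2 \<le> (R / sqrt l)\<^sup>2" using False by (intro power_mono) auto
      also have "\<dots> = R\<^sup>2 / l" using l by (simp add: power_divide)
      finally have "num x y \<le> R\<^sup>2 / l + (1 - norm x ^ 2) * (1 - norm y ^ 2)" by (simp add: num_eq)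
      also have "(1 - norm x ^ 2) * (1 - norm y ^ 2) \<le> (1 - norm x ^ 2) * 1"
        using \<open>0 < 1 - norm x ^ 2\<close> by (intro mult_left_mono) auto
      finally have "num x y \<le> ?t" by simp
      then have "ln (num x y) \<le> ln ?t" using num_pos[OF x y] by (intro ln_mono) auto
      moreover have "0 \<le> ln (4::real)" by simp
      ultimately have "ln (num x y) \<le> ln 4 + ln ?t" by linarith
      then show ?thesis using False by simp
    qed
  qed
  also have "\<dots> = ln 4 * a + ln ?t * (a - far (R / sqrt l) f x)"
    using dens_integrable[OF f] far_integrable[OF f, of "R / sqrt l" x]
    by (simp add: distrib_right left_diff_distrib right_diff_distrib mult.assoc far_def dens_integral[OF f])
  finally have 1: "(LINT y|lborel. ln (num x y) * f y) \<le> 2 * ln 2 * a + ln ?t * (a - far (R / sqrt l) f x)" by (simp add: ln4)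
  have "2 * ln 2 * a \<le> 2 * a" using ln_2_less_1 dens_mass_nonneg[OF f] mult_right_mono[of "ln 2" 1 a] by simp
  then show ?thesis
    using 1 V_ell(1)[OF f x] ell_potential_le[OF f x l, of 1] by simp
qed

text \<open>The ratio \<open>norm (x' - y) / norm (x - y)\<close> is at most
  \<open>1 + \<rho> / norm (x - y)\<close>, whose logarithm is either bounded or absorbed by
  \<open>ker\<close>; \<open>num\<close> is bounded above everywhere and below away from the circle.
  For \<rho> of order \<open>l powr (-1/2)\<close> the change is bounded independently of
  \<open>l\<close>.\<close>

lemma V_transfer:
  assumes f: "dens l a f" and x: "x \<in> D" "c \<le> 1 - norm x" and x': "x' \<in> D" "c \<le> 1 - norm x'"
    and c: "0 < c" and \<rho>: "norm (x - x') \<le> \<rho>" "0 < \<rho>"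
  shows "2 * pi * V f x \<le> 2 * pi * V f x' + a * (2 - ln c) + 64 * \<rho>\<^sup>2 * l"
proof -
  have 1: "(LINT y|lborel. ln (num x y) * f y) \<le> (LINT y|lborel. (ln (num x' y) + (2 * ln 2 - 2 * ln c)) * f y)"
  proof (rule dens_kernel_mono[OF f V_ell(2)[OF f x(1)]])
    show "integrable lborel (\<lambda>y. (ln (num x' y) + (2 * ln 2 - 2 * ln c)) * f y)"
      using V_ell(2)[OF f x'(1)] dens_integrable[OF f] by (simp add: distrib_right)
    fix y assume y: "y \<in> D"
    have "ln (num x y) \<le> ln 4" using num_pos[OF x(1) y] num_le[OF x(1) y] by simp
    moreover have "c\<^sup>2 \<le> num x' y"
      by (rule order_trans[OF _ num_ge[OF x'(1) y]]) (use c x' in \<open>intro power_mono, auto\<close>)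
    then have "ln (c\<^sup>2) \<le> ln (num x' y)" using c by (intro ln_mono) auto
    ultimately show "ln (num x y) \<le> ln (num x' y) + (2 * ln 2 - 2 * ln c)"
      using c by (simp add: ln4 ln_realpow)
  qed
  have 2: "(LINT y|lborel. (ell (x - y) - ell (x' - y)) * f y) \<le> (LINT y|lborel. (ln 2 + \<rho> powr (3/2) * ker \<rho> (x - y)) * f y)"
  proof (rule integral_mono_AE)
    show "integrable lborel (\<lambda>y. (ell (x - y) - ell (x' - y)) * f y)"
      using dens_ell_integrable[OF f x(1)] dens_ell_integrable[OF f x'(1)] by (simp add: left_diff_distrib)
    show "integrable lborel (\<lambda>y. (ln 2 + \<rho> powr (3/2) * ker \<rho> (x - y)) * f y)"
    proof (rule dens_kernel_integrable[OF f _ _ \<rho>(2)])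
      show "\<bar>ln 2 + \<rho> powr (3/2) * ker \<rho> (x - y)\<bar> \<le> ln 2 + \<rho> powr (3/2) * ker \<rho> (x - y)" for y
        by (simp add: add_nonneg_nonneg)
    qed measurable
    show "AE y in lborel. (ell (x - y) - ell (x' - y)) * f y \<le> (ln 2 + \<rho> powr (3/2) * ker \<rho> (x - y)) * f y"
      using AE_lborel_singleton[of x] AE_lborel_singleton[of x']
    proof eventually_elim
      case (elim y)
      have n: "0 < norm (x - y)" "0 < norm (x' - y)" using elim by auto
      let ?u = "\<rho> / norm (x - y)"
      have "norm (x' - y) \<le> norm (x - y) + \<rho>"
        using norm_triangle_ineq[of "x' - x" "x - y"] \<rho>(1) by (simp add: norm_minus_commute)
      then have "norm (x' - y) / norm (x - y) \<le> 1 + ?u" using n by (simp add: field_simps)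
      then have "ln (norm (x' - y) / norm (x - y)) \<le> ln (1 + ?u)" using n by (intro ln_mono) auto
      then have 3: "ell (x - y) - ell (x' - y) \<le> ln (1 + ?u)" using n by (simp add: ell_def ln_div)
      have "ell (x - y) - ell (x' - y) \<le> ln 2 + \<rho> powr (3/2) * ker \<rho> (x - y)"
      proof (cases "norm (x - y) < \<rho>")
        case True
        then have u: "1 \<le> ?u" using n by simp
        have "ln (1 + ?u) \<le> ?u" using u by (intro ln_add_one_self_le_self) auto
        also have "?u \<le> ?u powr (3/2)" using powr_mono[of 1 "3/2" ?u] u \<rho>(2) by simp
        also have "\<dots> = \<rho> powr (3/2) * ker \<rho> (x - y)"
          by (rule ker_scale[OF \<rho>(2) _ True, symmetric]) (use elim in auto)
        also have "\<dots> \<le> ln 2 + \<rho> powr (3/2) * ker \<rho> (x - y)" by simp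
        finally show ?thesis using 3 by linarith
      next
        case False
        then have "?u \<le> 1" using n \<rho> by simp
        moreover have "0 < 1 + ?u" using n \<rho> by (simp add: add_pos_pos)
        ultimately have "ln (1 + ?u) \<le> ln 2" by (intro ln_mono) auto
        moreover have "0 \<le> \<rho> powr (3/2) * ker \<rho> (x - y)" by simp
        ultimately show ?thesis using 3 by linarith
      qed
      then show ?case using dens_nonneg[OF f] by (intro mult_right_mono)
    qed
  qed
  have i: "integrable lborel (\<lambda>y. (ln 2 + \<rho> powr (3/2) * ker \<rho> (x - y)) * f y)"
  proof (rule dens_kernel_integrable[OF f _ _ \<rho>(2)])
    show "\<bar>ln 2 + \<rho> powr (3/2) * ker \<rho> (x - y)\<bar> \<le> ln 2 + \<rho> powr (3/2) * ker \<rho> (x - y)" for y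
      by (simp add: add_nonneg_nonneg)
  qed measurable
  have "(LINT y|lborel. (ln 2 + \<rho> powr (3/2) * ker \<rho> (x - y)) * f y) \<le> ln 2 * a + 64 * (\<rho> powr (3/2)) * sqrt \<rho> * l"
    by (rule dens_kernel_le[OF f i order_refl \<rho>(2)]) simp
  also have "\<dots> = ln 2 * a + 64 * \<rho>\<^sup>2 * l"
    using sqrt_powr_scale[OF \<rho>(2)] by (simp only: mult.assoc)
  finally have 3: "(LINT y|lborel. ell (x - y) * f y) - (LINT y|lborel. ell (x' - y) * f y) \<le> ln 2 * a + 64 * \<rho>\<^sup>2 * l"
    using 2 dens_ell_integrable[OF f x(1)] dens_ell_integrable[OF f x'(1)] by (simp add: left_diff_distrib)
  have 4: "(LINT y|lborel. ln (num x y) * f y) \<le> (LINT y|lborel. ln (num x' y) * f y) + (2 * ln 2 - 2 * ln c) * a"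
    using 1 V_ell(2)[OF f x'(1)] dens_integrable[OF f] by (simp add: distrib_right dens_integral[OF f])
  have "2 * (ln 2 * a) \<le> 2 * a" using ln_2_less_1 dens_mass_nonneg[OF f] mult_right_mono[of "ln 2" 1 a] by simp
  then show ?thesis
    using 3 4 unfolding V_ell(1)[OF f x(1)] V_ell(1)[OF f x'(1)] by (simp add: algebra_simps)
qed

section \<open>Concentration\<close>

text \<open>Up to the constant \<open>K\<close>, the stream function attains at \<open>x\<close> the
  largest value that \<open>V_upper0\<close> permits.\<close>

definition good :: "real \<Rightarrow> real \<Rightarrow> real \<Rightarrow> (pt \<Rightarrow> real) \<Rightarrow> (pt \<Rightarrow> real) \<Rightarrow> pt \<Rightarrow> bool" where
  "good l a K f g x \<longleftrightarrow> x \<in> D \<and> a * (ln l / 2) - K \<le> 2 * pi * (V f x - V g x)"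

text \<open>Nothing may be lost by more than a constant in the upper bounds at such a point: neither
  by mass spread beyond \<open>R / sqrt l\<close>, nor by the image near the circle, nor by the
  potential of \<open>g\<close>.\<close>

lemma good_props:
  assumes a: "0 < a"
  obtains R c K' :: real where "0 < R" "0 < c"
    "eventually (\<lambda>l. \<forall>b f g x. dens l a f \<longrightarrow> dens l b g \<longrightarrow> good l a K f g x \<longrightarrow>
       far (R / sqrt l) f x \<le> a / 4 \<and> c \<le> 1 - norm x ^ 2 \<and> 2 * pi * V g x \<le> K') at_top"
proof -
  define K' where "K' = \<bar>K\<bar> + a + 64"
  have K': "0 < K'" using a by (simp add: K'_def)
  \<comment> \<open>Chosen so that \<open>ln R * far (R / sqrt l) f x \<le> K'\<close> means that at
    least three quarters of the mass are near.\<close>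
  define R where "R = exp (4 * K' / a)"
  have R: "1 \<le> R" "0 < R" "ln R = 4 * K' / a" using a K' by (auto simp: R_def)
  \<comment> \<open>With that near mass the boundary estimate gives
    \<open>ln t \<ge> - 8 * K' / (3 * a)\<close> for
    \<open>t = R\<^sup>2 / l + (1 - norm x ^ 2)\<close>; the exponent is rounded down to -3. Half of
    \<open>c\<close> is later given up to \<open>R\<^sup>2 / l\<close>.\<close>
  define c where "c = exp (- (3 * K' / a))"
  have c: "0 < c" "c \<le> 1" using a K' by (auto simp: c_def)
  have key: "far (R / sqrt l) f x \<le> a / 4 \<and> c / 2 \<le> 1 - norm x ^ 2 \<and> 2 * pi * V g x \<le> K'"
    if l: "1 \<le> l" "2 * R\<^sup>2 / c \<le> l" and f: "dens l a f" and g: "dens l b g" and gd: "good l a K f g x" for l b f g x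
  proof -
    have x: "x \<in> D" and ge: "a * (ln l / 2) - K \<le> 2 * pi * (V f x - V g x)" using gd by (auto simp: good_def)
    have pg: "0 \<le> 2 * pi * V g x" using V_nonneg[OF g x] by simp
    have ge': "a * (ln l / 2) - K \<le> 2 * pi * V f x - 2 * pi * V g x" using ge by (simp add: right_diff_distrib)
    have "ln R * far (R / sqrt l) f x \<le> K'"
      using V_upper[OF f x l(1) R(1)] ge' pg by (simp add: K'_def)
    then have far: "far (R / sqrt l) f x \<le> a / 4"
      using a K' by (simp add: R(3) field_simps)
    have Vg: "2 * pi * V g x \<le> K'"
      using V_upper0[OF f x l(1)] ge' by (simp add: K'_def)
    let ?t = "R\<^sup>2 / l + (1 - norm x ^ 2)"
    have Rl: "R\<^sup>2 / l \<le> c / 2" using l c by (simp add: field_simps)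
    have x1: "0 < 1 - norm x ^ 2" by (rule one_minus_norm_sq_pos[OF x])
    have "c \<le> ?t"
    proof (cases "?t \<le> 1")
      case True
      have t0: "0 < ?t" using l x1 by (simp add: add_nonneg_pos)
      have "ln ?t \<le> 0" using True t0 by simp
      then have "ln ?t / 2 * (a - far (R / sqrt l) f x) \<le> ln ?t / 2 * (3 * a / 4)"
        using far by (intro mult_left_mono_neg) auto
      then have "- K' \<le> ln ?t / 2 * (3 * a / 4)"
        using V_upper_boundary[OF f x l(1) True] ge' pg unfolding K'_def by linarith
      then have "- (8 * K' / (3 * a)) \<le> ln ?t" using a by (simp add: field_simps)
      moreover have "8 * K' / (3 * a) \<le> 3 * K' / a" using a K' by (simp add: field_simps)
      ultimately have "- (3 * K' / a) \<le> ln ?t" by linarith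
      then have "c \<le> exp (ln ?t)" unfolding c_def by simp
      then show ?thesis using t0 by simp
    qed (use c in simp)
    then have "c / 2 \<le> 1 - norm x ^ 2" using Rl by linarith
    with far Vg show ?thesis by simp
  qed
  have "eventually (\<lambda>l. \<forall>b f g x. dens l a f \<longrightarrow> dens l b g \<longrightarrow> good l a K f g x \<longrightarrow>
       far (R / sqrt l) f x \<le> a / 4 \<and> c / 2 \<le> 1 - norm x ^ 2 \<and> 2 * pi * V g x \<le> K') at_top"
    using eventually_ge_at_top[of 1] eventually_ge_at_top[of "2 * R\<^sup>2 / c"] by eventually_elim (use key in blast)
  then show ?thesis using R c by (intro that[of R "c / 2" K']) auto
qed

text \<open>At least three quarters of the mass lie within \<open>R\<close> of each point. If the
  points were \<open>2 * R\<close> apart these two portions would be disjoint.\<close>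

lemma far_close:
  assumes f: "dens l a f" and a: "0 < a" and x: "far R f x \<le> a / 4" "far R f x' \<le> a / 4"
  shows "norm (x - x') < 2 * R"
proof (rule ccontr)
  assume n: "\<not> norm (x - x') < 2 * R"
  let ?i = "\<lambda>x y. indicator {y. R \<le> norm (x - y)} y :: real"
  have i: "integrable lborel (\<lambda>y. (?i x y + ?i x' y) * f y)"
    using far_integrable[OF f, of R x] far_integrable[OF f, of R x'] by (simp add: distrib_right)
  have "(LINT y|lborel. 1 * f y) \<le> (LINT y|lborel. (?i x y + ?i x' y) * f y)"
  proof (rule dens_kernel_mono[OF f _ i])
    fix y
    have "norm (x - x') \<le> norm (x - y) + norm (x' - y)"
      using norm_triangle_ineq[of "x - y" "y - x'"] by (simp add: norm_minus_commute)
    then have "R \<le> norm (x - y) \<or> R \<le> norm (x' - y)" using n by linarith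
    then show "1 \<le> ?i x y + ?i x' y" by (auto simp: indicator_def)
  qed (use dens_integrable[OF f] in simp)
  also have "\<dots> = far R f x + far R f x'"
    using far_integrable[OF f, of R x] far_integrable[OF f, of R x'] by (simp add: distrib_right far_def)
  finally show False using x a by (simp add: dens_integral[OF f])
qed

section \<open>Test discs and lower bounds for the energy\<close>

lemma measure_ball_pt: "0 \<le> r \<Longrightarrow> measure lborel (ball (x::pt) r) = pi * r\<^sup>2"
  by (simp add: content_ball unit_ball_vol_2 power2_eq_square)

lemma measure_D: "measure lborel D = pi"
  unfolding D_def by (simp add: measure_ball_pt)

definition disc :: "pt \<Rightarrow> real \<Rightarrow> real \<Rightarrow> pt \<Rightarrow> real" where
  "disc v l a x = l * indicator (ball ((1/2) *\<^sub>R v) (sqrt (a / (pi * l)))) x"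

lemma disc_dens:
  assumes v: "norm v = 1" and a: "0 < a" and l: "0 < l" and r: "sqrt (a / (pi * l)) \<le> 1 / 4"
  shows "dens l a (disc v l a)" and "fol v (disc v l a)"
    and "disc v l a x \<noteq> 0 \<Longrightarrow> norm x \<le> 3 / 4"
    and "disc v l a x \<noteq> 0 \<Longrightarrow> norm (x - (1/2) *\<^sub>R v) < sqrt (a / (pi * l))"
proof -
  let ?r = "sqrt (a / (pi * l))"
  show near: "norm (x - (1/2) *\<^sub>R v) < ?r" if "disc v l a x \<noteq> 0" for x
    using that by (auto simp: disc_def indicator_def dist_norm norm_minus_commute split: if_splits)
  show n: "norm x \<le> 3 / 4" if "disc v l a x \<noteq> 0" for x
    using norm_triangle_ineq[of "x - (1/2) *\<^sub>R v" "(1/2) *\<^sub>R v"] near[OF that] r v by simp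
  have off: "disc v l a x = 0" if "x \<notin> D" for x
    using n[of x] that by (auto simp: D_iff)
  have "(LINT x|lborel. disc v l a x) = l * measure lborel (ball ((1/2) *\<^sub>R v) ?r)"
    by (simp add: disc_def)
  also have "\<dots> = a" using a l by (simp add: measure_ball_pt)
  finally show "dens l a (disc v l a)"
    unfolding dens_def using l off by (auto simp: disc_def[abs_def] indicator_def)
  show "fol v (disc v l a)"
  proof (rule fol_monotone)
    fix x y :: pt assume h: "norm x = norm y" "y \<bullet> v \<le> x \<bullet> v"
    have e: "norm ((1/2) *\<^sub>R v - z) ^ 2 = norm z ^ 2 - z \<bullet> v + 1 / 4" for z
      using v by (simp add: power2_norm_eq_inner inner_simps inner_commute)
    have "norm ((1/2) *\<^sub>R v - x) ^ 2 \<le> norm ((1/2) *\<^sub>R v - y) ^ 2" using h by (simp add: e)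
    then have "norm ((1/2) *\<^sub>R v - x) \<le> norm ((1/2) *\<^sub>R v - y)" by simp
    then show "disc v l a y \<le> disc v l a x"
      using l by (auto simp: disc_def indicator_def dist_norm)
  qed
qed

text \<open>Points of the disc are less than \<open>2 * r\<close> apart, and \<open>num\<close> is
  at least 1/16 on it; so \<open>ln num / 2 + ell\<close> is at least
  \<open>- ln 4 - ln (2 * r) = - ln (8 * r)\<close>.\<close>

lemma disc_self_energy:
  assumes v: "norm v = 1" and a: "0 < a" and l: "0 < l" and r: "sqrt (a / (pi * l)) \<le> 1 / 4"
  shows "- ln (8 * sqrt (a / (pi * l))) * a\<^sup>2 \<le> 2 * pi * Int2 (disc v l a) (disc v l a)"
proof -
  let ?r = "sqrt (a / (pi * l))" and ?f = "disc v l a"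
  note f = disc_dens(1)[OF assms] and n = disc_dens(3)[OF assms] and near = disc_dens(4)[OF assms]
  have r0: "0 < ?r" using a l by simp
  have V: "- ln (8 * ?r) * a \<le> 2 * pi * V ?f x" if fx: "?f x \<noteq> 0" for x
  proof -
    have x: "x \<in> D" using n[OF fx] by (simp add: D_iff)
    have i: "integrable lborel (\<lambda>y. (ln (num x y) / 2 + ell (x - y)) * ?f y)"
      using V_ell(2)[OF f x] dens_ell_integrable[OF f x] by (simp add: distrib_right)
    have "(LINT y|lborel. - ln (8 * ?r) * ?f y) \<le> (LINT y|lborel. (ln (num x y) / 2 + ell (x - y)) * ?f y)"
    proof (rule integral_mono_AE[OF _ i])
      show "AE y in lborel. - ln (8 * ?r) * ?f y \<le> (ln (num x y) / 2 + ell (x - y)) * ?f y"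
        using AE_lborel_singleton[of x]
      proof eventually_elim
        case (elim y)
        show ?case
        proof (cases "?f y = 0")
          case False
          then have y: "y \<in> D" using n[OF False] by (simp add: D_iff)
          have "(1/4)\<^sup>2 \<le> num x y"
            by (rule order_trans[OF _ num_ge[OF x y]]) (use n[OF fx] in \<open>intro power_mono, auto\<close>)
          then have "ln ((1/4)\<^sup>2) \<le> ln (num x y)" by (intro ln_mono) auto
          then have 1: "- ln 4 \<le> ln (num x y) / 2" by (simp add: ln_realpow ln_div)
          have "norm (x - y) \<le> norm (x - (1/2) *\<^sub>R v) + norm (y - (1/2) *\<^sub>R v)"
            using norm_triangle_ineq4[of "x - (1/2) *\<^sub>R v" "y - (1/2) *\<^sub>R v"] by simp
          then have "norm (x - y) \<le> 2 * ?r" using near[OF fx] near[OF False] by linarith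
          then have "ln (norm (x - y)) \<le> ln (2 * ?r)" using elim by (intro ln_mono) auto
          moreover have "ln (8 * ?r) = ln 4 + ln (2 * ?r)"
          proof -
            have "ln (4 * (2 * ?r)) = ln 4 + ln (2 * ?r)"
              by (rule ln_mult_pos) (use r0 in linarith)+
            moreover have "4 * (2 * ?r) = 8 * ?r" by linarith
            ultimately show ?thesis by metis
          qed
          ultimately have "- ln (8 * ?r) \<le> ln (num x y) / 2 + ell (x - y)" using 1 by (simp add: ell_def)
          then show ?thesis using dens_nonneg[OF f] by (intro mult_right_mono)
        qed simp
      qed
    qed (use dens_integrable[OF f] in simp)
    also have "\<dots> = 2 * pi * V ?f x"
      using V_ell[OF f x] dens_ell_integrable[OF f x] by (simp add: distrib_right)
    finally show ?thesis by (simp add: dens_integral[OF f])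
  qed
  have "(LINT x|lborel. - ln (8 * ?r) * a * ?f x) \<le> (LINT x|lborel. 2 * pi * (V ?f x * ?f x))"
  proof (rule integral_mono)
    fix x
    show "- ln (8 * ?r) * a * ?f x \<le> 2 * pi * (V ?f x * ?f x)"
    proof (cases "?f x = 0")
      case False
      have "- ln (8 * ?r) * a * ?f x \<le> 2 * pi * V ?f x * ?f x"
        by (intro mult_right_mono V[OF False] dens_nonneg[OF f])
      then show ?thesis by (simp add: mult.assoc)
    qed simp
  qed (use dens_integrable[OF f] Vf_g_integrable[OF f f] in simp_all)
  then show ?thesis by (simp add: Int2_def dens_integral[OF f] power2_eq_square mult.assoc)
qed

text \<open>The centres are at distance 1 and the radii are at most 1/4, so points of different
  discs are at least 1/2 apart and \<open>2 * pi * Green\<close> is at most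
  \<open>2 * ln 2\<close>.\<close>

lemma disc_cross_energy:
  assumes v: "norm v = 1" and a: "0 < a" and b: "0 < b" and l: "0 < l"
    and r: "sqrt (a / (pi * l)) \<le> 1 / 4" "sqrt (b / (pi * l)) \<le> 1 / 4"
  shows "2 * pi * Int2 (disc v l a) (disc (- v) l b) \<le> 2 * a * b"
proof -
  let ?f = "disc v l a" and ?g = "disc (- v) l b"
  have v': "norm (- v) = 1" using v by simp
  note f = disc_dens[OF v a l r(1)] and g = disc_dens[OF v' b l r(2)]
  have V: "2 * pi * V ?f x \<le> 2 * a" if gx: "?g x \<noteq> 0" for x
  proof -
    have x: "x \<in> D" using g(3)[OF gx] by (simp add: D_iff)
    have "(LINT y|lborel. (2 * pi * Green x y) * ?f y) \<le> (LINT y|lborel. 2 * ?f y)"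
    proof (rule integral_mono)
      fix y
      show "(2 * pi * Green x y) * ?f y \<le> 2 * ?f y"
      proof (cases "?f y = 0")
        case False
        have y: "y \<in> D" using f(3)[OF False] by (simp add: D_iff)
        have "norm v \<le> norm (y - x) + (norm (x - (1/2) *\<^sub>R (- v)) + norm (y - (1/2) *\<^sub>R v))"
        proof -
          have "v = (y - x) + ((x - (1/2) *\<^sub>R (- v)) - (y - (1/2) *\<^sub>R v))"
            by (simp add: algebra_simps scaleR_half_double[symmetric] flip: scaleR_left_distrib)
          then have "norm v \<le> norm (y - x) + norm ((x - (1/2) *\<^sub>R (- v)) - (y - (1/2) *\<^sub>R v))"
            by (metis norm_triangle_ineq)
          then show ?thesis using norm_triangle_ineq4[of "x - (1/2) *\<^sub>R (- v)" "y - (1/2) *\<^sub>R v"] by linarith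
        qed
        then have "1 / 2 \<le> norm (x - y)"
          using f(4)[OF False] g(4)[OF gx] r v by (simp add: norm_minus_commute)
        then have "ln (1 / 2) \<le> ln (norm (x - y))" by (intro ln_mono) auto
        then have "ell (x - y) \<le> ln 2" by (simp add: ell_def ln_div)
        then have "2 * pi * Green x y \<le> 2" using Green_le_ell[OF x y] ln_2_less_1 by linarith
        then show ?thesis using dens_nonneg[OF f(1)] by (intro mult_right_mono)
      qed simp
    qed (use dens_integrable[OF f(1)] Green_integrable[OF f(1) x] in \<open>simp_all add: mult.assoc\<close>)
    then show ?thesis by (simp add: V_def dens_integral[OF f(1)] mult.assoc)
  qed
  have "(LINT x|lborel. 2 * pi * (V ?f x * ?g x)) \<le> (LINT x|lborel. 2 * a * ?g x)"
  proof (rule integral_mono)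
    fix x
    show "2 * pi * (V ?f x * ?g x) \<le> 2 * a * ?g x"
    proof (cases "?g x = 0")
      case False
      have "2 * pi * V ?f x * ?g x \<le> 2 * a * ?g x"
        by (intro mult_right_mono V[OF False] dens_nonneg[OF g(1)])
      then show ?thesis by (simp add: mult.assoc)
    qed simp
  qed (use dens_integrable[OF g(1)] Vf_g_integrable[OF f(1) g(1)] in simp_all)
  then show ?thesis by (simp add: Int2_def dens_integral[OF g(1)])
qed

lemma radius_small:
  assumes "0 < (d::real)"
  shows "eventually (\<lambda>l. sqrt (a / (pi * l)) \<le> d) at_top"
proof -
  have key: "sqrt (a / (pi * l)) \<le> d" if "0 < l" "a / (pi * d\<^sup>2) \<le> l" for l
  proof -
    have "a / (pi * l) \<le> d\<^sup>2" using that assms by (simp add: field_simps)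
    then have "sqrt (a / (pi * l)) \<le> sqrt (d\<^sup>2)" by (rule real_sqrt_le_mono)
    then show ?thesis using assms by simp
  qed
  show ?thesis
    using eventually_gt_at_top[of 0] eventually_ge_at_top[of "a / (pi * d\<^sup>2)"] by eventually_elim (use key in blast)
qed

text \<open>The maximiser beats the pair of test discs. Radii of order \<open>l powr (-1/2)\<close>
  give each disc a self-energy with leading term mass squared times \<open>ln l / 2\<close>, while
  the interaction stays bounded.\<close>

lemma energy_lower:
  assumes a: "0 < a" and b: "0 < b"
  obtains K :: real where
    "eventually (\<lambda>l. \<forall>v f g. norm v = 1 \<longrightarrow> is_max v l a b f g \<longrightarrow>
       a\<^sup>2 * (ln l / 2) + b\<^sup>2 * (ln l / 2) - K \<le> 2 * pi * J f g) at_top"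
proof -
  define k where "k a = ln 8 + ln (a / pi) / 2" for a :: real
  have k: "- ln (8 * sqrt (a / (pi * l))) = ln l / 2 - k a" if "0 < a" "0 < l" for a l
  proof -
    have "ln (8 * sqrt (a / (pi * l))) = ln 8 + ln (sqrt (a / (pi * l)))"
      using that by (intro ln_mult_pos) auto
    also have "ln (sqrt (a / (pi * l))) = (ln (a / pi) - ln l) / 2"
      using that by (simp add: ln_sqrt ln_div ln_mult)
    finally show ?thesis by (simp add: k_def diff_divide_distrib)
  qed
  have key: "a\<^sup>2 * (ln l / 2) + b\<^sup>2 * (ln l / 2) - (a\<^sup>2 * k a + b\<^sup>2 * k b + 4 * a * b) \<le> 2 * pi * J f g"
    if l: "0 < l" and r: "sqrt (a / (pi * l)) \<le> 1 / 4" "sqrt (b / (pi * l)) \<le> 1 / 4"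
      and v: "norm v = 1" and mx: "is_max v l a b f g" for l v f g
  proof -
    let ?f = "disc v l a" and ?g = "disc (- v) l b"
    have v': "norm (- v) = 1" using v by simp
    have "Adm v l a b ?f ?g"
      using disc_dens(1,2)[OF v a l r(1)] disc_dens(1,2)[OF v' b l r(2)] by (simp add: Adm_def)
    then have "J ?f ?g \<le> J f g" using mx by (simp add: is_max_def)
    then have "2 * pi * J ?f ?g \<le> 2 * pi * J f g" by simp
    moreover have "2 * pi * J ?f ?g = 2 * pi * Int2 ?f ?f + 2 * pi * Int2 ?g ?g - 2 * (2 * pi * Int2 ?f ?g)"
      by (simp add: J_def algebra_simps)
    moreover have "a\<^sup>2 * (ln l / 2) - a\<^sup>2 * k a \<le> 2 * pi * Int2 ?f ?f"
      using disc_self_energy[OF v a l r(1)] by (simp only: k[OF a l]) (simp add: algebra_simps)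
    moreover have "b\<^sup>2 * (ln l / 2) - b\<^sup>2 * k b \<le> 2 * pi * Int2 ?g ?g"
      using disc_self_energy[OF v' b l r(2)] by (simp only: k[OF b l]) (simp add: algebra_simps)
    ultimately show ?thesis using disc_cross_energy[OF v a b l r] by linarith
  qed
  have r4: "eventually (\<lambda>l. sqrt (a / (pi * l)) \<le> 1 / 4) at_top" "eventually (\<lambda>l. sqrt (b / (pi * l)) \<le> 1 / 4) at_top"
    by (rule radius_small, simp)+
  have "eventually (\<lambda>l. \<forall>v f g. norm v = 1 \<longrightarrow> is_max v l a b f g \<longrightarrow>
       a\<^sup>2 * (ln l / 2) + b\<^sup>2 * (ln l / 2) - (a\<^sup>2 * k a + b\<^sup>2 * k b + 4 * a * b) \<le> 2 * pi * J f g) at_top"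
    using eventually_gt_at_top[of 0] r4 by eventually_elim (use key in blast)
  then show ?thesis by (rule that)
qed

lemma max_exists:
  assumes a: "0 < a" and b: "0 < b"
  shows "eventually (\<lambda>l. \<forall>v. norm v = 1 \<longrightarrow> (\<exists>f g. is_max v l a b f g)) at_top"
proof -
  have key: "\<exists>f g. is_max v l a b f g"
    if l: "0 < l" and r: "sqrt (a / (pi * l)) \<le> 1 / 4" "sqrt (b / (pi * l)) \<le> 1 / 4"
      and v: "norm v = 1" for l v
  proof -
    have v': "norm (- v) = 1" using v by simp
    have "Adm v l a b (disc v l a) (disc (- v) l b)"
      using disc_dens(1,2)[OF v a l r(1)] disc_dens(1,2)[OF v' b l r(2)] by (simp add: Adm_def)
    then show ?thesis by (meson maximizer_exists)
  qed
  have r4: "eventually (\<lambda>l. sqrt (a / (pi * l)) \<le> 1 / 4) at_top" "eventually (\<lambda>l. sqrt (b / (pi * l)) \<le> 1 / 4) at_top"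
    by (rule radius_small, simp)+
  show ?thesis
    using eventually_gt_at_top[of 0] r4 by eventually_elim (use key in blast)
qed

text \<open>Without such a point the mean of the stream function against \<open>f\<close> is too
  small, and the remaining part of the energy, at most \<open>Int2 g g\<close>, cannot make up for
  it: its own leading term is only \<open>b\<^sup>2 * (ln l / 2)\<close>.\<close>

lemma good_exists:
  assumes a: "0 < a" and b: "0 < b"
  obtains K :: real where
    "eventually (\<lambda>l. \<forall>v f g. norm v = 1 \<longrightarrow> is_max v l a b f g \<longrightarrow> (\<exists>x. good l a K f g x)) at_top"
proof -
  obtain K where K: "eventually (\<lambda>l. \<forall>v f g. norm v = 1 \<longrightarrow> is_max v l a b f g \<longrightarrow>
       a\<^sup>2 * (ln l / 2) + b\<^sup>2 * (ln l / 2) - K \<le> 2 * pi * J f g) at_top"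
    by (rule energy_lower[OF a b])
  \<comment> \<open>The added terms are the lower-order part of the upper bound for
    \<open>2 * pi * Int2 g g\<close>; the extra 1 in \<open>K1 / a + 1\<close> makes the
    contradiction strict.\<close>
  define K1 where "K1 = K + b\<^sup>2 + 64 * b"
  have key: "\<exists>x. good l a (K1 / a + 1) f g x"
    if l: "1 \<le> l" and mx: "is_max v l a b f g"
      and E: "a\<^sup>2 * (ln l / 2) + b\<^sup>2 * (ln l / 2) - K \<le> 2 * pi * J f g" for l v f g
  proof (rule ccontr)
    assume "\<not> (\<exists>x. good l a (K1 / a + 1) f g x)"
    then have less: "2 * pi * (V f x - V g x) \<le> a * (ln l / 2) - (K1 / a + 1)" if "x \<in> D" for x
    proof -
      have "\<not> good l a (K1 / a + 1) f g x" using \<open>\<not> (\<exists>x. good l a (K1 / a + 1) f g x)\<close> by blast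
      then show ?thesis using that unfolding good_def by linarith
    qed
    have f: "dens l a f" and g: "dens l b g" using mx by (auto simp: is_max_def Adm_def)
    have "(LINT x|lborel. (2 * pi * (V f x - V g x)) * f x) \<le> (LINT x|lborel. (a * (ln l / 2) - (K1 / a + 1)) * f x)"
    proof (rule dens_kernel_mono[OF f _ _ less])
      show "integrable lborel (\<lambda>x. (2 * pi * (V f x - V g x)) * f x)"
        using Vf_g_integrable[OF f f] Vf_g_integrable[OF g f] by (simp add: left_diff_distrib right_diff_distrib mult.assoc)
    qed (use dens_integrable[OF f] in simp)
    also have "\<dots> = (a * (ln l / 2) - (K1 / a + 1)) * a" by (simp add: dens_integral[OF f])
    also have "\<dots> = a\<^sup>2 * (ln l / 2) - K1 - a" using a by (simp add: field_simps power2_eq_square)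
    also have "(LINT x|lborel. (2 * pi * (V f x - V g x)) * f x) = 2 * pi * (Int2 f f - Int2 g f)"
      using Vf_g_integrable[OF f f] Vf_g_integrable[OF g f] by (simp add: Int2_def left_diff_distrib right_diff_distrib mult.assoc)
    finally have 1: "2 * pi * (Int2 f f - Int2 g f) \<le> a\<^sup>2 * (ln l / 2) - K1 - a" .
    have "Int2 g g \<le> ((b * (ln l / 2) + b + 64) / (2 * pi)) * b"
      by (rule Int2_le[OF g g]) (use V_upper0[OF g _ l] in \<open>simp add: field_simps\<close>)
    then have "2 * pi * Int2 g g \<le> (b * (ln l / 2) + b + 64) * b" by (simp add: field_simps)
    moreover have "0 \<le> 2 * pi * Int2 f g" using Int2_nonneg[OF f g] by simp
    moreover have "2 * pi * J f g = 2 * pi * (Int2 f f - Int2 g f) + 2 * pi * Int2 g g - 2 * pi * Int2 f g"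
      using Int2_commute[OF f g] by (simp add: J_def algebra_simps)
    moreover have "(b * (ln l / 2) + b + 64) * b = b\<^sup>2 * (ln l / 2) + b\<^sup>2 + 64 * b" by (simp add: power2_eq_square algebra_simps)
    ultimately show False using 1 E a unfolding K1_def by linarith
  qed
  have "eventually (\<lambda>l. \<forall>v f g. norm v = 1 \<longrightarrow> is_max v l a b f g \<longrightarrow> (\<exists>x. good l a (K1 / a + 1) f g x)) at_top"
    using K eventually_ge_at_top[of 1] by eventually_elim (use key in blast)
  then show ?thesis by (rule that)
qed

text \<open>If the level lay far below the value at a good point, \<open>V_transfer\<close> would
  put a whole ball around that point above the level, and its area would exceed the measure allowed
  to the superlevel set.\<close>

lemma level_lower:
  assumes a: "0 < a" and b: "0 < b"
  obtains K :: real where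
    "eventually (\<lambda>l. \<forall>v f g \<mu>. norm v = 1 \<longrightarrow> is_max v l a b f g \<longrightarrow> l * measure lborel {x \<in> D. \<mu> < V f x - V g x} \<le> a
       \<longrightarrow> a * (ln l / 2) - K \<le> 2 * pi * \<mu>) at_top"
proof -
  obtain K where K: "eventually (\<lambda>l. \<forall>v f g. norm v = 1 \<longrightarrow> is_max v l a b f g \<longrightarrow> (\<exists>x. good l a K f g x)) at_top"
    by (rule good_exists[OF a b])
  obtain R c K' where R: "0 < R" "0 < c"
    "eventually (\<lambda>l. \<forall>b f g x. dens l a f \<longrightarrow> dens l b g \<longrightarrow> good l a K f g x \<longrightarrow>
       far (R / sqrt l) f x \<le> a / 4 \<and> c \<le> 1 - norm x ^ 2 \<and> 2 * pi * V g x \<le> K') at_top"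
    by (rule good_props[OF a])
  \<comment> \<open>\<open>V_transfer\<close> is applied once to \<open>f\<close> and once to
    \<open>g\<close>, at distance \<open>c / 4\<close> from the circle; for the radius used below
    each application costs at most \<open>256 * a\<close> in its last term.\<close>
  define K3 where "K3 = (a + b) * (2 - ln (c / 4)) + 512 * a"
  have key: "a * (ln l / 2) - (K + K3) \<le> 2 * pi * \<mu>"
    if l: "0 < l" and r: "sqrt (a / (pi * l)) \<le> c / 8" and mx: "is_max v l a b f g"
      and gd: "good l a K f g x" and c: "c \<le> 1 - norm x ^ 2"
      and m: "l * measure lborel {x \<in> D. \<mu> < V f x - V g x} \<le> a" for l v f g \<mu> x
  proof (rule ccontr)
    assume n: "\<not> a * (ln l / 2) - (K + K3) \<le> 2 * pi * \<mu>"
    have f: "dens l a f" and g: "dens l b g" using mx by (auto simp: is_max_def Adm_def)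
    have x: "x \<in> D" and ge: "a * (ln l / 2) - K \<le> 2 * pi * (V f x - V g x)" using gd by (auto simp: good_def)
    have c': "c / 2 \<le> 1 - norm x"
    proof -
      have "1 - norm x ^ 2 = (1 - norm x) * (1 + norm x)" by (simp add: power2_eq_square algebra_simps)
      also have "\<dots> \<le> (1 - norm x) * 2" using x by (intro mult_left_mono) (auto simp: D_iff)
      finally show ?thesis using c by simp
    qed
    \<comment> \<open>The factor 2 gives the ball the area \<open>4 * a / l\<close>, whereas the
      superlevel set has at most \<open>a / l\<close>.\<close>
    let ?r = "2 * sqrt (a / (pi * l))"
    have r0: "0 < ?r" "?r \<le> c / 4" using a l r by auto
    have rl: "64 * ?r\<^sup>2 * l \<le> 256 * a"
    proof -
      have "64 * ?r\<^sup>2 * l = 256 * (a / pi)" using a l by (simp add: power_mult_distrib)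
      also have "\<dots> \<le> 256 * (a / 1)" using pi_ge_two a by (intro mult_left_mono divide_left_mono) auto
      finally show ?thesis by simp
    qed
    have "ball x ?r \<subseteq> {x \<in> D. \<mu> < V f x - V g x}"
    proof
      fix y assume "y \<in> ball x ?r"
      then have d: "norm (x - y) \<le> ?r" "norm (y - x) \<le> ?r" by (auto simp: dist_norm norm_minus_commute)
      have "norm y \<le> norm x + norm (y - x)" using norm_triangle_ineq[of x "y - x"] by simp
      then have y: "c / 4 \<le> 1 - norm y" using c' d r0 by linarith
      then have yD: "y \<in> D" using R(2) by (simp add: D_iff)
      have x4: "c / 4 \<le> 1 - norm x" using c' R(2) by linarith
      have "2 * pi * V f x \<le> 2 * pi * V f y + a * (2 - ln (c / 4)) + 64 * ?r\<^sup>2 * l"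
        by (rule V_transfer[OF f x x4 yD y _ d(1) r0(1)]) (use R in simp)
      moreover have "2 * pi * V g y \<le> 2 * pi * V g x + b * (2 - ln (c / 4)) + 64 * ?r\<^sup>2 * l"
        by (rule V_transfer[OF g yD y x x4 _ d(2) r0(1)]) (use R in simp)
      ultimately have "2 * pi * (V f x - V g x) \<le> 2 * pi * (V f y - V g y) + K3"
        using rl unfolding K3_def by (simp add: algebra_simps)
      then have "2 * pi * \<mu> < 2 * pi * (V f y - V g y)" using n ge by linarith
      then show "y \<in> {x \<in> D. \<mu> < V f x - V g x}" using yD by simp
    qed
    then have "measure lborel (ball x ?r) \<le> measure lborel {x \<in> D. \<mu> < V f x - V g x}"
    proof (rule measure_mono_fmeasurable)
      have [measurable]: "(\<lambda>x. V f x - V g x) \<in> borel_measurable borel" by (rule psi_measurable[OF f g])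
      have "emeasure lborel {x \<in> D. \<mu> < V f x - V g x} < \<infinity>"
        by (rule le_less_trans[OF emeasure_mono D_emeasure]) auto
      then show "{x \<in> D. \<mu> < V f x - V g x} \<in> fmeasurable lborel" by (auto simp: fmeasurable_def)
    qed simp
    then have "pi * ?r\<^sup>2 \<le> measure lborel {x \<in> D. \<mu> < V f x - V g x}"
      using measure_ball_pt[OF less_imp_le[OF r0(1)], of x] by linarith
    then have "l * (pi * ?r\<^sup>2) \<le> l * measure lborel {x \<in> D. \<mu> < V f x - V g x}" using l by (intro mult_left_mono) auto
    then have "l * (pi * ?r\<^sup>2) \<le> a" using m by linarith
    moreover have "l * (pi * ?r\<^sup>2) = 4 * a" using a l by (simp add: power_mult_distrib)
    ultimately show False using a by simp
  qed
  have r8: "eventually (\<lambda>l. sqrt (a / (pi * l)) \<le> c / 8) at_top"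
    by (rule radius_small) (use R in simp)
  have "eventually (\<lambda>l. \<forall>v f g \<mu>. norm v = 1 \<longrightarrow> is_max v l a b f g \<longrightarrow> l * measure lborel {x \<in> D. \<mu> < V f x - V g x} \<le> a
       \<longrightarrow> a * (ln l / 2) - (K + K3) \<le> 2 * pi * \<mu>) at_top"
    using K R(3) eventually_gt_at_top[of 0] r8
  proof eventually_elim
    case (elim l)
    show ?case
    proof (intro allI impI)
      fix v f g \<mu> assume h: "norm v = 1" "is_max v l a b f g" "l * measure lborel {x \<in> D. \<mu> < V f x - V g x} \<le> a"
      then obtain x where x: "good l a K f g x" using elim(1) by blast
      have "dens l a f" "dens l b g" using h by (auto simp: is_max_def Adm_def)
      then have "c \<le> 1 - norm x ^ 2" using elim(2) x by blast
      then show "a * (ln l / 2) - (K + K3) \<le> 2 * pi * \<mu>" using key[OF elim(3,4) h(2) x _ h(3)] by blast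
    qed
  qed
  then show ?thesis by (rule that)
qed

text \<open>The geometric clauses concern the closed superlevel set, since the bathtub principle
  leaves \<open>f\<close> undetermined on the level itself. They bound its distance to the circle,
  the potential of the opposite vortex on it, and its diameter.\<close>

definition patch :: "real \<Rightarrow> real \<Rightarrow> real \<Rightarrow> real \<Rightarrow> (pt \<Rightarrow> real) \<Rightarrow> (pt \<Rightarrow> real) \<Rightarrow> real \<Rightarrow> bool" where
  "patch l c K \<delta> f g \<mu> \<longleftrightarrow> 0 < \<mu> \<and>
     (AE x in lborel. x \<in> D \<longrightarrow> \<mu> < V f x - V g x \<longrightarrow> f x = l) \<and>
     (AE x in lborel. x \<in> D \<longrightarrow> V f x - V g x < \<mu> \<longrightarrow> f x = 0) \<and>
     (\<forall>x\<in>D. \<mu> \<le> V f x - V g x \<longrightarrow> c \<le> 1 - norm x ^ 2 \<and> 2 * pi * V g x \<le> K \<and>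
        (\<forall>y\<in>D. \<mu> \<le> V f y - V g y \<longrightarrow> norm (x - y) \<le> \<delta>))"

lemma patch_mono:
  assumes "patch l c K \<delta> f g \<mu>" "c' \<le> c" "K \<le> K'" "\<delta> \<le> \<delta>'"
  shows "patch l c' K' \<delta>' f g \<mu>"
  using assms unfolding patch_def by (meson order_trans)

text \<open>By \<open>level_lower\<close> the multiplier itself reaches the leading value, so every
  point of the closed superlevel set is good, and \<open>far_close\<close> bounds the distance of
  any two of them.\<close>

lemma concentration:
  assumes a: "0 < a" and b: "0 < b"
  obtains R c K :: real where "0 < R" "0 < c"
    "eventually (\<lambda>l. \<forall>v f g. norm v = 1 \<longrightarrow> is_max v l a b f g \<longrightarrow> (\<exists>\<mu>. patch l c K (R / sqrt l) f g \<mu>)) at_top"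
proof -
  obtain K where K: "eventually (\<lambda>l. \<forall>v f g \<mu>. norm v = 1 \<longrightarrow> is_max v l a b f g \<longrightarrow> l * measure lborel {x \<in> D. \<mu> < V f x - V g x} \<le> a
       \<longrightarrow> a * (ln l / 2) - K \<le> 2 * pi * \<mu>) at_top"
    by (rule level_lower[OF a b])
  obtain R c K' where R: "0 < R" "0 < c"
    "eventually (\<lambda>l. \<forall>b f g x. dens l a f \<longrightarrow> dens l b g \<longrightarrow> good l a K f g x \<longrightarrow>
       far (R / sqrt l) f x \<le> a / 4 \<and> c \<le> 1 - norm x ^ 2 \<and> 2 * pi * V g x \<le> K') at_top"
    by (rule good_props[OF a])
  have "eventually (\<lambda>l. \<forall>v f g. norm v = 1 \<longrightarrow> is_max v l a b f g \<longrightarrow> (\<exists>\<mu>. patch l c K' ((2 * R) / sqrt l) f g \<mu>)) at_top"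
    \<comment> \<open>The first threshold leaves room for the mass \<open>a\<close> at height
      \<open>l\<close> inside \<open>D\<close>, the second makes the multiplier positive.\<close>
    using K R(3) eventually_gt_at_top[of "a / pi"] eventually_gt_at_top[of "exp (2 * K / a)"]
  proof eventually_elim
    case (elim l)
    have al: "a < l * measure lborel D" using elim(3) by (simp add: measure_D field_simps)
    have l0: "0 < l" by (rule less_trans[OF exp_gt_zero elim(4)])
    have "2 * K / a < ln l" using ln_less_cancel_iff[of "exp (2 * K / a)" l] l0 elim(4) by simp
    then have pos: "0 < a * (ln l / 2) - K" using a by (simp add: field_simps)
    show ?case
    proof (intro allI impI)
      fix v f g assume v: "norm (v::pt) = 1" and mx: "is_max v l a b f g"
      have f: "dens l a f" and g: "dens l b g" using mx by (auto simp: is_max_def Adm_def)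
      show "\<exists>\<mu>. patch l c K' ((2 * R) / sqrt l) f g \<mu>"
      proof (rule is_max_bathtub[OF mx a al])
        fix \<mu>
        assume \<mu>: "l * measure lborel {x \<in> D. \<mu> < V f x - V g x} \<le> a"
          "AE x in lborel. x \<in> D \<longrightarrow> \<mu> < V f x - V g x \<longrightarrow> f x = l"
          "AE x in lborel. x \<in> D \<longrightarrow> V f x - V g x < \<mu> \<longrightarrow> f x = 0"
        have ge: "a * (ln l / 2) - K \<le> 2 * pi * \<mu>" using elim(1) v mx \<mu>(1) by blast
        then have "0 < 2 * pi * \<mu>" using pos by linarith
        then have "0 < \<mu>" by (simp add: zero_less_mult_iff)
        have P: "far (R / sqrt l) f x \<le> a / 4 \<and> c \<le> 1 - norm x ^ 2 \<and> 2 * pi * V g x \<le> K'"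
          if "x \<in> D" "\<mu> \<le> V f x - V g x" for x
        proof -
          have "2 * pi * \<mu> \<le> 2 * pi * (V f x - V g x)" using that by (intro mult_left_mono) auto
          then have "a * (ln l / 2) - K \<le> 2 * pi * (V f x - V g x)" using ge by linarith
          then have "good l a K f g x" using that unfolding good_def by blast
          then show ?thesis using elim(2) f g by blast
        qed
        have "norm (x - y) \<le> 2 * R / sqrt l" if "x \<in> D" "\<mu> \<le> V f x - V g x" "y \<in> D" "\<mu> \<le> V f y - V g y" for x y
          using far_close[OF f a, of "R / sqrt l" x y] P[OF that(1,2)] P[OF that(3,4)] by simp
        then have "patch l c K' ((2 * R) / sqrt l) f g \<mu>"
          unfolding patch_def using \<open>0 < \<mu>\<close> \<mu>(2,3) P by blast
        then show ?thesis by blast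
      qed
    qed
  qed
  then show ?thesis using R by (intro that[of "2 * R" c K']) auto
qed

section \<open>Strict monotonicity and vortex patches\<close>

lemma concentration_pair:
  assumes a: "0 < a" and b: "0 < b"
  obtains R c K :: real where "0 < R" "0 < c"
    "eventually (\<lambda>l. \<forall>v f g. norm v = 1 \<longrightarrow> is_max v l a b f g \<longrightarrow>
       (\<exists>\<mu> \<nu>. patch l c K (R / sqrt l) f g \<mu> \<and> patch l c K (R / sqrt l) g f \<nu>)) at_top"
proof -
  obtain R c K where 1: "0 < R" "0 < c"
    "eventually (\<lambda>l. \<forall>v f g. norm v = 1 \<longrightarrow> is_max v l a b f g \<longrightarrow> (\<exists>\<mu>. patch l c K (R / sqrt l) f g \<mu>)) at_top"
    by (rule concentration[OF a b])
  obtain R' c' K' where 2: "0 < R'" "0 < c'"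
    "eventually (\<lambda>l. \<forall>v f g. norm v = 1 \<longrightarrow> is_max v l b a f g \<longrightarrow> (\<exists>\<mu>. patch l c' K' (R' / sqrt l) f g \<mu>)) at_top"
    by (rule concentration[OF b a])
  have "eventually (\<lambda>l. \<forall>v f g. norm v = 1 \<longrightarrow> is_max v l a b f g \<longrightarrow>
       (\<exists>\<mu> \<nu>. patch l (min c c') (max K K') (max R R' / sqrt l) f g \<mu> \<and> patch l (min c c') (max K K') (max R R' / sqrt l) g f \<nu>)) at_top"
    using 1(3) 2(3) eventually_gt_at_top[of 0]
  proof eventually_elim
    case (elim l)
    show ?case
    proof (intro allI impI)
      fix v f g assume v: "norm (v::pt) = 1" and mx: "is_max v l a b f g"
      have v': "norm (- v) = 1" using v by simp
      obtain \<mu> where \<mu>: "patch l c K (R / sqrt l) f g \<mu>" using elim(1) v mx by blast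
      obtain \<nu> where \<nu>: "patch l c' K' (R' / sqrt l) g f \<nu>" using elim(2) v' is_max_swap[OF mx] by blast
      have "patch l (min c c') (max K K') (max R R' / sqrt l) f g \<mu>"
        by (rule patch_mono[OF \<mu>]) (use elim(3) in \<open>auto intro: divide_right_mono\<close>)
      moreover have "patch l (min c c') (max K K') (max R R' / sqrt l) g f \<nu>"
        by (rule patch_mono[OF \<nu>]) (use elim(3) in \<open>auto intro: divide_right_mono\<close>)
      ultimately show "\<exists>\<mu> \<nu>. patch l (min c c') (max K K') (max R R' / sqrt l) f g \<mu> \<and> patch l (min c c') (max K K') (max R R' / sqrt l) g f \<nu>"
        by blast
    qed
  qed
  then show ?thesis using 1 2 by (intro that[of "max R R'" "min c c'" "max K K'"]) auto
qed

text \<open>The potential of \<open>g\<close> is bounded by \<open>K\<close> at \<open>x\<close>.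
  But if all of \<open>g\<close> sits within distance \<open>d\<close> of \<open>x\<close>, and both
  stay away from the circle, then \<open>2 * pi * V g x \<ge> b * ln (c / d)\<close>; so
  \<open>d\<close> cannot be less than \<open>c * exp (- K / b)\<close>.\<close>

lemma patch_separation:
  assumes g: "dens l b g" and b: "0 < b" and P: "patch l c K \<delta> f g \<mu>" and Q: "patch l c K \<delta> g f \<nu>" and c: "0 < c"
    and \<delta>: "\<delta> \<le> c * exp (- K / b) / 2"
    and x: "x \<in> D" "\<mu> \<le> V f x - V g x" and y: "y \<in> D" "\<nu> \<le> V g y - V f y"
  shows "c * exp (- K / b) / 2 \<le> norm (x - y)"
proof (rule ccontr)
  assume n: "\<not> c * exp (- K / b) / 2 \<le> norm (x - y)"
  \<comment> \<open>Bounds the distance from \<open>x\<close> to every point carrying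
    \<open>g\<close>; the claimed separation and the diameter may each use half of the critical
    value.\<close>
  define d where "d = norm (x - y) + \<delta>"
  have d: "d < c * exp (- K / b)" using n \<delta> by (simp add: d_def)
  have "0 \<le> \<delta>" using Q y unfolding patch_def by (metis cancel_comm_monoid_add_class.diff_cancel norm_zero)
  have "c \<le> 1 - norm x ^ 2" "2 * pi * V g x \<le> K" using P x by (auto simp: patch_def)
  have "(LINT z|lborel. ln (c / d) * g z) \<le> (LINT z|lborel. (ln (num x z) / 2 + ell (x - z)) * g z)"
  proof (rule integral_mono_AE)
    show "AE z in lborel. ln (c / d) * g z \<le> (ln (num x z) / 2 + ell (x - z)) * g z"
      using AE_lborel_singleton[of x] Q[unfolded patch_def, THEN conjunct2, THEN conjunct2, THEN conjunct1]
    proof eventually_elim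
      case (elim z)
      show ?case
      proof (cases "z \<in> D \<and> \<nu> \<le> V g z - V f z")
        case True
        then have z: "c \<le> 1 - norm z ^ 2" "norm (y - z) \<le> \<delta>" using Q y by (auto simp: patch_def)
        have "c * c \<le> (1 - norm x ^ 2) * (1 - norm z ^ 2)"
          using \<open>c \<le> 1 - norm x ^ 2\<close> z c by (intro mult_mono) auto
        also have "\<dots> \<le> num x z" by (simp add: num_eq)
        finally have "ln (c * c) \<le> ln (num x z)" using c by (intro ln_mono) auto
        then have 1: "ln c \<le> ln (num x z) / 2" using c by (simp add: ln_mult)
        have "norm (x - z) \<le> d" using norm_triangle_ineq[of "x - y" "y - z"] z by (simp add: d_def)
        moreover have xz: "0 < norm (x - z)" using elim by simp
        ultimately have "ln (norm (x - z)) \<le> ln d" by (intro ln_mono)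
        have d0: "0 < d" using xz \<open>norm (x - z) \<le> d\<close> by linarith
        have "ln (c / d) \<le> ln (num x z) / 2 + ell (x - z)" using 1 c d0 \<open>ln (norm (x - z)) \<le> ln d\<close> by (simp add: ln_div ell_def)
        then show ?thesis using dens_nonneg[OF g] by (intro mult_right_mono)
      next
        case False
        then have "g z = 0" using elim(2) dens_off[OF g, of z] by auto
        then show ?thesis by simp
      qed
    qed
  qed (use dens_integrable[OF g] V_ell(2)[OF g x(1)] dens_ell_integrable[OF g x(1)] in \<open>simp_all add: distrib_right\<close>)
  also have "\<dots> = 2 * pi * V g x"
    using V_ell[OF g x(1)] dens_ell_integrable[OF g x(1)] by (simp add: distrib_right)
  finally have "ln (c / d) * b \<le> K" using \<open>2 * pi * V g x \<le> K\<close> by (simp add: dens_integral[OF g])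
  then have le: "ln (c / d) \<le> K / b" using b by (simp add: field_simps)
  show False
  proof (cases "d = 0")
    case True
    text \<open>Then the whole mass of \<open>g\<close> would sit in the single point \<open>x = y\<close>.\<close>
    have xy: "x = y" "\<delta> = 0" using True \<open>0 \<le> \<delta>\<close> by (auto simp: d_def add_nonneg_eq_0_iff)
    have "AE z in lborel. g z = 0"
      using AE_lborel_singleton[of y] Q[unfolded patch_def, THEN conjunct2, THEN conjunct2, THEN conjunct1]
    proof eventually_elim
      case (elim z)
      show ?case
      proof (cases "z \<in> D \<and> \<nu> \<le> V g z - V f z")
        case True
        then have "norm (y - z) \<le> \<delta>" using Q y by (auto simp: patch_def)
        then show ?thesis using xy elim by simp
      next
        case False
        then show ?thesis using elim(2) dens_off[OF g, of z] by auto
      qed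
    qed
    then have "(LINT z|lborel. g z) = 0" by (simp add: integral_eq_zero_AE)
    then show False using dens_integral[OF g] b by simp
  next
    case False
    then have d0: "0 < d" using \<open>0 \<le> \<delta>\<close> by (simp add: d_def add_nonneg_eq_0_iff less_le)
    then have "c / d \<le> exp (K / b)" using le c by (metis divide_pos_pos exp_le_cancel_iff exp_ln)
    then have "c * exp (- K / b) \<le> d" using d0 by (simp add: field_simps exp_minus)
    then show False using d by simp
  qed
qed

section \<open>Centres of mass and invariance under reflections\<close>

lemma center_near:
  assumes f: "dens l a f" and a: "0 < a" and near: "AE y in lborel. f y \<noteq> 0 \<longrightarrow> norm (x - y) \<le> \<delta>"
  shows "norm (x - (1 / a) *\<^sub>R (LINT y|lborel. f y *\<^sub>R y)) \<le> \<delta>"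
    and "integrable lborel (\<lambda>y. f y *\<^sub>R y)"
proof -
  note [measurable] = dens_measurable[OF f]
  show i: "integrable lborel (\<lambda>y. f y *\<^sub>R y)"
  proof (rule Bochner_Integration.integrable_bound[OF dens_integrable[OF f]])
    have "norm (f y *\<^sub>R y) \<le> norm (f y)" for y
      using dens_off[OF f, of y] by (cases "y \<in> D") (auto simp: D_iff mult_left_le)
    then show "AE y in lborel. norm (f y *\<^sub>R y) \<le> norm (f y)" by simp
  qed measurable
  have "a *\<^sub>R x - (LINT y|lborel. f y *\<^sub>R y) = (LINT y|lborel. f y *\<^sub>R x - f y *\<^sub>R y)"
    using i dens_integrable[OF f] by (simp add: dens_integral[OF f])
  also have "norm \<dots> \<le> (LINT y|lborel. norm (f y *\<^sub>R x - f y *\<^sub>R y))"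
    by (rule integral_norm_bound)
  also have "\<dots> \<le> (LINT y|lborel. \<delta> * f y)"
  proof (rule integral_mono_AE)
    show "AE y in lborel. norm (f y *\<^sub>R x - f y *\<^sub>R y) \<le> \<delta> * f y"
      using near
    proof eventually_elim
      case (elim y)
      have "norm (f y *\<^sub>R x - f y *\<^sub>R y) = f y * norm (x - y)"
        using dens_nonneg[OF f, of y] by (simp add: scaleR_diff_right[symmetric])
      then show ?case using elim dens_nonneg[OF f, of y]
        by (cases "f y = 0") (auto simp: mult.commute intro: mult_right_mono)
    qed
  qed (use i dens_integrable[OF f] in auto)
  also have "\<dots> = \<delta> * a" by (simp add: dens_integral[OF f])
  finally have "norm (a *\<^sub>R x - (LINT y|lborel. f y *\<^sub>R y)) \<le> \<delta> * a" .
  moreover have "a *\<^sub>R x - (LINT y|lborel. f y *\<^sub>R y) = a *\<^sub>R (x - (1 / a) *\<^sub>R (LINT y|lborel. f y *\<^sub>R y))"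
    using a by (simp add: scaleR_diff_right)
  ultimately have "a * norm (x - (1 / a) *\<^sub>R (LINT y|lborel. f y *\<^sub>R y)) \<le> a * \<delta>"
    using a by (simp add: mult.commute)
  then show "norm (x - (1 / a) *\<^sub>R (LINT y|lborel. f y *\<^sub>R y)) \<le> \<delta>" using a by simp
qed

definition perp :: "pt \<Rightarrow> pt" where
  "perp v = (- snd v, fst v)"

lemma perp_norm [simp]: "norm (perp v) = norm v"
  by (cases v) (simp add: perp_def norm_Pair)

lemma perp_inner [simp]: "perp v \<bullet> v = 0" "v \<bullet> perp v = 0"
  by (cases v, simp add: perp_def)+

lemma frame_expand:
  assumes "norm v = 1"
  shows "x = (x \<bullet> v) *\<^sub>R v + (x \<bullet> perp v) *\<^sub>R perp v"
proof -
  obtain p q where v: "v = (p, q)" by force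
  obtain s t where x: "x = (s, t)" by force
  have 1: "p * p + q * q = 1" using assms by (simp add: v norm_Pair power2_eq_square)
  have "s = s * (p * p + q * q)" "t = t * (p * p + q * q)" using 1 by auto
  then show ?thesis by (simp add: x v perp_def algebra_simps)
qed

text \<open>For \<open>e\<close> orthogonal to \<open>v\<close> both \<open>e\<close> and
  \<open>- e\<close> are permitted directions, so the reflection inequality holds in both
  senses.\<close>

lemma fol_even:
  assumes f: "f \<in> borel_measurable borel" and F: "fol v f" and e: "norm e = 1" "e \<bullet> v = 0"
  shows "AE x in lborel. f (mirror e x) = f x"
proof -
  note [measurable] = f
  have 1: "AE x in lborel. 0 < x \<bullet> e \<longrightarrow> f (mirror e x) \<le> f x"
    by (rule fol_AE[OF F e(1)]) (simp add: e)
  have 2: "AE x in lborel. 0 < x \<bullet> (- e) \<longrightarrow> f (mirror (- e) x) \<le> f x"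
    by (rule fol_AE[OF F]) (simp_all add: e)
  have 3: "AE x in lborel. 0 < mirror e x \<bullet> e \<longrightarrow> f (mirror e (mirror e x)) \<le> f (mirror e x)"
    by (rule AE_mirror[OF _ e(1) 1]) measurable
  have 4: "AE x in lborel. 0 < mirror e x \<bullet> (- e) \<longrightarrow> f (mirror (- e) (mirror e x)) \<le> f (mirror e x)"
    by (rule AE_mirror[OF _ e(1) 2]) measurable
  from 1 2 3 4 show ?thesis
  proof eventually_elim
    case (elim x)
    consider "x \<bullet> e = 0" | "0 < x \<bullet> e" | "x \<bullet> e < 0" by linarith
    then show ?case
    proof cases
      case 1
      then show ?thesis by (simp add: mirror_def)
    qed (use elim e mirror_inner_unit[OF e(1), of x] in \<open>auto simp: mirror_uminus\<close>)
  qed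
qed

text \<open>The moment in the direction \<open>e\<close> changes sign under the reflection, whereas
  the invariance of \<open>f\<close> leaves it unchanged.\<close>

lemma center_mirror_invariant:
  assumes f: "dens l a f" and e: "norm e = 1" and inv: "AE x in lborel. f (mirror e x) = f x"
  shows "(LINT y|lborel. f y *\<^sub>R y) \<bullet> e = 0"
proof -
  note [measurable] = dens_measurable[OF f]
  have i: "integrable lborel (\<lambda>y. f y *\<^sub>R y)"
  proof (rule Bochner_Integration.integrable_bound[OF dens_integrable[OF f]])
    have "norm (f y *\<^sub>R y) \<le> norm (f y)" for y
      using dens_off[OF f, of y] by (cases "y \<in> D") (auto simp: D_iff mult_left_le)
    then show "AE y in lborel. norm (f y *\<^sub>R y) \<le> norm (f y)" by simp
  qed measurable
  have 1: "(LINT y|lborel. f y *\<^sub>R y) \<bullet> e = (LINT y|lborel. f y * (y \<bullet> e))"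
    using integral_inner_left[of e lborel "\<lambda>y. f y *\<^sub>R y"] i by simp
  have "(LINT y|lborel. f y * (y \<bullet> e)) = (LINT y|lborel. f (mirror e y) * (mirror e y \<bullet> e))"
    by (subst integral_mirror[OF _ e, of "\<lambda>y. f y * (y \<bullet> e)"]) simp_all
  also have "\<dots> = (LINT y|lborel. - (f y * (y \<bullet> e)))"
  proof (rule integral_cong_AE)
    show "AE y in lborel. f (mirror e y) * (mirror e y \<bullet> e) = - (f y * (y \<bullet> e))"
      using inv by eventually_elim (simp add: mirror_inner_unit[OF e])
  qed measurable
  finally show ?thesis using 1 by simp
qed

lemma patch_support_AE:
  assumes P: "patch l c K \<delta> f g \<mu>" and f: "dens l a f" and x: "x \<in> D" "\<mu> \<le> V f x - V g x"
  shows "AE y in lborel. f y \<noteq> 0 \<longrightarrow> norm (x - y) \<le> \<delta>"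
  using P[unfolded patch_def, THEN conjunct2, THEN conjunct2, THEN conjunct1]
proof eventually_elim
  case (elim y)
  show ?case
  proof
    assume "f y \<noteq> 0"
    then have "y \<in> D" "\<mu> \<le> V f y - V g y" using elim dens_off[OF f, of y] by auto
    then show "norm (x - y) \<le> \<delta>" using P x by (auto simp: patch_def)
  qed
qed

lemma patch_nonempty:
  assumes P: "patch l c K \<delta> f g \<mu>" and f: "dens l a f" and a: "0 < a"
  obtains x where "x \<in> D" "\<mu> \<le> V f x - V g x"
proof -
  have "\<exists>x\<in>D. \<mu> \<le> V f x - V g x"
  proof (rule ccontr)
    assume n: "\<not> (\<exists>x\<in>D. \<mu> \<le> V f x - V g x)"
    have "AE x in lborel. f x = 0"
      using P[unfolded patch_def, THEN conjunct2, THEN conjunct2, THEN conjunct1]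
    proof eventually_elim
      case (elim y)
      then show ?case using n dens_off[OF f, of y] by force
    qed
    then have "(LINT z|lborel. f z) = 0" by (simp add: integral_eq_zero_AE)
    then show False using dens_integral[OF f] a by simp
  qed
  then show ?thesis using that by blast
qed

text \<open>Equality at different heights gives a common reflection of \<open>f\<close> and
  \<open>g\<close> with \<open>e \<bullet> v > 0\<close>. Together with evenness across the axis it
  forces both centres of mass to the origin, hence both supports into its \<delta>-neighbourhood,
  against their separation.\<close>

lemma psi_strict:
  assumes A: "Adm v l a b f g" and v: "norm v = 1" and ab: "0 < a" "0 < b"
    and P: "patch l c K \<delta> f g \<mu>" and Q: "patch l c K \<delta> g f \<nu>" and c: "0 < c"
    and \<delta>: "\<delta> < c * exp (- K / b) / 4" "0 < \<delta>"
    and x: "x \<in> D" "norm x = norm y" and eq: "V f x - V g x = V f y - V g y"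
  shows "x \<bullet> v = y \<bullet> v"
proof -
  have f: "dens l a f" "fol v f" and g: "dens l b g" "fol (- v) g" using A by (auto simp: Adm_def)
  have main: False if x: "x \<in> D" "norm x = norm y" and eq: "V f x - V g x = V f y - V g y" and lt: "y \<bullet> v < x \<bullet> v" for x y
  proof -
    have "x \<noteq> y" using lt by auto
    then obtain e where e: "norm e = 1" "e \<bullet> v = (x \<bullet> v - y \<bullet> v) / norm (x - y)"
        "AE z in lborel. f (mirror e z) = f z" "AE z in lborel. g (mirror e z) = g z"
      using psi_mono(2)[OF A x less_imp_le[OF lt] _ eq[symmetric]] by blast
    have ev: "0 < e \<bullet> v" using e(2) lt \<open>x \<noteq> y\<close> by simp
    have zero: "(LINT y|lborel. h y *\<^sub>R y) = 0" if h: "dens l m h" and w: "fol w h" "w = v \<or> w = - v"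
      and inv: "AE z in lborel. h (mirror e z) = h z" for h m w
    proof -
      let ?X = "LINT y|lborel. h y *\<^sub>R y"
      have "norm (perp v) = 1" "perp v \<bullet> w = 0" using v w(2) by auto
      then have 1: "?X \<bullet> perp v = 0"
        by (intro center_mirror_invariant[OF h] fol_even[OF dens_measurable[OF h] w(1)])
      have X: "?X = (?X \<bullet> v) *\<^sub>R v" using frame_expand[OF v, of ?X] 1 by simp
      have "?X \<bullet> e = 0" by (rule center_mirror_invariant[OF h e(1) inv])
      moreover have "?X \<bullet> e = (?X \<bullet> v) * (v \<bullet> e)" by (subst X) (simp only: inner_scaleR_left)
      ultimately have "?X \<bullet> v = 0" using ev by (simp add: inner_commute)
      then show ?thesis using X by simp
    qed
    obtain p where p: "p \<in> D" "\<mu> \<le> V f p - V g p" by (rule patch_nonempty[OF P f(1) ab(1)])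
    obtain q where q: "q \<in> D" "\<nu> \<le> V g q - V f q" by (rule patch_nonempty[OF Q g(1) ab(2)])
    have "norm p \<le> \<delta>" using center_near(1)[OF f(1) ab(1) patch_support_AE[OF P f(1) p]] zero[OF f disjI1[OF refl] e(3)] by simp
    moreover have "norm q \<le> \<delta>" using center_near(1)[OF g(1) ab(2) patch_support_AE[OF Q g(1) q]] zero[OF g disjI2[OF refl] e(4)] by simp
    moreover have "c * exp (- K / b) / 2 \<le> norm (p - q)"
      by (rule patch_separation[OF g(1) ab(2) P Q c _ p q]) (use \<delta> in linarith)
    moreover have "norm (p - q) \<le> norm p + norm q" by (rule norm_triangle_ineq4)
    ultimately show False using \<delta>(1) by linarith
  qed
  have yD: "y \<in> D" using x by (simp add: D_iff)
  show ?thesis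
    using main[OF x eq] main[OF yD x(2)[symmetric] eq[symmetric]] by (cases "x \<bullet> v" "y \<bullet> v" rule: linorder_cases) auto
qed

text \<open>Reflections \<open>S\<^sub>n\<close> of \<open>S\<close> in infinitely many lines through the origin are pairwise almost
  disjoint, since \<open>S\<^sub>n \<inter> S\<^sub>m\<close> lies in a line; all having the same measure, they are null.\<close>

lemma circle_thin_null:
  assumes [measurable]: "S \<in> sets borel" and SD: "S \<subseteq> D" and v: "norm v = 1"
    and thin: "\<And>x y. x \<in> S \<Longrightarrow> y \<in> S \<Longrightarrow> norm x = norm y \<Longrightarrow> x \<bullet> v = y \<bullet> v"
  shows "measure lborel S = 0"
proof -
  \<comment> \<open>Pairwise non-parallel directions, normalised by
    \<open>u n \<bullet> v = 1\<close> so that their projections can be compared explicitly.\<close>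
  define u where "u n = v + real n *\<^sub>R perp v" for n :: nat
  define e where "e n = u n /\<^sub>R norm (u n)" for n
  have uv: "u n \<bullet> v = 1" for n using v by (simp add: u_def inner_simps)
  have nu: "norm (u n) > 0" for n using uv[of n] by (metis inner_zero_left norm_eq_zero norm_ge_zero order_le_less zero_neq_one)
  have e: "norm (e n) = 1" for n using nu[of n] by (simp add: e_def)
  have uu: "norm (u n) ^ 2 = 1 + real n ^ 2" for n
    unfolding power2_norm_eq_inner u_def using v by (simp add: inner_simps power2_eq_square)
  \<comment> \<open>Equal heights of \<open>mirror (e n) x\<close> and \<open>mirror (e m) x\<close>
    along \<open>v\<close> mean exactly \<open>x \<bullet> w n m = 0\<close>; for
    \<open>n \<noteq> m\<close> this is a line.\<close>
  define w where "w n m = (e n \<bullet> v) *\<^sub>R e n - (e m \<bullet> v) *\<^sub>R e m" for n m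
  have ee: "(e n \<bullet> v) *\<^sub>R e n = (1 / (1 + real n ^ 2)) *\<^sub>R u n" for n
  proof -
    have "e n \<bullet> v = inverse (norm (u n))" using uv[of n] by (simp add: e_def)
    then show ?thesis
      unfolding uu[symmetric] by (simp add: e_def power2_eq_square divide_inverse)
  qed
  have w: "w n m \<noteq> 0" if "n \<noteq> m" for n m
  proof
    assume "w n m = 0"
    then have "(1 / (1 + real n ^ 2)) *\<^sub>R u n \<bullet> v = (1 / (1 + real m ^ 2)) *\<^sub>R u m \<bullet> v"
      by (simp add: w_def ee)
    then have "1 / (1 + real n ^ 2) = 1 / (1 + real m ^ 2)" by (simp only: inner_scaleR_left uv mult_1_right)
    then have "1 + real n ^ 2 = 1 + real m ^ 2" by simp
    then have "real n = real m" by (simp add: power2_eq_iff_nonneg)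
    then show False using that by simp
  qed
  define B where "B n = {x. mirror (e n) x \<in> S}" for n
  have [measurable]: "B n \<in> sets borel" for n unfolding B_def by measurable
  have BD: "B n \<subseteq> D" for n using SD e by (auto simp: B_def)
  have mB: "measure lborel (B n) = measure lborel S" for n
  proof -
    have "measure lborel S = measure (distr lborel borel (mirror (e n))) S" by (simp add: distr_mirror[OF e])
    also have "\<dots> = measure lborel (B n)" by (subst measure_distr) (auto simp: B_def vimage_def)
    finally show ?thesis by simp
  qed
  have meet: "x \<bullet> w n m = 0" if "x \<in> B n" "x \<in> B m" for x n m
  proof -
    have "mirror (e n) x \<bullet> v = mirror (e m) x \<bullet> v"
      by (rule thin) (use that e in \<open>auto simp: B_def\<close>)
    then show ?thesis by (simp add: mirror_def w_def inner_simps inner_commute mult.commute)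
  qed
  have ae: "AE x in lborel. n \<noteq> m \<longrightarrow> x \<bullet> w n m \<noteq> 0" for n m
  proof (cases "n = m")
    case False
    have "negligible {x. w n m \<bullet> x = 0}" by (rule negligible_hyperplane) (use w[OF False] in simp)
    then have "{x. w n m \<bullet> x = 0} \<in> null_sets lebesgue" by (simp add: negligible_iff_null_sets)
    moreover have "{x. w n m \<bullet> x = 0} \<in> sets borel" by measurable
    ultimately have "{x. w n m \<bullet> x = 0} \<in> null_sets lborel" by (simp add: null_sets_completion_iff)
    then show ?thesis by (rule AE_I') (auto simp: inner_commute)
  qed simp
  have bound: "real N * measure lborel S \<le> measure lborel D" for N
  proof -
    have fin: "emeasure lborel (B n) < \<infinity>" for n
      by (rule le_less_trans[OF emeasure_mono[OF BD] D_emeasure]) simp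
    have "real N * measure lborel S = (LINT x|lborel. (\<Sum>n<N. indicator (B n) x))"
      using fin by (subst Bochner_Integration.integral_sum) (simp_all add: mB integrable_indicator_iff)
    also have "\<dots> \<le> (LINT x|lborel. indicator D x)"
    proof (rule integral_mono_AE)
      have "AE x in lborel. \<forall>n m. n \<noteq> m \<longrightarrow> x \<bullet> w n m \<noteq> 0"
        using ae by (simp add: AE_all_countable)
      then show "AE x in lborel. (\<Sum>n<N. indicator (B n) x) \<le> (indicator D x :: real)"
      proof eventually_elim
        case (elim x)
        have "(\<Sum>n<N. indicator (B n) x) = (real (card {n \<in> {..<N}. x \<in> B n}))"
          by (simp add: indicator_def sum.If_cases Int_def of_bool_def[symmetric] if_distrib)
        also have "card {n \<in> {..<N}. x \<in> B n} \<le> 1"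
        proof -
          have "n = m" if "x \<in> B n" "x \<in> B m" for n m using elim meet[OF that] by blast
          then show ?thesis by (subst One_nat_def, subst card_le_Suc0_iff_eq) simp_all
        qed
        finally have 1: "(\<Sum>n<N. indicator (B n) x) \<le> (1::real)" by simp
        show ?case
        proof (cases "x \<in> D")
          case False
          then have "x \<notin> B n" for n using BD by blast
          then show ?thesis by simp
        qed (use 1 in simp)
      qed
    qed (use fin integrable_indicator_D in \<open>auto simp: integrable_indicator_iff intro!: Bochner_Integration.integrable_sum\<close>)
    finally show ?thesis by simp
  qed
  show ?thesis
  proof (rule ccontr)
    assume "measure lborel S \<noteq> 0"
    then have "0 < measure lborel S" by (simp add: less_le)
    then obtain N where "measure lborel D < real N * measure lborel S" using reals_Archimedean3 by blast
    then show False using bound[of N] by simp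
  qed
qed

text \<open>Collects what the maximisation has produced, now pointwise and for exact patches:
  \<open>F\<close> and \<open>G\<close> are superlevel sets of the stream function they generate
  themselves. The constants \<open>c\<close>, \<delta> and \<open>s\<close> control the distance to
  the circle, the diameters and the separation.\<close>

definition steady :: "pt \<Rightarrow> real \<Rightarrow> real \<Rightarrow> real \<Rightarrow> real \<Rightarrow> real \<Rightarrow> real \<Rightarrow> (pt \<Rightarrow> real) \<Rightarrow> (pt \<Rightarrow> real) \<Rightarrow> real \<Rightarrow> real \<Rightarrow> bool" where
  "steady v l a b c \<delta> s F G \<mu> \<nu> \<longleftrightarrow> dens l a F \<and> dens l b G \<and> 0 < \<mu> \<and> 0 < \<nu> \<and> fol v F \<and> fol (- v) G \<and>
     F = (\<lambda>x. l * indicator {x \<in> D. \<mu> < V F x - V G x} x) \<and> G = (\<lambda>x. l * indicator {x \<in> D. \<nu> < V G x - V F x} x) \<and>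
     (\<forall>x. F x \<noteq> 0 \<longrightarrow> c \<le> 1 - norm x ^ 2) \<and> (\<forall>x. G x \<noteq> 0 \<longrightarrow> c \<le> 1 - norm x ^ 2) \<and>
     (\<forall>x y. F x \<noteq> 0 \<longrightarrow> F y \<noteq> 0 \<longrightarrow> norm (x - y) \<le> \<delta>) \<and> (\<forall>x y. G x \<noteq> 0 \<longrightarrow> G y \<noteq> 0 \<longrightarrow> norm (x - y) \<le> \<delta>) \<and>
     (\<forall>x y. F x \<noteq> 0 \<longrightarrow> G y \<noteq> 0 \<longrightarrow> s \<le> norm (x - y))"

lemma steady_swap: "steady v l a b c \<delta> s F G \<mu> \<nu> \<Longrightarrow> steady (- v) l b a c \<delta> s G F \<nu> \<mu>"
  unfolding steady_def minus_minus
  by (elim conjE, intro conjI; (assumption | (intro allI impI, subst norm_minus_commute, blast)))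

lemma V_cong_AE:
  assumes [measurable]: "f \<in> borel_measurable borel" "g \<in> borel_measurable borel" and "AE x in lborel. f x = g x"
  shows "V f = V g"
proof
  fix x show "V f x = V g x"
    unfolding V_def
  proof (rule integral_cong_AE)
    show "AE y in lborel. Green x y * f y = Green x y * g y" using assms(3) by eventually_elim simp
  qed measurable
qed

text \<open>Strict monotonicity lets the level set meet each circle at a single height only, so it
  is null and the undetermined values of \<open>f\<close> do not matter. The representative
  \<open>F\<close> is determined everywhere and generates the same potential.\<close>

lemma patch_exact:
  assumes A: "Adm v l a b f g" and v: "norm v = 1" and P: "patch l c K \<delta> f g \<mu>"
    and strict: "\<forall>x y. x \<in> D \<longrightarrow> norm x = norm y \<longrightarrow> V f x - V g x = V f y - V g y \<longrightarrow> x \<bullet> v = y \<bullet> v"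
  defines "F \<equiv> \<lambda>x. l * indicator {x \<in> D. \<mu> < V f x - V g x} x"
  shows "AE x in lborel. f x = F x" "dens l a F" "fol v F"
proof -
  have f: "dens l a f" "fol v f" and g: "dens l b g" "fol (- v) g" using A by (auto simp: Adm_def)
  have [measurable]: "(\<lambda>x. V f x - V g x) \<in> borel_measurable borel" by (rule psi_measurable[OF f(1) g(1)])
  note [measurable] = dens_measurable[OF f(1)]
  have Fm[measurable]: "F \<in> borel_measurable borel" unfolding F_def by measurable
  let ?S = "{x \<in> D. V f x - V g x = \<mu>}"
  have "measure lborel ?S = 0"
  proof (rule circle_thin_null[OF _ _ v])
    fix x y assume "x \<in> ?S" "y \<in> ?S" "norm x = norm y"
    then show "x \<bullet> v = y \<bullet> v" using strict[rule_format, of x y] by simp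
  qed auto
  moreover have "emeasure lborel ?S < \<infinity>"
    by (rule le_less_trans[OF emeasure_mono D_emeasure]) auto
  ultimately have "?S \<in> null_sets lborel"
    by (auto simp: null_sets_def emeasure_eq_ennreal_measure)
  then have "AE x in lborel. x \<notin> ?S" by (rule AE_not_in)
  then show ae: "AE x in lborel. f x = F x"
    using P[unfolded patch_def, THEN conjunct2, THEN conjunct1] P[unfolded patch_def, THEN conjunct2, THEN conjunct2, THEN conjunct1]
  proof eventually_elim
    case (elim x)
    then show ?case
      using dens_off[OF f(1), of x] by (cases "x \<in> D"; cases "V f x - V g x" \<mu> rule: linorder_cases) (auto simp: F_def)
  qed
  have "(LINT x|lborel. F x) = (LINT x|lborel. f x)"
    by (rule integral_cong_AE) (use ae in \<open>auto elim: eventually_mono\<close>)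
  then show "dens l a F"
    using dens_level_nonneg[OF f(1)] Fm unfolding dens_def by (auto simp: F_def indicator_def dens_integral[OF f(1)])
  show "fol v F"
  proof (rule fol_monotone)
    fix x y :: pt assume n: "norm x = norm y" "y \<bullet> v \<le> x \<bullet> v"
    show "F y \<le> F x"
    proof (cases "x \<in> D")
      case True
      then show ?thesis using psi_mono(1)[OF A True n] dens_level_nonneg[OF f(1)] by (auto simp: F_def indicator_def)
    next
      case False
      then have "y \<notin> D" using n by (simp add: D_iff)
      then show ?thesis using False by (simp add: F_def)
    qed
  qed
qed

lemma steady_exists:
  assumes a: "0 < a" and b: "0 < b"
  obtains R c s :: real where "0 < R" "0 < c" "0 < s"
    "eventually (\<lambda>l. \<forall>v. norm v = 1 \<longrightarrow> (\<exists>F G \<mu> \<nu>. steady v l a b c (R / sqrt l) s F G \<mu> \<nu>)) at_top"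
proof -
  obtain R c K where R: "0 < R" "0 < c"
    and ev: "eventually (\<lambda>l. \<forall>v f g. norm v = 1 \<longrightarrow> is_max v l a b f g \<longrightarrow>
       (\<exists>\<mu> \<nu>. patch l c K (R / sqrt l) f g \<mu> \<and> patch l c K (R / sqrt l) g f \<nu>)) at_top"
    by (rule concentration_pair[OF a b])
  \<comment> \<open>\<open>s\<close> is at most the distance provided by
    \<open>patch_separation\<close>, and \<open>R / sqrt l < s / 2\<close> below supplies the
    quarter that \<open>psi_strict\<close> asks for.\<close>
  define s where "s = min (c * exp (- K / a)) (c * exp (- K / b)) / 2"
  have s: "0 < s" using R by (simp add: s_def)
  have small: "eventually (\<lambda>l. R / sqrt l < s / 2) at_top"
    using eventually_gt_at_top[of "(2 * R / s)\<^sup>2"]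
  proof eventually_elim
    case (elim l)
    then have "sqrt ((2 * R / s)\<^sup>2) < sqrt l" by (rule real_sqrt_less_mono)
    then have "2 * R / s < sqrt l" using R s by simp
    moreover from this have "0 < sqrt l" using R s by (meson divide_pos_pos less_trans mult_pos_pos zero_less_numeral)
    ultimately show ?case using s by (simp add: field_simps)
  qed
  have "eventually (\<lambda>l. \<forall>v. norm v = 1 \<longrightarrow> (\<exists>F G \<mu> \<nu>. steady v l a b c (R / sqrt l) s F G \<mu> \<nu>)) at_top"
    using ev small max_exists[OF a b] eventually_gt_at_top[of 0]
  proof eventually_elim
    case (elim l)
    show ?case
    proof (intro allI impI)
      fix v :: pt assume v: "norm v = 1"
      have v': "norm (- v) = 1" using v by simp
      let ?d = "R / sqrt l"
      have d: "0 < ?d" using R elim(4) by simp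
      obtain f g where mx: "is_max v l a b f g" using elim(3) v by blast
      obtain \<mu> \<nu> where P: "patch l c K ?d f g \<mu>" and Q: "patch l c K ?d g f \<nu>" using elim(1) v mx by blast
      have A: "Adm v l a b f g" using mx by (simp add: is_max_def)
      note A' = Adm_swap[OF A]
      have f: "dens l a f" and g: "dens l b g" using A by (auto simp: Adm_def)
      have db: "?d < c * exp (- K / b) / 4" using elim(2) by (simp add: s_def min_def split: if_splits)
      have strict0: "x \<bullet> v = y \<bullet> v" if "x \<in> D" "norm x = norm y" "V f x - V g x = V f y - V g y" for x y
        by (rule psi_strict[OF A v a b P Q R(2) db d that])
      have strict: "\<forall>x y. x \<in> D \<longrightarrow> norm x = norm y \<longrightarrow> V f x - V g x = V f y - V g y \<longrightarrow> x \<bullet> v = y \<bullet> v"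
        using strict0 by blast
      have strict': "\<forall>x y. x \<in> D \<longrightarrow> norm x = norm y \<longrightarrow> V g x - V f x = V g y - V f y \<longrightarrow> x \<bullet> (- v) = y \<bullet> (- v)"
      proof (intro allI impI)
        fix x y assume "x \<in> D" "norm x = norm y" "V g x - V f x = V g y - V f y"
        then show "x \<bullet> (- v) = y \<bullet> (- v)" using strict0[of x y] by simp
      qed
      define F where "F = (\<lambda>x. l * indicator {x \<in> D. \<mu> < V f x - V g x} x)"
      define G where "G = (\<lambda>x. l * indicator {x \<in> D. \<nu> < V g x - V f x} x)"
      have F: "AE x in lborel. f x = F x" "dens l a F" "fol v F"
        unfolding F_def using patch_exact[OF A v P strict] by simp_all
      have G: "AE x in lborel. g x = G x" "dens l b G" "fol (- v) G"
        unfolding G_def using patch_exact[OF A' v' Q strict'] by simp_all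
      have VF: "V F = V f" using V_cong_AE[OF dens_measurable[OF f] dens_measurable[OF F(2)] F(1)] by simp
      have VG: "V G = V g" using V_cong_AE[OF dens_measurable[OF g] dens_measurable[OF G(2)] G(1)] by simp
      have Fs: "x \<in> D \<and> \<mu> \<le> V f x - V g x" if "F x \<noteq> 0" for x using that by (auto simp: F_def indicator_def split: if_splits)
      have Gs: "x \<in> D \<and> \<nu> \<le> V g x - V f x" if "G x \<noteq> 0" for x using that by (auto simp: G_def indicator_def split: if_splits)
      have "steady v l a b c ?d s F G \<mu> \<nu>"
        unfolding steady_def
      proof (intro conjI allI impI)
        show "0 < \<mu>" "0 < \<nu>" using P Q by (auto simp: patch_def)
        show "F = (\<lambda>x. l * indicator {x \<in> D. \<mu> < V F x - V G x} x)" unfolding VF VG by (rule F_def)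
        show "G = (\<lambda>x. l * indicator {x \<in> D. \<nu> < V G x - V F x} x)" unfolding VF VG by (rule G_def)
        show "c \<le> 1 - norm x ^ 2" if "F x \<noteq> 0" for x using P Fs[OF that] by (auto simp: patch_def)
        show "c \<le> 1 - norm x ^ 2" if "G x \<noteq> 0" for x using Q Gs[OF that] by (auto simp: patch_def)
        show "norm (x - y) \<le> ?d" if "F x \<noteq> 0" "F y \<noteq> 0" for x y using P Fs[OF that(1)] Fs[OF that(2)] by (auto simp: patch_def)
        show "norm (x - y) \<le> ?d" if "G x \<noteq> 0" "G y \<noteq> 0" for x y using Q Gs[OF that(1)] Gs[OF that(2)] by (auto simp: patch_def)
        show "s \<le> norm (x - y)" if "F x \<noteq> 0" "G y \<noteq> 0" for x y
        proof -
          have "c * exp (- K / b) / 2 \<le> norm (x - y)"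
          proof (rule patch_separation[OF g b P Q R(2)])
            show "?d \<le> c * exp (- K / b) / 2" using db d by linarith
          qed (use Fs[OF that(1)] Gs[OF that(2)] in auto)
          moreover have "s \<le> c * exp (- K / b) / 2" by (simp add: s_def)
          ultimately show ?thesis by linarith
        qed
      qed (fact F G)+
      then show "\<exists>F G \<mu> \<nu>. steady v l a b c ?d s F G \<mu> \<nu>" by blast
    qed
  qed
  then show ?thesis using R s by (intro that[of R c s]) auto
qed

section \<open>Translating a patch\<close>

lemma dens_translate:
  assumes f: "dens l a f" and h: "\<And>x. f x \<noteq> 0 \<Longrightarrow> x + h \<in> D"
  shows "dens l a (\<lambda>x. f (x - h))"
proof -
  note [measurable] = dens_measurable[OF f]
  have "(LINT x|lborel. f (x - h)) = a"
    using integral_translate[of f "- h"] dens_integral[OF f] by simp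
  moreover have "f (x - h) = 0" if "x \<notin> D" for x
    using h[of "x - h"] that by auto
  ultimately show ?thesis
    unfolding dens_def using dens_nonneg[OF f] dens_le[OF f] by simp
qed

text \<open>A translate of \<open>F\<close> has the same mass and values in \<open>[0, l]\<close>,
  and \<open>F\<close> equals \<open>l\<close> above the level and 0 elsewhere in \<open>D\<close>.
  The comparison is therefore pointwise, and \<open>h\<close> may have any direction although the
  translate need not be symmetric.\<close>

lemma bathtub_shift:
  assumes S: "steady v l a b c \<delta> s F G \<mu> \<nu>" and h: "\<And>x. F x \<noteq> 0 \<Longrightarrow> x + h \<in> D"
  shows "(LINT x|lborel. (V F (x + h) - V G (x + h)) * F x) \<le> (LINT x|lborel. (V F x - V G x) * F x)"
    and "integrable lborel (\<lambda>x. (V F (x + h) - V G (x + h)) * F x)"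
proof -
  have F: "dens l a F" and G: "dens l b G" and Fe: "F = (\<lambda>x. l * indicator {x \<in> D. \<mu> < V F x - V G x} x)"
    using S by (auto simp: steady_def)
  have m[measurable]: "(\<lambda>x. V F x - V G x) \<in> borel_measurable borel" by (rule psi_measurable[OF F G])
  note [measurable] = dens_measurable[OF F]
  let ?F' = "\<lambda>x. F (x - h)"
  have F': "dens l a ?F'" by (rule dens_translate[OF F h])
  have i: "integrable lborel (\<lambda>x. (V F x - V G x) * F x)" "integrable lborel (\<lambda>x. (V F x - V G x) * ?F' x)"
    by (rule dens_bounded_integrable[OF F m psi_abs[OF F G]], assumption)
       (rule dens_bounded_integrable[OF F' m psi_abs[OF F G]], assumption)
  have "0 \<le> (LINT x|lborel. ((V F x - V G x) * F x - (V F x - V G x) * ?F' x) - (\<mu> * F x - \<mu> * ?F' x))"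
  proof (rule Bochner_Integration.integral_nonneg)
    fix x
    have "0 \<le> (V F x - V G x - \<mu>) * (F x - ?F' x)"
    proof (cases "x \<in> D")
      case True
      show ?thesis
      proof (cases "\<mu> < V F x - V G x")
        case 1: True
        then have "F x = l" using True by (subst Fe) simp
        then show ?thesis using 1 dens_le[OF F'] by simp
      next
        case False
        then have "F x = 0" using True by (subst Fe) simp
        then show ?thesis using False dens_nonneg[OF F', of x] by (auto intro: mult_nonpos_nonneg)
      qed
    qed (simp add: dens_off[OF F] dens_off[OF F'])
    then show "0 \<le> ((V F x - V G x) * F x - (V F x - V G x) * ?F' x) - (\<mu> * F x - \<mu> * ?F' x)"
      by (simp add: algebra_simps)
  qed
  also have "\<dots> = (LINT x|lborel. (V F x - V G x) * F x) - (LINT x|lborel. (V F x - V G x) * ?F' x)"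
    using i dens_integrable[OF F] dens_integrable[OF F'] by (simp add: dens_integral[OF F] dens_integral[OF F'])
  also have "(LINT x|lborel. (V F x - V G x) * ?F' x) = (LINT x|lborel. (V F (h + x) - V G (h + x)) * ?F' (h + x))"
    by (rule integral_translate[symmetric]) measurable
  finally show "(LINT x|lborel. (V F (x + h) - V G (x + h)) * F x) \<le> (LINT x|lborel. (V F x - V G x) * F x)"
    by (simp add: add.commute[of h])
  show "integrable lborel (\<lambda>x. (V F (x + h) - V G (x + h)) * F x)"
    using integrable_translate[OF i(2), of h] by (simp add: add.commute[of h])
qed

lemma ln_one_plus_square_le:
  assumes "0 < (u::real)"
  shows "ln (1 + u\<^sup>2) \<le> 2 * u powr (3/2)"
proof (cases "u \<le> 1")
  case True
  have "ln (1 + u\<^sup>2) \<le> u\<^sup>2" by (rule ln_add_one_self_le_self) simp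
  also have "u\<^sup>2 = u powr 2" using assms by simp
  also have "\<dots> \<le> u powr (3/2)" by (rule powr_mono') (use assms True in auto)
  also have "\<dots> \<le> 2 * u powr (3/2)" by simp
  finally show ?thesis .
next
  case False
  have "1 + u\<^sup>2 \<le> (1 + u)\<^sup>2" using assms by (simp add: power2_sum)
  moreover have "0 < 1 + u\<^sup>2" by (rule add_pos_nonneg) simp_all
  ultimately have "ln (1 + u\<^sup>2) \<le> ln ((1 + u)\<^sup>2)" by (rule ln_mono)
  also have "\<dots> = 2 * ln (1 + u)" using assms by (simp add: ln_realpow)
  also have "\<dots> \<le> 2 * u" using assms ln_add_one_self_le_self[of u] by simp
  also have "\<dots> \<le> 2 * u powr (3/2)" using powr_mono[of 1 "3/2" u] False by simp
  finally show ?thesis .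
qed

text \<open>By the parallelogram law and the inequality of the means,
  \<open>norm (z + h) * norm (z - h) \<le> norm z ^ 2 + norm h ^ 2\<close>. The cut-off 2 covers
  differences of points of \<open>D\<close>.\<close>

lemma ell_second_difference:
  assumes z: "z \<noteq> 0" "z + h \<noteq> 0" "z - h \<noteq> 0" and n: "norm z < 2" and h: "h \<noteq> 0"
  shows "- (2 * norm h powr (3/2) * ker 2 z) \<le> ell (z + h) + ell (z - h) - 2 * ell z"
proof -
  let ?u = "norm h / norm z"
  have "0 \<le> (norm (z + h) - norm (z - h))\<^sup>2" by simp
  then have "2 * (norm (z + h) * norm (z - h)) \<le> norm (z + h) ^ 2 + norm (z - h) ^ 2" by (simp add: power2_diff)
  also have "\<dots> = 2 * (norm z ^ 2 + norm h ^ 2)"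
    by (simp add: power2_norm_eq_inner inner_simps inner_commute)
  also have "norm z ^ 2 + norm h ^ 2 = norm z ^ 2 * (1 + ?u\<^sup>2)" using z by (simp add: power_divide distrib_left)
  finally have "norm (z + h) * norm (z - h) \<le> norm z ^ 2 * (1 + ?u\<^sup>2)" by linarith
  moreover have pos: "0 < norm (z + h)" "0 < norm (z - h)" "0 < norm z" using z by simp_all
  ultimately have "ln (norm (z + h) * norm (z - h)) \<le> ln (norm z ^ 2 * (1 + ?u\<^sup>2))"
    by (intro ln_mono mult_pos_pos)
  also have "\<dots> = ln (norm z ^ 2) + ln (1 + ?u\<^sup>2)"
  proof (rule ln_mult_pos)
    show "0 < norm z ^ 2" using pos by simp
    show "0 < 1 + ?u\<^sup>2" by (rule add_pos_nonneg) simp_all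
  qed
  also have "\<dots> = 2 * ln (norm z) + ln (1 + ?u\<^sup>2)" using pos by (simp add: ln_realpow)
  also have "\<dots> \<le> 2 * ln (norm z) + 2 * ?u powr (3/2)"
    by (rule add_left_mono, rule ln_one_plus_square_le) (use pos h in simp)
  finally have "ln (norm (z + h) * norm (z - h)) \<le> 2 * ln (norm z) + 2 * ?u powr (3/2)" .
  moreover have "?u powr (3/2) = norm h powr (3/2) * ker 2 z"
    using z n by (simp add: ker_def powr_divide powr_minus_divide)
  moreover have "ln (norm (z + h) * norm (z - h)) = ln (norm (z + h)) + ln (norm (z - h))"
    by (rule ln_mult_pos[OF pos(1,2)])
  ultimately show ?thesis by (simp add: ell_def)
qed

text \<open>The self-interaction of \<open>F\<close> with its translate is even in \<open>h\<close>,
  so the first difference is half of a symmetric second difference and has no linear term. The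
  constant comes from \<open>64 * 2 * sqrt 2 \<le> 200\<close>, halved.\<close>

lemma self_shift:
  assumes F: "dens l a F" and h: "\<And>x. F x \<noteq> 0 \<Longrightarrow> x + h \<in> D" "\<And>x. F x \<noteq> 0 \<Longrightarrow> x - h \<in> D" and h0: "h \<noteq> 0"
  defines "P \<equiv> \<lambda>x. LINT y|lborel. ell (x - y) * F y"
  shows "- (100 * a * l * norm h powr (3/2)) \<le> (LINT x|lborel. (P (x + h) - P x) * F x)"
    and "integrable lborel (\<lambda>x. (P (x + h) - P x) * F x)"
proof -
  note [measurable] = dens_measurable[OF F]
  have h': "F x \<noteq> 0 \<Longrightarrow> x + - h \<in> D" for x using h(2) by simp
  note F1 = dens_translate[OF F h(1)] and F2 = dens_translate[OF F h', simplified]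
  have km: "(\<lambda>p. ell (fst p - snd p)) \<in> borel_measurable (borel \<Otimes>\<^sub>M borel)" by measurable
  have kb: "\<bar>ell (x - y)\<bar> \<le> 1 + 1 * ker 1 (x - y)" if "x \<in> D" "y \<in> D" for x y
    using ell_abs_le[OF D_dist[OF that]] by simp
  note Fub = Fubini_dens[OF _ _ km kb zero_less_one zero_le_one]
  have Pm[measurable]: "P \<in> borel_measurable borel"
  proof -
    have "(\<lambda>x. LINT y|lborel. ell (fst (x, y) - snd (x, y)) * F y) \<in> borel_measurable borel"
      by measurable
    then show ?thesis by (simp add: P_def)
  qed
  have i0: "integrable lborel (\<lambda>x. P x * F x)" using Fub(2)[OF F F] by (simp add: P_def)
  have i1: "integrable lborel (\<lambda>x. P (x + h) * F x)"
    using integrable_translate[OF Fub(2)[OF F F1], of h] by (simp add: P_def add.commute[of h])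
  have i2: "integrable lborel (\<lambda>x. P (x - h) * F x)"
    using integrable_translate[OF Fub(2)[OF F F2], of "- h"] by (simp add: P_def add.commute[of "- h"])
  \<comment> \<open>Translation, exchange of the integrals and the evenness of \<open>ell\<close>
    turn the shift by \<open>- h\<close> into the shift by \<open>h\<close>.\<close>
  have eq2: "(LINT x|lborel. P (x - h) * F x) = (LINT x|lborel. P (x + h) * F x)"
  proof -
    have "(LINT x|lborel. P (x - h) * F x) = (LINT x|lborel. P x * F (x + h))"
      using integral_translate[of "\<lambda>x. P x * F (x + h)" "- h"] by (simp add: add.commute[of "- h"])
    also have "\<dots> = (LINT x|lborel. (LINT y|lborel. ell (y - x) * F (y + h)) * F x)"
      using Fub(1)[OF F F2] by (simp add: P_def)
    also have "\<dots> = (LINT x|lborel. P (x + h) * F x)"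
    proof (rule Bochner_Integration.integral_cong[OF refl])
      fix x
      have "(LINT y|lborel. ell (y - x) * F (y + h)) = (LINT y|lborel. ell (x + h - (h + y)) * F (h + y))"
        by (rule Bochner_Integration.integral_cong) (simp_all add: ell_def norm_minus_commute add.commute)
      also have "\<dots> = P (x + h)"
        unfolding P_def by (rule integral_translate[of "\<lambda>y. ell (x + h - y) * F y"]) measurable
      finally show "(LINT y|lborel. ell (y - x) * F (y + h)) * F x = P (x + h) * F x" by simp
    qed
    finally show ?thesis .
  qed
  let ?N = "norm h powr (3/2)"
  have pt: "- (200 * l * ?N) * F x \<le> (P (x + h) + P (x - h) - 2 * P x) * F x" for x
  proof (cases "F x = 0")
    case False
    then have x: "x \<in> D" using dens_off[OF F, of x] by auto
    note e = dens_ell_integrable[OF F]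
    have "- (LINT y|lborel. (2 * ?N * ker 2 (x - y)) * F y) \<le> (LINT y|lborel. (ell (x + h - y) + ell (x - h - y) - 2 * ell (x - y)) * F y)"
      unfolding Bochner_Integration.integral_minus[symmetric]
    proof (rule integral_mono_AE)
      have "integrable lborel (\<lambda>y. (2 * ?N * ker 2 (x - y)) * F y)"
        by (rule dens_kernel_integrable[OF F, where ?C0.0=0 and ?C1.0="2 * ?N" and R=2 and x=x]) auto
      then show "integrable lborel (\<lambda>y. - ((2 * ?N * ker 2 (x - y)) * F y))" by simp
      show "integrable lborel (\<lambda>y. (ell (x + h - y) + ell (x - h - y) - 2 * ell (x - y)) * F y)"
        using e[OF x] e[OF h(1)[OF False]] e[OF h(2)[OF False]] by (simp add: distrib_right left_diff_distrib mult.assoc)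
      show "AE y in lborel. - ((2 * ?N * ker 2 (x - y)) * F y) \<le> (ell (x + h - y) + ell (x - h - y) - 2 * ell (x - y)) * F y"
        using AE_lborel_singleton[of x] AE_lborel_singleton[of "x + h"] AE_lborel_singleton[of "x - h"]
      proof eventually_elim
        case (elim y)
        show ?case
        proof (cases "F y = 0")
          case Fy: False
          then have y: "y \<in> D" using dens_off[OF F, of y] by auto
          have e: "x - y + h = x + h - y" "x - y - h = x - h - y" by (simp_all add: algebra_simps)
          have ne: "x - y \<noteq> 0" "x - y + h \<noteq> 0" "x - y - h \<noteq> 0" unfolding e using elim by auto
          have "- (2 * ?N * ker 2 (x - y)) \<le> ell (x + h - y) + ell (x - h - y) - 2 * ell (x - y)"
            using ell_second_difference[OF ne D_dist[OF x y] h0] unfolding e .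
          from mult_right_mono[OF this dens_nonneg[OF F, of y]] show ?thesis by simp
        qed simp
      qed
    qed
    also have "\<dots> = P (x + h) + P (x - h) - 2 * P x"
      using e[OF x] e[OF h(1)[OF False]] e[OF h(2)[OF False]] by (simp add: P_def distrib_right left_diff_distrib mult.assoc)
    finally have 1: "- (LINT y|lborel. (2 * ?N * ker 2 (x - y)) * F y) \<le> P (x + h) + P (x - h) - 2 * P x" .
    have "(LINT y|lborel. (2 * ?N * ker 2 (x - y)) * F y) \<le> 0 * a + 64 * (2 * ?N) * sqrt 2 * l"
      by (rule dens_kernel_le[OF F dens_kernel_integrable[OF F, where ?C0.0=0 and ?C1.0="2 * ?N" and R=2 and x=x], where x=x and R=2]) auto
    also have "\<dots> = (128 * sqrt 2) * (l * ?N)" by simp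
    also have "\<dots> \<le> 200 * (l * ?N)"
    proof (rule mult_right_mono)
      have "sqrt 2 \<le> sqrt ((3/2)\<^sup>2)" by (rule real_sqrt_le_mono) (simp add: power2_eq_square)
      then show "128 * sqrt 2 \<le> 200" by simp
    qed (use dens_level_nonneg[OF F] in simp)
    finally have "- (200 * l * ?N) \<le> P (x + h) + P (x - h) - 2 * P x" using 1 by simp
    then show ?thesis by (rule mult_right_mono[OF _ dens_nonneg[OF F]])
  qed simp
  have "(LINT x|lborel. - (200 * l * ?N) * F x) \<le> (LINT x|lborel. (P (x + h) + P (x - h) - 2 * P x) * F x)"
    by (rule integral_mono[OF _ _ pt])
       (use dens_integrable[OF F] i0 i1 i2 in \<open>simp_all add: distrib_right left_diff_distrib mult.assoc\<close>)
  also have "\<dots> = 2 * (LINT x|lborel. (P (x + h) - P x) * F x)"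
    using i0 i1 i2 eq2 by (simp add: distrib_right left_diff_distrib mult.assoc)
  finally have "(LINT x|lborel. - (200 * l * ?N) * F x) \<le> 2 * (LINT x|lborel. (P (x + h) - P x) * F x)" .
  moreover have "(LINT x|lborel. - (200 * l * ?N) * F x) = - (200 * l * ?N) * a"
    by (simp only: integral_mult_right_zero dens_integral[OF F])
  moreover have "- (200 * l * ?N) * a = 2 * - (100 * a * l * ?N)" by simp
  ultimately show "- (100 * a * l * ?N) \<le> (LINT x|lborel. (P (x + h) - P x) * F x)" by linarith
  show "integrable lborel (\<lambda>x. (P (x + h) - P x) * F x)"
    using i0 i1 by (simp add: left_diff_distrib)
qed

text \<open>The stream function does not gain on average under translation of \<open>F\<close>. Its
  increment splits into the singular self-part, negligible by \<open>self_shift\<close>, the regular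
  self-part, at least \<open>a * \<alpha>\<close>, and the interaction with \<open>G\<close>, at
  most \<open>b * \<beta>\<close>.\<close>

lemma shift_inequality:
  assumes S: "steady v l a b c \<delta> s F G \<mu> \<nu>" and a: "0 < a"
    and h: "\<And>x. F x \<noteq> 0 \<Longrightarrow> x + h \<in> D" "\<And>x. F x \<noteq> 0 \<Longrightarrow> x - h \<in> D" and h0: "h \<noteq> 0"
    and n: "\<And>x y. F x \<noteq> 0 \<Longrightarrow> F y \<noteq> 0 \<Longrightarrow> \<alpha> \<le> ln (num (x + h) y) / 2 - ln (num x y) / 2"
    and k: "\<And>x y. F x \<noteq> 0 \<Longrightarrow> G y \<noteq> 0 \<Longrightarrow>
      (ln (num (x + h) y) / 2 + ell (x + h - y)) - (ln (num x y) / 2 + ell (x - y)) \<le> \<beta>"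
  shows "a * \<alpha> - b * \<beta> \<le> 100 * l * norm h powr (3/2)"
proof -
  have F: "dens l a F" and G: "dens l b G" using S by (auto simp: steady_def)
  define P where "P x = (LINT y|lborel. ell (x - y) * F y)" for x
  note self = self_shift[OF F h h0, folded P_def]
  have pt: "(a * \<alpha> - b * \<beta> + (P (x + h) - P x)) * F x \<le> 2 * pi * ((V F (x + h) - V G (x + h)) * F x - (V F x - V G x) * F x)" for x
  proof (cases "F x = 0")
    case False
    then have x: "x \<in> D" using dens_off[OF F, of x] by auto
    note xh = h(1)[OF False]
    note iF = V_ell(2)[OF F x] V_ell(2)[OF F xh] dens_integrable[OF F]
    note iG = V_ell(2)[OF G x] V_ell(2)[OF G xh] dens_integrable[OF G] dens_ell_integrable[OF G x] dens_ell_integrable[OF G xh]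
    have "(LINT y|lborel. \<alpha> * F y) \<le> (LINT y|lborel. (ln (num (x + h) y) / 2 - ln (num x y) / 2) * F y)"
    proof (rule integral_mono)
      fix y show "\<alpha> * F y \<le> (ln (num (x + h) y) / 2 - ln (num x y) / 2) * F y"
        using n[OF False, of y] dens_nonneg[OF F, of y] by (cases "F y = 0") (auto intro: mult_right_mono)
    qed (use iF in \<open>simp_all add: left_diff_distrib\<close>)
    then have 1: "\<alpha> * a \<le> (LINT y|lborel. ln (num (x + h) y) * F y) / 2 - (LINT y|lborel. ln (num x y) * F y) / 2"
      using iF by (simp add: left_diff_distrib dens_integral[OF F])
    have "(LINT y|lborel. ((ln (num (x + h) y) / 2 + ell (x + h - y)) - (ln (num x y) / 2 + ell (x - y))) * G y) \<le> (LINT y|lborel. \<beta> * G y)"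
    proof (rule integral_mono)
      fix y show "((ln (num (x + h) y) / 2 + ell (x + h - y)) - (ln (num x y) / 2 + ell (x - y))) * G y \<le> \<beta> * G y"
        using k[OF False, of y] dens_nonneg[OF G, of y] by (cases "G y = 0") (auto intro: mult_right_mono)
    qed (use iG in \<open>simp_all add: left_diff_distrib distrib_right\<close>)
    then have 2: "2 * pi * V G (x + h) - 2 * pi * V G x \<le> \<beta> * b"
      unfolding V_ell(1)[OF G x] V_ell(1)[OF G xh]
      using iG by (simp add: left_diff_distrib distrib_right dens_integral[OF G])
    have 3: "\<alpha> * a + (P (x + h) - P x) \<le> 2 * pi * V F (x + h) - 2 * pi * V F x"
      unfolding V_ell(1)[OF F x] V_ell(1)[OF F xh] P_def using 1 by simp
    have "a * \<alpha> - b * \<beta> + (P (x + h) - P x) \<le> 2 * pi * ((V F (x + h) - V G (x + h)) - (V F x - V G x))"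
      using 2 3 by (simp add: algebra_simps)
    from mult_right_mono[OF this dens_nonneg[OF F, of x]] show ?thesis by (simp add: algebra_simps)
  qed simp
  have m: "(\<lambda>x. V F x - V G x) \<in> borel_measurable borel" by (rule psi_measurable[OF F G])
  have i: "integrable lborel (\<lambda>x. (V F x - V G x) * F x)"
    by (rule dens_bounded_integrable[OF F m psi_abs[OF F G]])
  note i' = bathtub_shift(2)[OF S h(1)]
  have "(LINT x|lborel. (a * \<alpha> - b * \<beta> + (P (x + h) - P x)) * F x) \<le> (LINT x|lborel. 2 * pi * ((V F (x + h) - V G (x + h)) * F x - (V F x - V G x) * F x))"
  proof (rule integral_mono[OF _ _ pt])
    show "integrable lborel (\<lambda>x. (a * \<alpha> - b * \<beta> + (P (x + h) - P x)) * F x)"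
      using dens_integrable[OF F] self(2) by (subst distrib_right) simp
  qed (use i i' in simp)
  also have "\<dots> \<le> 0" using bathtub_shift(1)[OF S h(1)] i i' by (simp add: mult_le_0_iff)
  also have "(LINT x|lborel. (a * \<alpha> - b * \<beta> + (P (x + h) - P x)) * F x) = (a * \<alpha> - b * \<beta>) * a + (LINT x|lborel. (P (x + h) - P x) * F x)"
    using dens_integrable[OF F] self(2) by (subst distrib_right) (simp add: dens_integral[OF F])
  finally have "(a * \<alpha> - b * \<beta>) * a \<le> (100 * l * norm h powr (3/2)) * a" using self(1) by (simp add: mult_ac)
  then show ?thesis using a by simp
qed

text \<open>Derivative in \<open>x\<close> along a unit vector \<open>w\<close> of
  \<open>ln (num x y) / 2\<close>, the regular part of \<open>2 * pi * Green\<close>.\<close>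

definition dn :: "pt \<Rightarrow> pt \<Rightarrow> pt \<Rightarrow> real" where
  "dn w x y = ((x \<bullet> w) * norm y ^ 2 - y \<bullet> w) / num x y"

text \<open>The same derivative for the full \<open>2 * pi * Green\<close>, used only for points of
  different vortices.\<close>

definition dk :: "pt \<Rightarrow> pt \<Rightarrow> pt \<Rightarrow> real" where
  "dk w x y = dn w x y - ((x - y) \<bullet> w) / norm (x - y) ^ 2"

lemma num_shift_deriv:
  assumes w: "norm w = 1" and p: "0 < num (x + t *\<^sub>R w) y"
  shows "((\<lambda>t. ln (num (x + t *\<^sub>R w) y) / 2) has_real_derivative dn w (x + t *\<^sub>R w) y) (at t)"
proof -
  have e: "num (x + t *\<^sub>R w) y = (x \<bullet> x + 2 * t * (x \<bullet> w) + t\<^sup>2) * (y \<bullet> y) - 2 * (x \<bullet> y) - 2 * t * (w \<bullet> y) + 1" for t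
    unfolding num_def power2_norm_eq_inner using w by (simp add: inner_simps inner_commute algebra_simps power2_eq_square)
  have "((\<lambda>t. ln ((x \<bullet> x + 2 * t * (x \<bullet> w) + t\<^sup>2) * (y \<bullet> y) - 2 * (x \<bullet> y) - 2 * t * (w \<bullet> y) + 1) / 2)
    has_real_derivative ((2 * (x \<bullet> w) + 2 * t) * (y \<bullet> y) - 2 * (w \<bullet> y)) / num (x + t *\<^sub>R w) y / 2) (at t)"
    using p unfolding e by (auto intro!: derivative_eq_intros simp: field_simps)
  moreover have "((2 * (x \<bullet> w) + 2 * t) * (y \<bullet> y) - 2 * (w \<bullet> y)) / num (x + t *\<^sub>R w) y / 2 = dn w (x + t *\<^sub>R w) y"
    using w p by (simp add: dn_def power2_norm_eq_inner inner_simps inner_commute[of y w] field_simps)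
  ultimately show ?thesis unfolding e by simp
qed

lemma ell_shift_deriv:
  assumes w: "norm w = 1" and p: "x + t *\<^sub>R w \<noteq> y"
  shows "((\<lambda>t. ell (x + t *\<^sub>R w - y)) has_real_derivative - ((x + t *\<^sub>R w - y) \<bullet> w) / norm (x + t *\<^sub>R w - y) ^ 2) (at t)"
proof -
  let ?z = "x - y"
  have e: "norm (x + t *\<^sub>R w - y) ^ 2 = ?z \<bullet> ?z + 2 * t * (?z \<bullet> w) + t\<^sup>2" for t
    unfolding power2_norm_eq_inner using w by (simp add: inner_simps inner_commute algebra_simps power2_eq_square)
  have l: "ell (x + t *\<^sub>R w - y) = - ln (?z \<bullet> ?z + 2 * t * (?z \<bullet> w) + t\<^sup>2) / 2" for t
    unfolding e[symmetric] ell_def by (cases "norm (x + t *\<^sub>R w - y) = 0") (simp_all add: ln_realpow)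
  have "0 < norm (x + t *\<^sub>R w - y) ^ 2" using p by simp
  then have p': "0 < ?z \<bullet> ?z + 2 * t * (?z \<bullet> w) + t\<^sup>2" unfolding e .
  have "((\<lambda>t. - ln (?z \<bullet> ?z + 2 * t * (?z \<bullet> w) + t\<^sup>2) / 2) has_real_derivative
     - ((2 * (?z \<bullet> w) + 2 * t) / (?z \<bullet> ?z + 2 * t * (?z \<bullet> w) + t\<^sup>2)) / 2) (at t)"
  proof -
    have "((\<lambda>t. ?z \<bullet> ?z + 2 * t * (?z \<bullet> w) + t\<^sup>2) has_real_derivative (2 * (?z \<bullet> w) + 2 * t)) (at t)"
      by (auto intro!: derivative_eq_intros)
    from DERIV_cdivide[OF DERIV_minus[OF DERIV_chain2[OF DERIV_ln_divide[OF p'] this]], of 2]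
    show ?thesis by simp
  qed
  moreover have "- ((2 * (?z \<bullet> w) + 2 * t) / (?z \<bullet> ?z + 2 * t * (?z \<bullet> w) + t\<^sup>2)) / 2 = - ((x + t *\<^sub>R w - y) \<bullet> w) / norm (x + t *\<^sub>R w - y) ^ 2"
  proof -
    have n: "2 * (?z \<bullet> w) + 2 * t = 2 * ((x + t *\<^sub>R w - y) \<bullet> w)" using w by (simp add: inner_simps)
    have "- ((2 * A) / B) / 2 = - A / B" for A B :: real by simp
    then show ?thesis unfolding e n .
  qed
  ultimately show ?thesis unfolding l by simp
qed

section \<open>Asymptotic location\<close>

lemma n_shift_ge:
  assumes w: "norm w = 1" and t: "0 < t"
    and A: "\<And>\<xi>. 0 \<le> \<xi> \<Longrightarrow> \<xi> \<le> t \<Longrightarrow> 0 < num (x + \<xi> *\<^sub>R w) y \<and> A \<le> dn w (x + \<xi> *\<^sub>R w) y"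
  shows "t * A \<le> ln (num (x + t *\<^sub>R w) y) / 2 - ln (num x y) / 2"
proof -
  have "\<exists>z. 0 < z \<and> z < t \<and> ln (num (x + t *\<^sub>R w) y) / 2 - ln (num (x + 0 *\<^sub>R w) y) / 2 = (t - 0) * dn w (x + z *\<^sub>R w) y"
    by (rule MVT2[OF t]) (use num_shift_deriv[OF w] A in blast)
  then obtain z where z: "0 < z" "z < t" "ln (num (x + t *\<^sub>R w) y) / 2 - ln (num x y) / 2 = t * dn w (x + z *\<^sub>R w) y"
    by auto
  have "A \<le> dn w (x + z *\<^sub>R w) y" using A[of z] z by simp
  then show ?thesis using z(3) t by simp
qed

lemma k_shift_le:
  assumes w: "norm w = 1" and t: "0 < t"
    and B: "\<And>\<xi>. 0 \<le> \<xi> \<Longrightarrow> \<xi> \<le> t \<Longrightarrow> 0 < num (x + \<xi> *\<^sub>R w) y \<and> x + \<xi> *\<^sub>R w \<noteq> y \<and> dk w (x + \<xi> *\<^sub>R w) y \<le> B"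
  shows "(ln (num (x + t *\<^sub>R w) y) / 2 + ell (x + t *\<^sub>R w - y)) - (ln (num x y) / 2 + ell (x - y)) \<le> t * B"
proof -
  let ?k = "\<lambda>t. ln (num (x + t *\<^sub>R w) y) / 2 + ell (x + t *\<^sub>R w - y)"
  have d: "(?k has_real_derivative dk w (x + \<xi> *\<^sub>R w) y) (at \<xi>)" if "0 \<le> \<xi>" "\<xi> \<le> t" for \<xi>
  proof -
    have "0 < num (x + \<xi> *\<^sub>R w) y" "x + \<xi> *\<^sub>R w \<noteq> y" using B[OF that] by auto
    from DERIV_add[OF num_shift_deriv[OF w this(1)] ell_shift_deriv[OF w this(2)]]
    show ?thesis by (simp add: dk_def)
  qed
  have "\<exists>z. 0 < z \<and> z < t \<and> ?k t - ?k 0 = (t - 0) * dk w (x + z *\<^sub>R w) y"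
    by (rule MVT2[OF t d])
  then obtain z where z: "0 < z" "z < t" "?k t - ?k 0 = t * dk w (x + z *\<^sub>R w) y"
    by auto
  have "dk w (x + z *\<^sub>R w) y \<le> B" using B[of z] z by simp
  then have "t * dk w (x + z *\<^sub>R w) y \<le> t * B" using t by simp
  then show ?thesis using z(3) by simp
qed

section \<open>Approximate critical point equations for the centres of mass\<close>

definition center :: "real \<Rightarrow> (pt \<Rightarrow> real) \<Rightarrow> pt" where
  "center a f = (1 / a) *\<^sub>R (LINT y|lborel. f y *\<^sub>R y)"

lemma center_dist:
  assumes f: "dens l a f" and a: "0 < a" and near: "\<And>y. f y \<noteq> 0 \<Longrightarrow> norm (x - y) \<le> \<delta>"
  shows "norm (x - center a f) \<le> \<delta>"
  using center_near(1)[OF f a] near unfolding center_def by simp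

lemma one_minus_norm_ge:
  assumes "c \<le> 1 - norm (x::pt) ^ 2" "0 < c"
  shows "norm x \<le> 1 - c / 2"
proof -
  have "norm x ^ 2 < 1" using assms by linarith
  then have n: "norm x < 1" by (simp add: abs_square_less_1)
  have "1 - norm x ^ 2 = (1 - norm x) * (1 + norm x)" by (simp add: power2_eq_square algebra_simps)
  also have "\<dots> \<le> (1 - norm x) * 2" using n by (intro mult_left_mono) auto
  finally have "c \<le> (1 - norm x) * 2" using assms(1) by (rule order_trans[rotated])
  then show ?thesis by (simp add: field_simps)
qed

text \<open>Translate by \<open>t\<close> along \<open>w\<close>, divide by \<open>t\<close>, and
  replace points of the supports by the two centres through uniform continuity of \<open>dn\<close>
  and \<open>dk\<close> on compact sets. One inequality suffices, since both \<open>w\<close> and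
  \<open>- w\<close> may be inserted.\<close>

lemma location_equation:
  assumes a: "0 < a" and b: "0 < b" and R: "0 < R" and c: "0 < c" and s: "0 < s" and w: "norm w = 1" and \<eta>: "0 < \<eta>"
  shows "eventually (\<lambda>l. \<forall>v F G \<mu> \<nu>. steady v l a b c (R / sqrt l) s F G \<mu> \<nu> \<longrightarrow>
     a * dn w (center a F) (center a F) - b * dk w (center a F) (center b G) \<le> \<eta>) at_top"
proof -
  \<comment> \<open>Supports lie in the ball of radius \<open>1 - c / 2\<close>; the remaining
    \<open>c / 4\<close> is room for the translated points and for the centres.\<close>
  define r where "r = 1 - c / 4"
  define K1 where "K1 = cball (0::pt) r \<times> cball (0::pt) r"
  define K2 where "K2 = K1 \<inter> {p. s / 2 \<le> norm (fst p - snd p)}"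
  have K1D: "fst p \<in> D \<and> snd p \<in> D" if "p \<in> K1" for p
    using that c by (auto simp: K1_def r_def D_iff)
  have K1pos: "num (fst p) (snd p) \<noteq> 0" if "p \<in> K1" for p
    using num_pos[of "fst p" "snd p"] K1D[OF that] by simp
  have c1: "compact K1" unfolding K1_def by (intro compact_Times compact_cball)
  have c2: "compact K2" unfolding K2_def
    by (intro compact_Int_closed c1 closed_Collect_le continuous_intros)
  have con1: "continuous_on K1 (\<lambda>p. dn w (fst p) (snd p))"
    unfolding dn_def using K1pos unfolding num_def by (intro continuous_intros) auto
  have con2: "continuous_on K2 (\<lambda>p. dk w (fst p) (snd p))"
    unfolding dk_def
    by (intro continuous_intros continuous_on_subset[OF con1]) (use s in \<open>auto simp: K2_def\<close>)
  \<comment> \<open>Half of \<eta> pays for the two replacements, with total weight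
    \<open>a + b\<close>, and the other half for the self-interaction error
    \<open>100 / l\<close>.\<close>
  define \<eta>' where "\<eta>' = \<eta> / (2 * (a + b))"
  have \<eta>': "0 < \<eta>'" using a b \<eta> by (simp add: \<eta>'_def)
  from compact_uniformly_continuous[OF con1 c1] \<eta>' obtain d1 where d1: "0 < d1"
    "\<And>p p'. p \<in> K1 \<Longrightarrow> p' \<in> K1 \<Longrightarrow> dist p' p < d1 \<Longrightarrow> dist (dn w (fst p') (snd p')) (dn w (fst p) (snd p)) < \<eta>'"
    unfolding uniformly_continuous_on_def by metis
  from compact_uniformly_continuous[OF con2 c2] \<eta>' obtain d2 where d2: "0 < d2"
    "\<And>p p'. p \<in> K2 \<Longrightarrow> p' \<in> K2 \<Longrightarrow> dist p' p < d2 \<Longrightarrow> dist (dk w (fst p') (snd p')) (dk w (fst p) (snd p)) < \<eta>'"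
    unfolding uniformly_continuous_on_def by metis
  define m where "m = min (min d1 d2) (min (c / 4) (s / 4))"
  have m: "0 < m" "m \<le> d1" "m \<le> d2" "m \<le> c / 4" "m \<le> s / 4" using d1 d2 c s by (auto simp: m_def)
  have key: "a * dn w (center a F) (center a F) - b * dk w (center a F) (center b G) \<le> \<eta>"
    if l: "1 \<le> l" "((2 * R + 1) / m)\<^sup>2 < l" "200 / \<eta> \<le> l"
      and S: "steady v l a b c (R / sqrt l) s F G \<mu> \<nu>" for l v F G \<mu> \<nu>
  proof -
    let ?X = "center a F" and ?Y = "center b G" and ?d = "R / sqrt l"
    \<comment> \<open>The error per unit of translation is \<open>100 * l * sqrt t\<close>;
      \<open>sqrt t = 1 / l\<^sup>2\<close> makes it \<open>100 / l\<close>.\<close>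
    define t where "t = (1 / l\<^sup>2)\<^sup>2"
    have t: "0 < t" using l by (simp add: t_def)
    have sq: "sqrt t = 1 / l\<^sup>2" unfolding t_def by (rule real_sqrt_unique) simp_all
    have tle: "t \<le> 1 / sqrt l"
    proof -
      have "sqrt l \<le> l" using l mult_left_mono[of 1 l l] by (intro real_le_lsqrt) (simp_all add: power2_eq_square)
      also have "l = l ^ 1" by simp
      also have "l ^ 1 \<le> l ^ 4" using l by (intro power_increasing) auto
      finally have "sqrt l \<le> l ^ 4" .
      moreover have "t = 1 / l ^ 4" by (simp add: t_def power_divide)
      ultimately show ?thesis using l by (simp add: frac_le)
    qed
    have "sqrt (((2 * R + 1) / m)\<^sup>2) < sqrt l" using l(2) by (rule real_sqrt_less_mono)
    then have "(2 * R + 1) / m < sqrt l" using R m by simp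
    then have "(2 * R + 1) / sqrt l < m" using m l by (simp add: field_simps)
    then have sm: "2 * ?d + t < m" using tle by (simp add: add_divide_distrib)
    have dp: "0 < ?d" using R l by simp
    have F: "dens l a F" and G: "dens l b G" using S by (auto simp: steady_def)
    have Fn: "norm x \<le> 1 - c / 2" if "F x \<noteq> 0" for x
      by (rule one_minus_norm_ge[OF _ c]) (use S that in \<open>unfold steady_def, blast\<close>)
    have Gn: "norm x \<le> 1 - c / 2" if "G x \<noteq> 0" for x
      by (rule one_minus_norm_ge[OF _ c]) (use S that in \<open>unfold steady_def, blast\<close>)
    have FX: "norm (x - ?X) \<le> ?d" if "F x \<noteq> 0" for x
      by (rule center_dist[OF F a]) (use S that in \<open>unfold steady_def, blast\<close>)
    have GY: "norm (x - ?Y) \<le> ?d" if "G x \<noteq> 0" for x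
      by (rule center_dist[OF G b]) (use S that in \<open>unfold steady_def, blast\<close>)
    have FG: "s \<le> norm (x - y)" if "F x \<noteq> 0" "G y \<noteq> 0" for x y
      using S that unfolding steady_def by blast
    let ?h = "t *\<^sub>R w"
    have nw: "norm (\<xi> *\<^sub>R w) \<le> t" if "0 \<le> \<xi>" "\<xi> \<le> t" for \<xi> using that w by simp
    have xr: "norm (x + \<xi> *\<^sub>R w) \<le> r" if "F x \<noteq> 0" "0 \<le> \<xi>" "\<xi> \<le> t" for x \<xi>
      using norm_triangle_ineq[of x "\<xi> *\<^sub>R w"] Fn[OF that(1)] nw[OF that(2,3)] sm dp m unfolding r_def by linarith
    have xD: "x + ?h \<in> D" "x - ?h \<in> D" if "F x \<noteq> 0" for x
      using norm_triangle_ineq[of x ?h] norm_triangle_ineq4[of x ?h] Fn[OF that] nw[of t] t sm dp m c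
      unfolding D_iff by linarith+
    have h0: "?h \<noteq> 0" using t w by auto
    have Xr: "norm ?X \<le> r" if "F x \<noteq> 0" for x
      using norm_triangle_ineq4[of x "x - ?X"] FX[OF that] Fn[OF that] sm dp t m unfolding r_def by simp
    have Yr: "norm ?Y \<le> r" if "G x \<noteq> 0" for x
      using norm_triangle_ineq4[of x "x - ?Y"] GY[OF that] Gn[OF that] sm dp t m unfolding r_def by simp
    have yr: "norm y \<le> r" if "F y \<noteq> 0 \<or> G y \<noteq> 0" for y
      using that Fn[of y] Gn[of y] c unfolding r_def by auto
    have xX: "norm (x + \<xi> *\<^sub>R w - ?X) \<le> ?d + t" if "F x \<noteq> 0" "0 \<le> \<xi>" "\<xi> \<le> t" for x \<xi>
      using norm_triangle_ineq[of "x - ?X" "\<xi> *\<^sub>R w"] FX[OF that(1)] nw[OF that(2,3)] by (simp add: algebra_simps)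
    have dP: "dist (p, q) (p', q') \<le> norm (p - p') + norm (q - q')" for p q p' q' :: pt
      unfolding dist_Pair_Pair dist_norm[of p p'] dist_norm[of q q'] by (rule sqrt_sum_squares_le_sum) auto
    have "a * (t * (dn w ?X ?X - \<eta>')) - b * (t * (dk w ?X ?Y + \<eta>')) \<le> 100 * l * norm ?h powr (3/2)"
    proof (rule shift_inequality[OF S a xD h0])
      fix x y assume x: "F x \<noteq> 0" and y: "F y \<noteq> 0"
      show "t * (dn w ?X ?X - \<eta>') \<le> ln (num (x + ?h) y) / 2 - ln (num x y) / 2"
      proof (rule n_shift_ge[OF w t])
        fix \<xi> assume \<xi>: "0 \<le> \<xi>" "\<xi> \<le> t"
        have p: "(x + \<xi> *\<^sub>R w, y) \<in> K1" using xr[OF x \<xi>] yr[of y] y by (simp add: K1_def)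
        have q: "(?X, ?X) \<in> K1" using Xr[OF x] by (simp add: K1_def)
        have "dist (x + \<xi> *\<^sub>R w, y) (?X, ?X) < d1"
          using dP[of "x + \<xi> *\<^sub>R w" y ?X ?X] xX[OF x \<xi>] FX[OF y] sm m by linarith
        from d1(2)[OF q p this] have "dn w ?X ?X - \<eta>' \<le> dn w (x + \<xi> *\<^sub>R w) y" by (simp add: dist_real_def)
        moreover have "0 < num (x + \<xi> *\<^sub>R w) y" using num_pos K1D[OF p] by simp
        ultimately show "0 < num (x + \<xi> *\<^sub>R w) y \<and> dn w ?X ?X - \<eta>' \<le> dn w (x + \<xi> *\<^sub>R w) y" by simp
      qed
    next
      fix x y assume x: "F x \<noteq> 0" and y: "G y \<noteq> 0"
      show "(ln (num (x + ?h) y) / 2 + ell (x + ?h - y)) - (ln (num x y) / 2 + ell (x - y)) \<le> t * (dk w ?X ?Y + \<eta>')"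
      proof (rule k_shift_le[OF w t])
        fix \<xi> assume \<xi>: "0 \<le> \<xi>" "\<xi> \<le> t"
        have "norm (x - y) \<le> norm (x + \<xi> *\<^sub>R w - y) + norm (\<xi> *\<^sub>R w)"
          using norm_triangle_ineq4[of "x + \<xi> *\<^sub>R w - y" "\<xi> *\<^sub>R w"] by (simp add: algebra_simps)
        then have far1: "s / 2 \<le> norm (x + \<xi> *\<^sub>R w - y)" using FG[OF x y] nw[OF \<xi>] sm dp m s by linarith
        have "norm (x - y) \<le> norm (?X - ?Y) + norm ((x - ?X) - (y - ?Y))"
          using norm_triangle_ineq[of "?X - ?Y" "(x - ?X) - (y - ?Y)"] by (simp add: algebra_simps)
        also have "norm ((x - ?X) - (y - ?Y)) \<le> ?d + ?d"
          using norm_triangle_ineq4[of "x - ?X" "y - ?Y"] FX[OF x] GY[OF y] by linarith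
        finally have far2: "s / 2 \<le> norm (?X - ?Y)" using FG[OF x y] sm t m s by linarith
        have p: "(x + \<xi> *\<^sub>R w, y) \<in> K2" using xr[OF x \<xi>] yr[of y] y far1 by (simp add: K1_def K2_def)
        have q: "(?X, ?Y) \<in> K2" using Xr[OF x] Yr[OF y] far2 by (simp add: K1_def K2_def)
        have "dist (x + \<xi> *\<^sub>R w, y) (?X, ?Y) < d2"
          using dP[of "x + \<xi> *\<^sub>R w" y ?X ?Y] xX[OF x \<xi>] GY[OF y] sm m by linarith
        from d2(2)[OF q p this] have "dk w (x + \<xi> *\<^sub>R w) y \<le> dk w ?X ?Y + \<eta>'" by (simp add: dist_real_def)
        moreover have "(x + \<xi> *\<^sub>R w, y) \<in> K1" using p by (simp add: K2_def)
        then have "0 < num (x + \<xi> *\<^sub>R w) y" using num_pos K1D by fastforce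
        moreover have "x + \<xi> *\<^sub>R w \<noteq> y" using far1 s by auto
        ultimately show "0 < num (x + \<xi> *\<^sub>R w) y \<and> x + \<xi> *\<^sub>R w \<noteq> y \<and> dk w (x + \<xi> *\<^sub>R w) y \<le> dk w ?X ?Y + \<eta>'" by simp
      qed
    qed
    also have "norm ?h powr (3/2) = t * sqrt t"
    proof -
      have "t powr (3/2) = t powr (1 + 1/2)" by simp
      also have "\<dots> = t powr 1 * t powr (1/2)" by (rule powr_add)
      finally show ?thesis using t w by (simp add: powr_half_sqrt)
    qed
    finally have "t * (a * dn w ?X ?X - b * dk w ?X ?Y - (a + b) * \<eta>') \<le> t * (100 * l * sqrt t)"
      by (simp add: algebra_simps)
    then have "a * dn w ?X ?X - b * dk w ?X ?Y - (a + b) * \<eta>' \<le> 100 * l * sqrt t" using t by simp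
    moreover have "100 * l * sqrt t = 100 / l" unfolding sq using l by (simp add: power2_eq_square)
    moreover have "100 / l \<le> \<eta> / 2" using l \<eta> by (simp add: field_simps)
    moreover have "(a + b) * \<eta>' = \<eta> / 2"
    proof -
      have "a + b \<noteq> 0" using a b by simp
      then show ?thesis unfolding \<eta>'_def mult.commute[of 2 "a + b"] times_divide_eq_right
        by (rule nonzero_mult_divide_mult_cancel_left)
    qed
    ultimately show ?thesis by linarith
  qed
  show ?thesis
    using eventually_ge_at_top[of 1] eventually_gt_at_top[of "((2 * R + 1) / m)\<^sup>2"] eventually_ge_at_top[of "200 / \<eta>"]
    by eventually_elim (use key in blast)
qed

text \<open>Evenness across the axis removes the orthogonal component. For the sign,
  \<open>f y - f (mirror v y)\<close> and \<open>y \<bullet> v\<close> have the same sign, and their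
  product integrates to twice the moment.\<close>

lemma center_axis:
  assumes f: "dens l a f" and a: "0 < a" and F: "fol v f" and v: "norm v = 1"
  shows "center a f = (center a f \<bullet> v) *\<^sub>R v" "0 \<le> center a f \<bullet> v"
proof -
  note [measurable] = dens_measurable[OF f]
  have "(LINT y|lborel. f y *\<^sub>R y) \<bullet> perp v = 0"
    by (rule center_mirror_invariant[OF f _ fol_even[OF dens_measurable[OF f] F]]) (simp_all add: v)
  then have "center a f \<bullet> perp v = 0" by (simp add: center_def)
  then show "center a f = (center a f \<bullet> v) *\<^sub>R v" using frame_expand[OF v, of "center a f"] by simp
  have i: "integrable lborel (\<lambda>y. f y *\<^sub>R y)"
    by (rule center_near(2)[OF f a, of 0 1]) (use dens_off[OF f] in \<open>auto simp: D_iff intro!: always_eventually less_imp_le\<close>)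
  then have i1: "integrable lborel (\<lambda>y. f y * (y \<bullet> v))"
    using integrable_inner_left[of v lborel "\<lambda>y. f y *\<^sub>R y"] by simp
  have i2: "integrable lborel (\<lambda>y. f (mirror v y) * (y \<bullet> v))"
    using integrable_mirror[OF i1 v] by (simp add: mirror_inner_unit[OF v])
  have e: "(LINT y|lborel. f (mirror v y) * (y \<bullet> v)) = - (LINT y|lborel. f y * (y \<bullet> v))"
  proof -
    have "(LINT y|lborel. f y * (y \<bullet> v)) = (LINT y|lborel. f (mirror v y) * (mirror v y \<bullet> v))"
      by (subst integral_mirror[OF _ v, of "\<lambda>y. f y * (y \<bullet> v)"]) simp_all
    then show ?thesis by (simp add: mirror_inner_unit[OF v])
  qed
  have ae: "AE y in lborel. 0 < y \<bullet> v \<longrightarrow> f (mirror v y) \<le> f y"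
    by (rule fol_AE[OF F v]) (simp add: v)
  have ae': "AE y in lborel. 0 < mirror v y \<bullet> v \<longrightarrow> f (mirror v (mirror v y)) \<le> f (mirror v y)"
    by (rule AE_mirror[OF _ v ae]) measurable
  have "0 \<le> (LINT y|lborel. (f y - f (mirror v y)) * (y \<bullet> v))"
  proof (rule integral_nonneg_AE)
    show "AE y in lborel. 0 \<le> (f y - f (mirror v y)) * (y \<bullet> v)"
      using ae ae'
    proof eventually_elim
      case (elim y)
      consider "y \<bullet> v = 0" | "0 < y \<bullet> v" | "y \<bullet> v < 0" by linarith
      then show ?case
      proof cases
        case 3
        then have "f y \<le> f (mirror v y)" using elim v by (simp add: mirror_inner_unit[OF v])
        then show ?thesis using 3 by (auto intro: mult_nonpos_nonpos)
      qed (use elim in auto)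
    qed
  qed
  also have "\<dots> = 2 * (LINT y|lborel. f y * (y \<bullet> v))"
    using i1 i2 e by (simp add: left_diff_distrib)
  also have "(LINT y|lborel. f y * (y \<bullet> v)) = (LINT y|lborel. f y *\<^sub>R y) \<bullet> v"
    using integral_inner_left[of v lborel "\<lambda>y. f y *\<^sub>R y"] i by simp
  finally show "0 \<le> center a f \<bullet> v" using a by (simp add: center_def)
qed

text \<open>A multiple of the \<open>p\<close>-derivative of the Kirchhoff--Routh function for vortices of strengths
  \<open>a\<close> at \<open>(0, p)\<close> and \<open>- b\<close> at \<open>(0, - q)\<close>.\<close>

definition \<Phi> :: "real \<Rightarrow> real \<Rightarrow> real \<Rightarrow> real \<Rightarrow> real" where
  "\<Phi> a b p q = a * (p / (1 - p\<^sup>2)) + b * (q / (1 + p * q) - 1 / (p + q))"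

lemma dn_uminus: "dn (- w) x y = - dn w x y"
proof -
  have "(x \<bullet> - w) * norm y ^ 2 - y \<bullet> - w = - ((x \<bullet> w) * norm y ^ 2 - y \<bullet> w)" by simp
  then show ?thesis unfolding dn_def by (metis minus_divide_left)
qed

lemma dk_uminus: "dk (- w) x y = - dk w x y"
  by (simp add: dk_def dn_uminus)

lemma dn_axis:
  assumes v: "norm v = 1" and p: "p\<^sup>2 < 1"
  shows "dn v (p *\<^sub>R v) (p *\<^sub>R v) = - (p / (1 - p\<^sup>2))"
proof -
  have "num (p *\<^sub>R v) (p *\<^sub>R v) = (1 - p\<^sup>2) * (1 - p\<^sup>2)"
    using v by (simp add: num_def power2_eq_square algebra_simps)
  moreover have "(p *\<^sub>R v) \<bullet> v * norm (p *\<^sub>R v) ^ 2 - (p *\<^sub>R v) \<bullet> v = - (p * (1 - p\<^sup>2))"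
    using v by (simp add: power2_eq_square algebra_simps)
  ultimately show ?thesis using p by (simp add: dn_def)
qed

lemma dk_axis:
  assumes v: "norm v = 1" and pq: "0 \<le> p" "0 \<le> q" "0 < p + q"
  shows "dk v (p *\<^sub>R v) (- (q *\<^sub>R v)) = q / (1 + p * q) - 1 / (p + q)"
proof -
  have n0: "0 < 1 + p * q" using pq by (simp add: add_pos_nonneg)
  have "num (p *\<^sub>R v) (- (q *\<^sub>R v)) = (1 + p * q) * (1 + p * q)"
    using v by (simp add: num_def power2_eq_square algebra_simps)
  moreover have "(p *\<^sub>R v) \<bullet> v * norm (- (q *\<^sub>R v)) ^ 2 - (- (q *\<^sub>R v)) \<bullet> v = q * (1 + p * q)"
    using v by (simp add: power2_eq_square algebra_simps)
  ultimately have 1: "dn v (p *\<^sub>R v) (- (q *\<^sub>R v)) = q / (1 + p * q)" using n0 by (simp add: dn_def)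
  have "p *\<^sub>R v - - (q *\<^sub>R v) = (p + q) *\<^sub>R v" by (simp add: algebra_simps)
  then have "((p *\<^sub>R v - - (q *\<^sub>R v)) \<bullet> v) / norm (p *\<^sub>R v - - (q *\<^sub>R v)) ^ 2 = 1 / (p + q)"
    using v pq by (simp add: power2_eq_square)
  then show ?thesis using 1 by (simp add: dk_def)
qed

text \<open>The centres lie on the axis, so only the directions \<open>v\<close> and
  \<open>- v\<close> are needed: they give the two signs of each estimate. The second equation is
  the first one for the pair with exchanged roles.\<close>

lemma steady_location:
  assumes a: "0 < a" and b: "0 < b" and R: "0 < R" and c: "0 < c" and s: "0 < s" and v: "norm v = 1" and \<eta>: "0 < \<eta>"
  shows "eventually (\<lambda>l. \<forall>F G \<mu> \<nu>. steady v l a b c (R / sqrt l) s F G \<mu> \<nu> \<longrightarrow>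
     (\<exists>p q. center a F = p *\<^sub>R v \<and> center b G = - (q *\<^sub>R v) \<and> 0 \<le> p \<and> p \<le> 1 - c / 4 \<and> 0 \<le> q \<and> q \<le> 1 - c / 4 \<and> s / 2 \<le> p + q \<and>
       \<bar>\<Phi> a b p q\<bar> \<le> \<eta> \<and> \<bar>\<Phi> b a q p\<bar> \<le> \<eta>)) at_top"
proof -
  have v': "norm (- v) = 1" using v by simp
  define m where "m = min (c / 4) (s / 4)"
  have m: "0 < m" "m \<le> c / 4" "m \<le> s / 4" using c s by (auto simp: m_def)
  show ?thesis
    using location_equation[OF a b R c s v \<eta>] location_equation[OF a b R c s v' \<eta>]
      location_equation[OF b a R c s v \<eta>] location_equation[OF b a R c s v' \<eta>]
      eventually_gt_at_top[of 0] eventually_gt_at_top[of "(R / m)\<^sup>2"]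
  proof eventually_elim
    case (elim l)
    show ?case
    proof (intro allI impI)
      fix F G \<mu> \<nu> assume S: "steady v l a b c (R / sqrt l) s F G \<mu> \<nu>"
      note S' = steady_swap[OF S]
      have F: "dens l a F" "fol v F" and G: "dens l b G" "fol (- v) G" using S by (auto simp: steady_def)
      define p where "p = center a F \<bullet> v"
      define q where "q = center b G \<bullet> (- v)"
      have p: "center a F = p *\<^sub>R v" "0 \<le> p" using center_axis[OF F(1) a F(2) v] by (simp_all add: p_def)
      have q: "center b G = q *\<^sub>R (- v)" "0 \<le> q" using center_axis[OF G(1) b G(2) v'] unfolding q_def by blast+
      have q': "center b G = - (q *\<^sub>R v)" using q(1) by simp
      let ?d = "R / sqrt l"
      have d: "?d < m"
      proof -
        have "sqrt ((R / m)\<^sup>2) < sqrt l" using elim(6) by (rule real_sqrt_less_mono)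
        then have "R / m < sqrt l" using R m by simp
        then show ?thesis using m elim(5) by (simp add: field_simps)
      qed
      have ex: "\<exists>x. h x \<noteq> 0" if "dens l n h" "0 < n" for h n
      proof (rule ccontr)
        assume "\<not> (\<exists>x. h x \<noteq> 0)"
        then have "h = (\<lambda>x. 0)" by auto
        then show False using dens_integral[OF that(1)] that(2) by simp
      qed
      obtain x where x: "F x \<noteq> 0" using ex[OF F(1) a] by blast
      obtain y where y: "G y \<noteq> 0" using ex[OF G(1) b] by blast
      have nx: "norm x \<le> 1 - c / 2" by (rule one_minus_norm_ge[OF _ c]) (use S x in \<open>unfold steady_def, blast\<close>)
      have ny: "norm y \<le> 1 - c / 2" by (rule one_minus_norm_ge[OF _ c]) (use S y in \<open>unfold steady_def, blast\<close>)
      have dx: "norm (x - center a F) \<le> ?d" by (rule center_dist[OF F(1) a]) (use S x in \<open>unfold steady_def, blast\<close>)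
      have dy: "norm (y - center b G) \<le> ?d" by (rule center_dist[OF G(1) b]) (use S y in \<open>unfold steady_def, blast\<close>)
      have xy: "s \<le> norm (x - y)" using S x y unfolding steady_def by blast
      have "norm (center a F) \<le> 1 - c / 4"
        using norm_triangle_ineq4[of x "x - center a F"] nx dx d m by simp
      then have p1: "p \<le> 1 - c / 4" using p v by simp
      have "norm (center b G) \<le> 1 - c / 4"
        using norm_triangle_ineq4[of y "y - center b G"] ny dy d m by simp
      then have q1: "q \<le> 1 - c / 4" using q' q(2) v by simp
      have "norm (x - y) \<le> norm (center a F - center b G) + norm ((x - center a F) - (y - center b G))"
        using norm_triangle_ineq[of "center a F - center b G" "(x - center a F) - (y - center b G)"] by (simp add: algebra_simps)
      also have "norm ((x - center a F) - (y - center b G)) \<le> ?d + ?d"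
        using norm_triangle_ineq4[of "x - center a F" "y - center b G"] dx dy by linarith
      also have "norm (center a F - center b G) = p + q"
      proof -
        have "center a F - center b G = (p + q) *\<^sub>R v" unfolding p(1) q' by (simp add: algebra_simps)
        then show ?thesis using p q v by simp
      qed
      finally have pq: "s / 2 \<le> p + q" using xy d m by linarith
      have pq0: "0 < p + q" using pq s by linarith
      have p2: "p\<^sup>2 < 1" using p(2) p1 c by (simp add: abs_square_less_1)
      have q2: "q\<^sup>2 < 1" using q(2) q1 c by (simp add: abs_square_less_1)
      have E1: "a * dn v (center a F) (center a F) - b * dk v (center a F) (center b G) = - \<Phi> a b p q"
        unfolding p(1) q' dn_axis[OF v p2] dk_axis[OF v p(2) q(2) pq0] \<Phi>_def by simp
      have E2: "b * dn (- v) (center b G) (center b G) - a * dk (- v) (center b G) (center a F) = - \<Phi> b a q p"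
      proof -
        have qp0: "0 < q + p" using pq0 by simp
        have X: "center a F = - (p *\<^sub>R (- v))" using p(1) by simp
        show ?thesis
          unfolding X q(1) dn_axis[OF v' q2] dk_axis[OF v' q(2) p(2) qp0] \<Phi>_def by simp
      qed
      have "- \<Phi> a b p q \<le> \<eta>" using elim(1) S E1 by metis
      moreover have "\<Phi> a b p q \<le> \<eta>"
      proof -
        have "a * dn (- v) (center a F) (center a F) - b * dk (- v) (center a F) (center b G) \<le> \<eta>" using elim(2) S by blast
        then show ?thesis using E1 by (simp add: dn_uminus dk_uminus)
      qed
      moreover have "- \<Phi> b a q p \<le> \<eta>" using elim(4) S' E2 by metis
      moreover have "\<Phi> b a q p \<le> \<eta>"
      proof -
        have "b * dn v (center b G) (center b G) - a * dk v (center b G) (center a F) \<le> \<eta>" using elim(3) S' by blast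
        then show ?thesis using E2 by (simp add: dn_uminus dk_uminus)
      qed
      ultimately have "\<bar>\<Phi> a b p q\<bar> \<le> \<eta>" "\<bar>\<Phi> b a q p\<bar> \<le> \<eta>" by linarith+
      then show "\<exists>p q. center a F = p *\<^sub>R v \<and> center b G = - (q *\<^sub>R v) \<and> 0 \<le> p \<and> p \<le> 1 - c / 4 \<and> 0 \<le> q \<and> q \<le> 1 - c / 4 \<and> s / 2 \<le> p + q \<and>
       \<bar>\<Phi> a b p q\<bar> \<le> \<eta> \<and> \<bar>\<Phi> b a q p\<bar> \<le> \<eta>"
        using p q q' p1 q1 pq by blast
    qed
  qed
qed

section \<open>The limiting positions\<close>

text \<open>What remains of the two critical point equations after eliminating \<open>p = k\<^sup>2 q\<close>.\<close>

definition balance :: "real \<Rightarrow> real \<Rightarrow> real" where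
  "balance k q = k * (k\<^sup>2 + 1) * (q\<^sup>2 * (1 + k\<^sup>2 * q\<^sup>2)) - (1 - (k\<^sup>2 * q)\<^sup>2) * (1 - q\<^sup>2)"

text \<open>The first term grows with \<open>q\<close>, and both factors of the subtracted product
  decrease as long as \<open>q\<close> and \<open>k\<^sup>2 * q\<close> stay below 1.\<close>

lemma balance_strict:
  assumes k: "0 < k" and q: "0 \<le> q" "q < q'" "q' < 1" "k\<^sup>2 * q' < 1"
  shows "balance k q < balance k q'"
proof -
  have 1: "q\<^sup>2 < q'\<^sup>2" using q by (intro power_strict_mono) auto
  have "k\<^sup>2 * q < k\<^sup>2 * q'" using k q by simp
  then have 2: "(k\<^sup>2 * q)\<^sup>2 < (k\<^sup>2 * q')\<^sup>2" using k q by (intro power_strict_mono) auto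
  have "q\<^sup>2 * (1 + k\<^sup>2 * q\<^sup>2) \<le> q'\<^sup>2 * (1 + k\<^sup>2 * q'\<^sup>2)"
    using 1 by (intro mult_mono add_left_mono mult_left_mono) auto
  then have "k * (k\<^sup>2 + 1) * (q\<^sup>2 * (1 + k\<^sup>2 * q\<^sup>2)) \<le> k * (k\<^sup>2 + 1) * (q'\<^sup>2 * (1 + k\<^sup>2 * q'\<^sup>2))"
    using k by (intro mult_left_mono) auto
  moreover have "(1 - (k\<^sup>2 * q')\<^sup>2) * (1 - q'\<^sup>2) < (1 - (k\<^sup>2 * q)\<^sup>2) * (1 - q\<^sup>2)"
  proof (rule mult_strict_mono)
    have "(k\<^sup>2 * q')\<^sup>2 < 1" "q'\<^sup>2 < 1" using k q by (simp_all add: abs_square_less_1)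
    then show "0 < 1 - (k\<^sup>2 * q)\<^sup>2" "0 \<le> 1 - q'\<^sup>2" using 2 by auto
  qed (use 1 2 in auto)
  ultimately show ?thesis unfolding balance_def by linarith
qed

text \<open>With \<open>M = (1 + p * q) * (p + q)\<close> the interaction terms simplify to
  \<open>- B / M\<close> and \<open>- A / M\<close>, so the equations read
  \<open>p * M = k * A * B\<close> and \<open>k * q * M = A * B\<close>. Comparing them gives
  \<open>p = k\<^sup>2 * q\<close>.\<close>

lemma \<Phi>_zero:
  assumes k: "0 < k" and p: "0 \<le> p" "p < 1" and q: "0 \<le> q" "q < 1" and pq: "0 < p + q"
    and z: "\<Phi> 1 k p q = 0" "\<Phi> k 1 q p = 0"
  shows "p = k\<^sup>2 * q" "balance k q = 0"
proof -
  define A where "A = 1 - p\<^sup>2"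
  define B where "B = 1 - q\<^sup>2"
  define M where "M = (1 + p * q) * (p + q)"
  have A: "0 < A" and B: "0 < B" using p q by (simp_all add: A_def B_def abs_square_less_1)
  have n: "0 < 1 + p * q" using p q by (simp add: add_pos_nonneg)
  have M: "0 < M" using n pq by (simp add: M_def)
  have e1: "q / (1 + p * q) - 1 / (p + q) = - (B / M)"
  proof -
    have "q / (1 + p * q) - 1 / (p + q) = (q * (p + q) - 1 * (1 + p * q)) / M"
      unfolding M_def by (rule diff_frac_eq) (use n pq in auto)
    also have "q * (p + q) - 1 * (1 + p * q) = - B" by (simp add: B_def power2_eq_square algebra_simps)
    finally show ?thesis by simp
  qed
  have e2: "p / (1 + q * p) - 1 / (q + p) = - (A / M)"
  proof -
    have "p / (1 + q * p) - 1 / (q + p) = (p * (q + p) - 1 * (1 + q * p)) / ((1 + q * p) * (q + p))"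
      by (rule diff_frac_eq) (use n pq in \<open>auto simp: mult.commute add.commute\<close>)
    also have "p * (q + p) - 1 * (1 + q * p) = - A" by (simp add: A_def power2_eq_square algebra_simps)
    also have "(1 + q * p) * (q + p) = M" by (simp add: M_def mult.commute add.commute)
    finally show ?thesis by simp
  qed
  have "p / A = k * B / M" using z(1) e1 by (simp add: \<Phi>_def A_def[symmetric])
  then have 1: "p * M = k * (A * B)" using A M by (simp add: field_simps)
  have "k * q / B = A / M" using z(2) e2 by (simp add: \<Phi>_def B_def[symmetric])
  then have 2: "k * q * M = A * B" using B M by (simp add: field_simps)
  have "p * M = (k\<^sup>2 * q) * M" using 1 2 by (simp add: power2_eq_square)
  then show pe: "p = k\<^sup>2 * q" using M by simp
  have "k * q * M = k * (k\<^sup>2 + 1) * (q\<^sup>2 * (1 + k\<^sup>2 * q\<^sup>2))"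
    unfolding M_def pe by (simp add: power2_eq_square algebra_simps)
  then show "balance k q = 0" using 2 unfolding balance_def A_def B_def pe by simp
qed

text \<open>Existence comes from the intermediate value theorem for \<open>balance\<close>,
  uniqueness from its strict monotonicity.\<close>

lemma vortex_pair_position:
  assumes k: "0 < k"
  obtains P Q where "0 < P" "P < 1" "0 < Q" "Q < (1::real)"
    "\<And>p q. 0 \<le> p \<Longrightarrow> p < 1 \<Longrightarrow> 0 \<le> q \<Longrightarrow> q < 1 \<Longrightarrow> 0 < p + q \<Longrightarrow> \<Phi> 1 k p q = 0 \<Longrightarrow> \<Phi> k 1 q p = 0 \<Longrightarrow> p = P \<and> q = Q"
proof -
  \<comment> \<open>The right end of the range where both \<open>q\<close> and
    \<open>k\<^sup>2 * q\<close> are at most 1; the subtracted product in \<open>balance\<close>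
    vanishes there.\<close>
  define u where "u = min 1 (1 / k\<^sup>2)"
  have u: "0 < u" "u \<le> 1" "k\<^sup>2 * u \<le> 1" using k by (auto simp: u_def min_def field_simps)
  have "(1 - (k\<^sup>2 * u)\<^sup>2) * (1 - u\<^sup>2) = 0" using k by (auto simp: u_def min_def)
  moreover have "0 < k * (k\<^sup>2 + 1) * (u\<^sup>2 * (1 + k\<^sup>2 * u\<^sup>2))"
    using k u by (intro mult_pos_pos add_nonneg_pos add_pos_nonneg) auto
  ultimately have Hu: "0 < balance k u" unfolding balance_def by linarith
  have H0: "balance k 0 < 0" by (simp add: balance_def)
  have "\<exists>x\<ge>0. x \<le> u \<and> balance k x = 0"
    by (rule IVT) (use Hu H0 u in \<open>auto simp: balance_def intro!: continuous_intros\<close>)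
  then obtain Q where Q: "0 \<le> Q" "Q \<le> u" "balance k Q = 0" by blast
  have "Q \<noteq> 0" "Q \<noteq> u" using Q H0 Hu by auto
  then have Q': "0 < Q" "Q < u" using Q by auto
  have kQ: "k\<^sup>2 * Q < 1"
  proof -
    have "k\<^sup>2 * Q < k\<^sup>2 * u" using Q' k by simp
    then show ?thesis using u by simp
  qed
  have uniq: "p = k\<^sup>2 * Q \<and> q = Q"
    if "0 \<le> p" "p < 1" "0 \<le> q" "q < 1" "0 < p + q" "\<Phi> 1 k p q = 0" "\<Phi> k 1 q p = 0" for p q
  proof -
    note z = \<Phi>_zero[OF k that]
    have "q = Q"
    proof (cases q Q rule: linorder_cases)
      case less
      then show ?thesis using balance_strict[OF k that(3) less] Q' u kQ z Q by simp
    next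
      case greater
      then show ?thesis using balance_strict[OF k Q(1) greater that(4)] z Q that(2) by simp
    qed simp
    then show ?thesis using z by simp
  qed
  show ?thesis
  proof (rule that[of "k\<^sup>2 * Q" Q])
    show "0 < k\<^sup>2 * Q" "Q < 1" using Q' u k by auto
  qed (use Q' kQ uniq in blast)+
qed

lemma \<Phi>_scale:
  assumes "a \<noteq> 0"
  shows "\<Phi> a b p q = a * \<Phi> 1 (b / a) p q" "\<Phi> b a q p = a * \<Phi> (b / a) 1 q p"
  using assms by (simp_all add: \<Phi>_def distrib_left)

text \<open>Off a neighbourhood of the only zero the two equations have a positive minimal defect by
  compactness. The bounds \<open>r < 1\<close> and \<open>m > 0\<close> keep the poles at
  \<open>p = 1\<close>, \<open>q = 1\<close> and \<open>p + q = 0\<close> away.\<close>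

lemma \<Phi>_small_near_zero:
  fixes z :: "real \<times> real"
  assumes r: "r < 1" and m: "0 < m" and e: "0 < e"
    and uniq: "\<And>p q. 0 \<le> p \<Longrightarrow> p \<le> r \<Longrightarrow> 0 \<le> q \<Longrightarrow> q \<le> r \<Longrightarrow> m \<le> p + q \<Longrightarrow> \<Phi> a b p q = 0 \<Longrightarrow> \<Phi> b a q p = 0 \<Longrightarrow> (p, q) = z"
  obtains \<eta> where "0 < \<eta>"
    "\<And>p q. 0 \<le> p \<Longrightarrow> p \<le> r \<Longrightarrow> 0 \<le> q \<Longrightarrow> q \<le> r \<Longrightarrow> m \<le> p + q \<Longrightarrow> \<bar>\<Phi> a b p q\<bar> \<le> \<eta> \<Longrightarrow> \<bar>\<Phi> b a q p\<bar> \<le> \<eta> \<Longrightarrow> dist (p, q) z < e"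
proof -
  define K where "K = ({0..r} \<times> {0..r}) \<inter> {x. m \<le> fst x + snd x} \<inter> {x. e \<le> dist x z}"
  define N where "N x = \<bar>\<Phi> a b (fst x) (snd x)\<bar> + \<bar>\<Phi> b a (snd x) (fst x)\<bar>" for x
  have cK: "compact K"
    unfolding K_def by (intro compact_Int_closed compact_Times compact_Icc closed_Collect_le continuous_intros)
  have con: "continuous_on K N"
  proof -
    have sq: "x\<^sup>2 \<noteq> 1" if "0 \<le> x" "x \<le> r" for x :: real
      using that r by (auto simp: power2_eq_1_iff)
    have pos: "1 + x * y \<noteq> 0" if "0 \<le> x" "0 \<le> y" for x y :: real
      using mult_nonneg_nonneg[OF that] by linarith
    show ?thesis
      unfolding N_def \<Phi>_def
      by (intro continuous_intros) (use sq pos m in \<open>auto simp: K_def\<close>)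
  qed
  show ?thesis
  proof (cases "K = {}")
    case True
    show ?thesis
    proof (rule that[of 1])
      fix p q assume "0 \<le> p" "p \<le> r" "0 \<le> q" "q \<le> r" "m \<le> p + q"
      moreover have "(p, q) \<notin> K" using True by blast
      ultimately show "dist (p, q) z < e" by (simp add: K_def)
    qed simp
  next
    case False
    obtain y where y: "y \<in> K" "\<And>x. x \<in> K \<Longrightarrow> N y \<le> N x"
      using continuous_attains_inf[OF cK False con] by blast
    have "N y \<noteq> 0"
    proof
      assume "N y = 0"
      then have "\<Phi> a b (fst y) (snd y) = 0" "\<Phi> b a (snd y) (fst y) = 0" unfolding N_def by linarith+
      then have "(fst y, snd y) = z" using y(1) by (intro uniq) (auto simp: K_def)
      then show False using y(1) e by (simp add: K_def)
    qed
    then have Ny: "0 < N y" unfolding N_def by linarith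
    show ?thesis
    proof (rule that[of "N y / 3"])
      fix p q assume h: "0 \<le> p" "p \<le> r" "0 \<le> q" "q \<le> r" "m \<le> p + q" "\<bar>\<Phi> a b p q\<bar> \<le> N y / 3" "\<bar>\<Phi> b a q p\<bar> \<le> N y / 3"
      have "N (p, q) < N y" using h(6,7) Ny by (simp add: N_def)
      then have "(p, q) \<notin> K" using y(2)[of "(p, q)"] by auto
      then show "dist (p, q) z < e" using h by (simp add: K_def)
    qed (use Ny in simp)
  qed
qed

section \<open>Return to the operators and set integrals of the statement\<close>

lemma set_integral_D_lebesgue:
  fixes f :: "pt \<Rightarrow> 'b::{banach, second_countable_topology}"
  assumes [measurable]: "f \<in> borel_measurable borel" and off: "\<And>x. x \<notin> D \<Longrightarrow> f x = 0"
  shows "(LINT x:D|lebesgue. f x) = (LINT x|lborel. f x)"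
proof -
  have "(\<lambda>x. indicator D x *\<^sub>R f x) = f"
    using off by (auto simp: indicator_def)
  then show ?thesis
    unfolding set_lebesgue_integral_def by (simp add: integral_completion)
qed

lemma steady_Gop:
  assumes F: "dens l a F" and G: "dens l b G" and x: "x \<in> D"
  shows "Gop (\<lambda>x. F x + - G x) x = V F x - V G x"
proof -
  note [measurable] = dens_measurable[OF F] dens_measurable[OF G]
  have "Gop (\<lambda>x. F x + - G x) x = (LINT y|lborel. Green x y * (F y + - G y))"
    unfolding Gop_def by (rule set_integral_D_lebesgue) (measurable, simp add: dens_off[OF F] dens_off[OF G])
  then show ?thesis
    using Green_integrable[OF F x] Green_integrable[OF G x] by (simp add: V_def right_diff_distrib)
qed

text \<open>A point and its reflection have equal norm and equal height, so \<open>psi_mono\<close>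
  applies in both directions. This yields evenness at every point, not only almost
  everywhere.\<close>

lemma psi_even:
  assumes A: "Adm (0, 1) l a b f g" and x: "x \<in> D"
  shows "V f (reflect x) - V g (reflect x) = V f x - V g x"
proof -
  have n: "norm x = norm (reflect x)" by (cases x) (simp add: reflect_def norm_Pair)
  have rD: "reflect x \<in> D" using x n by (simp add: D_iff)
  have s: "reflect x \<bullet> (0, 1) = x \<bullet> (0, 1)" by (cases x) (simp add: reflect_def)
  show ?thesis
    using psi_mono(1)[OF A x n] psi_mono(1)[OF A rD n[symmetric]] s by (intro antisym) simp_all
qed

lemma closure_diameter_le:
  fixes S :: "pt set"
  assumes "S \<subseteq> D" "0 \<le> d" "\<And>x y. x \<in> S \<Longrightarrow> y \<in> S \<Longrightarrow> norm (x - y) \<le> d"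
  shows "diameter (closure S) \<le> d"
proof -
  have "bounded S" using assms(1) unfolding D_def by (rule bounded_subset[OF bounded_ball])
  then have "diameter (closure S) = diameter S" by (rule diameter_closure)
  also have "\<dots> \<le> d" by (rule diameter_le) (use assms in auto)
  finally show ?thesis .
qed

lemma steady_solution:
  assumes S: "steady (0, 1) l a b c (R / sqrt l) s F G \<mu> \<nu>" and R: "0 < R" and l: "0 < l"
  defines "\<omega> \<equiv> \<lambda>x. F x + - G x"
  shows "\<omega> \<in> borel_measurable lebesgue"
    "F = (\<lambda>x. l * indicator {y \<in> D. Gop \<omega> y > \<mu>} x)"
    "(\<lambda>x. - G x) = (\<lambda>x. - l * indicator {y \<in> D. Gop \<omega> y < - \<nu>} x)"
    "(LINT x:D|lebesgue. F x) = a" "(LINT x:D|lebesgue. - G x) = - b"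
    "x \<in> D \<Longrightarrow> \<omega> (reflect x) = \<omega> x"
    "diameter (closure {x \<in> D. F x \<noteq> 0}) \<le> R * l powr (-1/2)"
    "diameter (closure {x \<in> D. - G x \<noteq> 0}) \<le> R * l powr (-1/2)"
    "(LINT x:D|lebesgue. F x *\<^sub>R x) = (LINT x|lborel. F x *\<^sub>R x)"
    "(LINT x:D|lebesgue. - G x *\<^sub>R x) = - (LINT x|lborel. G x *\<^sub>R x)"
proof -
  have F: "dens l a F" "fol (0, 1) F" and G: "dens l b G" "fol (- (0, 1)) G"
    and Fe: "F = (\<lambda>x. l * indicator {x \<in> D. \<mu> < V F x - V G x} x)"
    and Ge: "G = (\<lambda>x. l * indicator {x \<in> D. \<nu> < V G x - V F x} x)"
    and dF: "\<And>x y. F x \<noteq> 0 \<Longrightarrow> F y \<noteq> 0 \<Longrightarrow> norm (x - y) \<le> R / sqrt l"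
    and dG: "\<And>x y. G x \<noteq> 0 \<Longrightarrow> G y \<noteq> 0 \<Longrightarrow> norm (x - y) \<le> R / sqrt l"
    using S unfolding steady_def by blast+
  note [measurable] = dens_measurable[OF F(1)] dens_measurable[OF G(1)]
  note Gop = steady_Gop[OF F(1) G(1), folded \<omega>_def]
  have "\<omega> \<in> borel_measurable lborel" unfolding \<omega>_def by measurable
  then show "\<omega> \<in> borel_measurable lebesgue" by (rule measurable_completion)
  have "{y \<in> D. Gop \<omega> y > \<mu>} = {x \<in> D. \<mu> < V F x - V G x}" using Gop by auto
  then show "F = (\<lambda>x. l * indicator {y \<in> D. Gop \<omega> y > \<mu>} x)" using Fe by simp
  have "{y \<in> D. Gop \<omega> y < - \<nu>} = {x \<in> D. \<nu> < V G x - V F x}" using Gop by auto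
  then have "G = (\<lambda>x. l * indicator {y \<in> D. Gop \<omega> y < - \<nu>} x)" using Ge by simp
  then show "(\<lambda>x. - G x) = (\<lambda>x. - l * indicator {y \<in> D. Gop \<omega> y < - \<nu>} x)"
    by (metis minus_mult_left)
  show "(LINT x:D|lebesgue. F x) = a"
    by (subst set_integral_D_lebesgue) (simp_all add: dens_off[OF F(1)] dens_integral[OF F(1)])
  show "(LINT x:D|lebesgue. - G x) = - b"
    by (subst set_integral_D_lebesgue) (simp_all add: dens_off[OF G(1)] dens_integral[OF G(1)])
  have A: "Adm (0, 1) l a b F G" using F G by (simp add: Adm_def)
  show "\<omega> (reflect x) = \<omega> x" if x: "x \<in> D"
  proof -
    have e: "V F (reflect x) - V G (reflect x) = V F x - V G x" by (rule psi_even[OF A x])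
    then have e': "V G (reflect x) - V F (reflect x) = V G x - V F x" by linarith
    have "norm (reflect x) = norm x" by (cases x) (simp add: reflect_def norm_Pair)
    then have rD: "reflect x \<in> D" using x by (simp add: D_iff)
    have "F (reflect x) = F x" using x rD e by (subst (1 2) Fe) (simp add: indicator_def)
    moreover have "G (reflect x) = G x" using x rD e' by (subst (1 2) Ge) (simp add: indicator_def)
    ultimately show ?thesis by (simp add: \<omega>_def)
  qed
  have Rl: "R / sqrt l = R * l powr (-1/2)"
    using l by (simp add: powr_minus_divide powr_half_sqrt)
  have R0: "0 \<le> R / sqrt l" using R l by simp
  show "diameter (closure {x \<in> D. F x \<noteq> 0}) \<le> R * l powr (-1/2)"
    unfolding Rl[symmetric] by (rule closure_diameter_le[OF _ R0]) (use dF in auto)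
  show "diameter (closure {x \<in> D. - G x \<noteq> 0}) \<le> R * l powr (-1/2)"
    unfolding Rl[symmetric] by (rule closure_diameter_le[OF _ R0]) (use dG in auto)
  show "(LINT x:D|lebesgue. F x *\<^sub>R x) = (LINT x|lborel. F x *\<^sub>R x)"
    by (rule set_integral_D_lebesgue) (simp_all add: dens_off[OF F(1)])
  show "(LINT x:D|lebesgue. - G x *\<^sub>R x) = - (LINT x|lborel. G x *\<^sub>R x)"
    by (subst set_integral_D_lebesgue) (simp_all add: dens_off[OF G(1)])
qed

text \<open>Works for an arbitrary choice of one solution per \<open>l\<close>: the location
  estimates are uniform over all of them, so no continuity in \<open>l\<close> is involved.\<close>

lemma steady_limit:
  assumes a: "0 < a" and b: "0 < b" and R: "0 < R" and c: "0 < c" and s: "0 < s"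
    and uniq: "\<And>p q. 0 \<le> p \<Longrightarrow> p < 1 \<Longrightarrow> 0 \<le> q \<Longrightarrow> q < 1 \<Longrightarrow> 0 < p + q \<Longrightarrow> \<Phi> 1 (b / a) p q = 0 \<Longrightarrow> \<Phi> (b / a) 1 q p = 0 \<Longrightarrow> p = P \<and> q = Q"
    and st: "\<And>l. l0 \<le> l \<Longrightarrow> steady (0, 1) l a b c (R / sqrt l) s (F l) (G l) (\<mu> l) (\<nu> l)"
  shows "((\<lambda>l. norm (center a (F l) - (0, P))) \<longlongrightarrow> 0) at_top" "((\<lambda>l. norm (center b (G l) - (0, - Q))) \<longlongrightarrow> 0) at_top"
proof -
  have v: "norm ((0, 1) :: pt) = 1" by (simp add: norm_Pair)
  have ev: "eventually (\<lambda>l. norm (center a (F l) - (0, P)) < e \<and> norm (center b (G l) - (0, - Q)) < e) at_top" if e: "0 < e" for e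
  proof -
    have u: "(p, q) = (P, Q)" if "0 \<le> p" "p \<le> 1 - c / 4" "0 \<le> q" "q \<le> 1 - c / 4" "s / 2 \<le> p + q" "\<Phi> a b p q = 0" "\<Phi> b a q p = 0" for p q
    proof -
      have "\<Phi> 1 (b / a) p q = 0" "\<Phi> (b / a) 1 q p = 0"
        using that(6,7) \<Phi>_scale(1)[of a b p q] \<Phi>_scale(2)[of a b q p] a by simp_all
      then show ?thesis using uniq[of p q] that(1-5) c s by simp
    qed
    have r: "1 - c / 4 < 1" "0 < s / 2" using c s by auto
    obtain \<eta> where \<eta>: "0 < \<eta>"
      "\<And>p q. 0 \<le> p \<Longrightarrow> p \<le> 1 - c / 4 \<Longrightarrow> 0 \<le> q \<Longrightarrow> q \<le> 1 - c / 4 \<Longrightarrow> s / 2 \<le> p + q \<Longrightarrow> \<bar>\<Phi> a b p q\<bar> \<le> \<eta> \<Longrightarrow> \<bar>\<Phi> b a q p\<bar> \<le> \<eta> \<Longrightarrow> dist (p, q) (P, Q) < e"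
      by (rule \<Phi>_small_near_zero[OF r e u]) blast+
    show ?thesis
      using steady_location[OF a b R c s v \<eta>(1)] eventually_ge_at_top[of l0]
    proof eventually_elim
      case (elim l)
      obtain p q where pq: "center a (F l) = p *\<^sub>R (0, 1)" "center b (G l) = - (q *\<^sub>R (0, 1))"
        "0 \<le> p" "p \<le> 1 - c / 4" "0 \<le> q" "q \<le> 1 - c / 4" "s / 2 \<le> p + q" "\<bar>\<Phi> a b p q\<bar> \<le> \<eta>" "\<bar>\<Phi> b a q p\<bar> \<le> \<eta>"
        using elim(1) st[OF elim(2)] by metis
      have "dist (p, q) (P, Q) < e" by (rule \<eta>(2)[OF pq(3-9)])
      then have "dist p P < e" "dist q Q < e"
        using dist_fst_le[of "(p, q)" "(P, Q)"] dist_snd_le[of "(p, q)" "(P, Q)"] by auto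
      then show ?case unfolding pq(1,2) by (simp add: norm_Pair dist_real_def abs_minus_commute)
    qed
  qed
  show "((\<lambda>l. norm (center a (F l) - (0, P))) \<longlongrightarrow> 0) at_top" "((\<lambda>l. norm (center b (G l) - (0, - Q))) \<longlongrightarrow> 0) at_top"
    by (rule tendstoI, use ev in \<open>simp add: dist_real_def eventually_conj_iff\<close>)+
qed

text \<open>Quantifying \<open>PQ\<close> before the strengths expresses that the limit points
  depend on their ratio alone. Boundedness of the vorticity is contained in the explicit form of its
  two parts.\<close>

theorem theorem5p1:
  "\<exists>PQ :: real \<Rightarrow> real \<times> real.
   \<forall>\<kappa>1 \<kappa>2 :: real. \<kappa>1 > 0 \<longrightarrow> \<kappa>2 < 0 \<longrightarrow>
    (let p = fst (PQ (\<kappa>2 / \<kappa>1)); q = snd (PQ (\<kappa>2 / \<kappa>1)) in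
     p > 0 \<and> q < 0 \<and> (0, p) \<in> D \<and> (0, q) \<in> D \<and>
     (\<exists>l0 > 0. \<exists>C > 0. \<exists>\<omega> \<omega>1 \<omega>2 :: real \<Rightarrow> pt \<Rightarrow> real.
       (\<forall>l > l0. \<exists>\<mu>1 > 0. \<exists>\<mu>2 > 0.
          \<omega> l \<in> borel_measurable lebesgue \<and>
          \<omega>1 l = (\<lambda>x. l * indicator {y \<in> D. Gop (\<omega> l) y > \<mu>1} x) \<and>
          \<omega>2 l = (\<lambda>x. - l * indicator {y \<in> D. Gop (\<omega> l) y < - \<mu>2} x) \<and>
          \<omega> l = (\<lambda>x. \<omega>1 l x + \<omega>2 l x) \<and>
          (LINT x:D|lebesgue. \<omega>1 l x) = \<kappa>1 \<and>
          (LINT x:D|lebesgue. \<omega>2 l x) = \<kappa>2 \<and>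
          (\<forall>x \<in> D. \<omega> l (reflect x) = \<omega> l x) \<and>
          diameter (closure {x \<in> D. \<omega>1 l x \<noteq> 0}) \<le> C * l powr (-1/2) \<and>
          diameter (closure {x \<in> D. \<omega>2 l x \<noteq> 0}) \<le> C * l powr (-1/2)) \<and>
       ((\<lambda>l. norm ((1 / \<kappa>1) *\<^sub>R (LINT x:D|lebesgue. \<omega>1 l x *\<^sub>R x) - (0, p)))
          \<longlongrightarrow> 0) at_top \<and>
       ((\<lambda>l. norm ((1 / \<kappa>2) *\<^sub>R (LINT x:D|lebesgue. \<omega>2 l x *\<^sub>R x) - (0, q)))
          \<longlongrightarrow> 0) at_top))"
proof -
  have "\<forall>k>0. \<exists>P Q. 0 < P \<and> P < 1 \<and> 0 < Q \<and> Q < (1::real) \<and>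
    (\<forall>p q. 0 \<le> p \<longrightarrow> p < 1 \<longrightarrow> 0 \<le> q \<longrightarrow> q < 1 \<longrightarrow> 0 < p + q \<longrightarrow> \<Phi> 1 k p q = 0 \<longrightarrow> \<Phi> k 1 q p = 0 \<longrightarrow> p = P \<and> q = Q)"
  proof (intro allI impI)
    fix k :: real assume "0 < k"
    then show "\<exists>P Q. 0 < P \<and> P < 1 \<and> 0 < Q \<and> Q < (1::real) \<and>
    (\<forall>p q. 0 \<le> p \<longrightarrow> p < 1 \<longrightarrow> 0 \<le> q \<longrightarrow> q < 1 \<longrightarrow> 0 < p + q \<longrightarrow> \<Phi> 1 k p q = 0 \<longrightarrow> \<Phi> k 1 q p = 0 \<longrightarrow> p = P \<and> q = Q)"
      by (rule vortex_pair_position) blast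
  qed
  then obtain P Q :: "real \<Rightarrow> real" where PQ: "\<And>k. 0 < k \<Longrightarrow> 0 < P k \<and> P k < 1 \<and> 0 < Q k \<and> Q k < 1"
    and uniq: "\<And>k p q. 0 < k \<Longrightarrow> 0 \<le> p \<Longrightarrow> p < 1 \<Longrightarrow> 0 \<le> q \<Longrightarrow> q < 1 \<Longrightarrow> 0 < p + q \<Longrightarrow> \<Phi> 1 k p q = 0 \<Longrightarrow> \<Phi> k 1 q p = 0 \<Longrightarrow> p = P k \<and> q = Q k"
    by metis
  show ?thesis
  \<comment> \<open>The ratio \<rho> is negative; the positions were found for the positive
    parameter \<open>- \<rho>\<close> and for the distance of the second vortex from the origin,
    whence both signs.\<close>
  proof (rule exI[of _ "\<lambda>\<rho>. (P (- \<rho>), - Q (- \<rho>))"], intro allI impI, goal_cases)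
    case (1 \<kappa>1 \<kappa>2)
    then have \<kappa>1: "\<kappa>1 > 0" and "\<kappa>2 < 0" by simp_all
    define b where "b = - \<kappa>2"
    have b: "0 < b" and \<kappa>2: "\<kappa>2 = - b" using \<open>\<kappa>2 < 0\<close> by (simp_all add: b_def)
    define k where "k = b / \<kappa>1"
    have k: "0 < k" "- (\<kappa>2 / \<kappa>1) = k" using \<kappa>1 b by (simp_all add: k_def \<kappa>2)
    obtain R c s where R: "0 < R" "0 < c" "0 < s"
      and ev: "eventually (\<lambda>l. \<forall>v. norm v = 1 \<longrightarrow> (\<exists>F G \<mu> \<nu>. steady v l \<kappa>1 b c (R / sqrt l) s F G \<mu> \<nu>)) at_top"
      by (rule steady_exists[OF \<kappa>1 b])
    obtain l1 where l1: "\<And>l. l1 \<le> l \<Longrightarrow> \<forall>v. norm v = 1 \<longrightarrow> (\<exists>F G \<mu> \<nu>. steady v l \<kappa>1 b c (R / sqrt l) s F G \<mu> \<nu>)"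
      using ev unfolding eventually_at_top_linorder by blast
    \<comment> \<open>The maximum with 1 provides the positive threshold that is required.\<close>
    define l0 where "l0 = max l1 1"
    have l0: "0 < l0" "l1 \<le> l0" by (auto simp: l0_def)
    have "\<forall>l. \<exists>F G \<mu> \<nu>. l0 \<le> l \<longrightarrow> steady (0, 1) l \<kappa>1 b c (R / sqrt l) s F G \<mu> \<nu>"
      using l1 l0 by (metis (no_types, opaque_lifting) norm_Pair norm_zero norm_one order_trans power_zero_numeral one_power2 add_0 real_sqrt_one)
    then obtain F G \<mu> \<nu> where st: "\<And>l. l0 \<le> l \<Longrightarrow> steady (0, 1) l \<kappa>1 b c (R / sqrt l) s (F l) (G l) (\<mu> l) (\<nu> l)"
      by metis
    have lim: "((\<lambda>l. norm (center \<kappa>1 (F l) - (0, P k))) \<longlongrightarrow> 0) at_top" "((\<lambda>l. norm (center b (G l) - (0, - Q k))) \<longlongrightarrow> 0) at_top"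
      using steady_limit[OF \<kappa>1 b R, of "P k" "Q k" l0 F G \<mu> \<nu>] uniq[OF k(1)] st unfolding k_def[symmetric] by blast+
    have sol: "\<exists>\<mu>1 > 0. \<exists>\<mu>2 > 0.
          (\<lambda>x. F l x + - G l x) \<in> borel_measurable lebesgue \<and>
          F l = (\<lambda>x. l * indicator {y \<in> D. Gop (\<lambda>x. F l x + - G l x) y > \<mu>1} x) \<and>
          (\<lambda>x. - G l x) = (\<lambda>x. - l * indicator {y \<in> D. Gop (\<lambda>x. F l x + - G l x) y < - \<mu>2} x) \<and>
          (\<lambda>x. F l x + - G l x) = (\<lambda>x. F l x + - G l x) \<and>
          (LINT x:D|lebesgue. F l x) = \<kappa>1 \<and>
          (LINT x:D|lebesgue. - G l x) = \<kappa>2 \<and>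
          (\<forall>x \<in> D. F l (reflect x) + - G l (reflect x) = F l x + - G l x) \<and>
          diameter (closure {x \<in> D. F l x \<noteq> 0}) \<le> R * l powr (-1/2) \<and>
          diameter (closure {x \<in> D. - G l x \<noteq> 0}) \<le> R * l powr (-1/2)" if l: "l0 < l" for l
    proof -
      have lp: "0 < l" using l l0 by simp
      note T = steady_solution[OF st[OF less_imp_le[OF l]] R(1) lp]
      have "0 < \<mu> l" "0 < \<nu> l" using st[OF less_imp_le[OF l]] by (simp_all add: steady_def)
      then show ?thesis
        by (intro exI[of _ "\<mu> l"] exI[of _ "\<nu> l"] conjI ballI T(1-4) T(6-8) refl) (use T(5) \<kappa>2 in auto)
    qed
    have e1: "eventually (\<lambda>l. norm (center \<kappa>1 (F l) - (0, P k)) = norm ((1 / \<kappa>1) *\<^sub>R (LINT x:D|lebesgue. F l x *\<^sub>R x) - (0, P k))) at_top"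
      using eventually_gt_at_top[of l0]
    proof eventually_elim
      case (elim l)
      have lp: "0 < l" using elim l0 by simp
      show ?case using steady_solution(9)[OF st[OF less_imp_le[OF elim]] R(1) lp] by (simp add: center_def)
    qed
    have e2: "eventually (\<lambda>l. norm (center b (G l) - (0, - Q k)) = norm ((1 / \<kappa>2) *\<^sub>R (LINT x:D|lebesgue. - G l x *\<^sub>R x) - (0, - Q k))) at_top"
      using eventually_gt_at_top[of l0]
    proof eventually_elim
      case (elim l)
      have lp: "0 < l" using elim l0 by simp
      show ?case using steady_solution(10)[OF st[OF less_imp_le[OF elim]] R(1) lp] by (simp add: center_def \<kappa>2)
    qed
    have lim1: "((\<lambda>l. norm ((1 / \<kappa>1) *\<^sub>R (LINT x:D|lebesgue. F l x *\<^sub>R x) - (0, P k))) \<longlongrightarrow> 0) at_top"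
      by (rule Lim_transform_eventually[OF lim(1) e1])
    have lim2: "((\<lambda>l. norm ((1 / \<kappa>2) *\<^sub>R (LINT x:D|lebesgue. - G l x *\<^sub>R x) - (0, - Q k))) \<longlongrightarrow> 0) at_top"
      by (rule Lim_transform_eventually[OF lim(2) e2])
    have pos: "0 < P k" "- Q k < 0" "(0, P k) \<in> D" "(0, - Q k) \<in> D"
      using PQ[OF k(1)] by (auto simp: D_iff norm_Pair)
    show ?case
      unfolding Let_def fst_conv snd_conv k(2)
      by (intro conjI pos, rule exI[of _ l0], rule conjI[OF l0(1)], rule exI[of _ R], rule conjI[OF R(1)],
          rule exI[of _ "\<lambda>l x. F l x + - G l x"], rule exI[of _ F], rule exI[of _ "\<lambda>l x. - G l x"],
          intro conjI allI impI sol lim1 lim2)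
  qed
qed

end
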